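(* Let $N\ge2$, $\mathcal{L}=\partial_x^N+u_{N-2}(x)\partial_x^{N-2}+\cdots+u_0(x)$, let $\kappa_N=(-1)^{N/2+1}$ if $N$ is even and $\kappa_N\in\{1,-1\}$ (fixed) if $N$ is odd, and let $H_k^j(x,y)$ be the Hadamard's coefficients of $\partial_tv=\kappa_N\mathcal{L}v$. Then for all $j\in\{0,1,\dots,N-2\}$ and $k\in\mathbb{N}$, $$H_k^{j}(x,x)=\frac{\kappa_N^k}{(1-(j+1)/N)_k}\,\mathrm{res}_{\partial_x}\mathcal{L}^{k-\frac{j+1}{N}}.$$ Therefore the functionals $$J_{k,j}=\int H_k^{j}(x,x)\,dx,\qquad j\in\{0,1,\dots,N-2\},\ k\in\mathbb{N},$$ are first integrals of all equations $\dfrac{\partial\mathcal{L}}{\partial s_m}=\left[(\mathcal{L}^{m/N})_+,\mathcal{L}\right]$, $m\in\mathbb{N}$, of the $N$-th Gelfand-Dickey hierarchy.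
   Context: The coefficients $u_j$ are smooth functions of $x$ (depending in addition on the times $s_m$ when the hierarchy is considered; $H_k^j$ is then computed for each fixed value of the times). $(a)_k=a(a+1)\cdots(a+k-1)$ is the Pochhammer symbol. Airy-type function: $A_N(z)=A_N(z;\kappa_N)=\frac{1}{2\pi}\int_{-\infty}^{\infty}e^{iz\xi+\kappa_N(i\xi)^N}d\xi$; for $N$ odd this is understood as $\frac{1}{2\pi i}\int_{c-i\infty}^{c+i\infty}e^{z\xi+\kappa_N\xi^N}d\xi$ with any $c>0$ if $\kappa_N=(-1)^{(N+1)/2}$ and any $c<0$ if $\kappa_N=(-1)^{(N-1)/2}$. It is entire and satisfies $A_N^{(N-1)}(z)=-\frac{\kappa_N}{N}zA_N(z)$. Heat kernel and Hadamard's coefficients: the heat kernel of $\partial_tv=\kappa_N\mathcal{L}v$ is the formal expansion ($t>0$) $$\mathcal{H}(x,y,t)=\frac{1}{\sqrt[N]{t}}A_N\left(\frac{x-y}{\sqrt[N]{t}}\right)+\sum_{j=0}^{N-2}\frac{1}{\sqrt[N]{t^{j+1}}}A_N^{(j)}\left(\frac{x-y}{\sqrt[N]{t}}\right)\sum_{k=1}^{\infty}H_k^j(x,y)t^k,$$ where the $H_k^j$ are uniquely determined by: (a) for fixed $y$, $\mathcal{H}(x,y,t)$ formally solves $\partial_tv=\kappa_N\mathcal{L}v$ (i.e. after substitution and elimination of $A_N^{(N-1)}$ and higher derivatives by the Airy equation, the coefficients of each $t^{-(j+1)/N}A_N^{(j)}\left(\frac{x-y}{\sqrt[N]{t}}\right)t^k$,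 $0\le j\le N-2$, on both sides coincide); (b) the $H_k^j(x,y)$ are smooth in a neighborhood of the diagonal $y=x$. Formal pseudo-differential operators are series $R=\sum_{i\le m}r_i(x)\partial_x^i$, multiplied via $\partial_x^k\cdot r(x)=\sum_{i\ge0}\binom{k}{i}r^{(i)}(x)\partial_x^{k-i}$, $k\in\mathbb{Z}$; $R_+=\sum_{i\ge0}r_i\partial_x^i$ and $\mathrm{res}_{\partial_x}R=r_{-1}$. $\mathcal{L}^{1/N}=\partial_x+\sum_{i\le0}p_i\partial_x^i$ is the unique operator of this form whose $N$-th power is $\mathcal{L}$, and $\mathcal{L}^{m/N}=(\mathcal{L}^{1/N})^m$. First integrals are understood in the usual sense of formal variational calculus: the integrand is a differential polynomial in $u_0,\dots,u_{N-2}$, functionals $\int f\,dx$ are considered modulo total $x$-derivatives of differential polynomials, and $\int f\,dx$ is a first integral of a flow if the derivative of $f$ along the flow is a total $x$-derivative of a differential polynomial. *)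

theory Defs
  imports
    "HOL-Analysis.Analysis"
    "HOL-Library.Function_Algebras"
    "HOL-Library.Poly_Mapping"
begin

section \<open>Smooth functions\<close>

primrec Ck_on :: "nat \<Rightarrow> 'b::real_normed_vector set \<Rightarrow> ('b \<Rightarrow> 'c::real_normed_vector) \<Rightarrow> bool" where
  "Ck_on 0 S f \<longleftrightarrow> continuous_on S f"
| "Ck_on (Suc n) S f \<longleftrightarrow> (\<forall>z\<in>S. f differentiable (at z)) \<and>
     (\<forall>v. Ck_on n S (\<lambda>z. frechet_derivative f (at z) v))"

text \<open>Only used for open \<open>S\<close>.\<close>

definition smooth_on :: "'b::real_normed_vector set \<Rightarrow> ('b \<Rightarrow> 'c::real_normed_vector) \<Rightarrow> bool" where
  "smooth_on S f \<longleftrightarrow> (\<forall>n. Ck_on n S f)"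

section \<open>Formal pseudo-differential operators over a commutative ring with derivation \<open>d\<close>\<close>

text \<open>An operator is its coefficient function: \<open>R\<close> stands for the sum of \<open>R i \<partial>\<^sup>i\<close>, where
  \<open>R i = 0\<close> for all large \<open>i\<close>. The coefficient ring is used in two instances: functions
  \<open>real \<Rightarrow> 'a\<close> with the pointwise operations, and differential polynomials.\<close>

type_synonym 'r psdo = "int \<Rightarrow> 'r"

text \<open>Binomial coefficients with integer upper argument; the division is exact.\<close>

definition int_choose :: "int \<Rightarrow> nat \<Rightarrow> int" where
  "int_choose i l = (\<Prod>t<l. i - int t) div fact l"

text \<open>From \<open>\<partial>\<^sup>i \<cdot> s = (\<Sum>l. (i choose l) s\<^sup>(\<^sup>l\<^sup>) \<partial>\<^sup>i\<^sup>-\<^sup>l)\<close>, with \<open>l = i + j - n\<close>; the index set is finite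
  because the orders of \<open>R\<close> and \<open>S\<close> are bounded above.\<close>

definition psdo_mult :: "('r \<Rightarrow> 'r) \<Rightarrow> 'r::comm_ring_1 psdo \<Rightarrow> 'r psdo \<Rightarrow> 'r psdo" where
  "psdo_mult d R S n =
     (\<Sum>(i, j) | R i \<noteq> 0 \<and> S j \<noteq> 0 \<and> n \<le> i + j.
        of_int (int_choose i (nat (i + j - n))) * R i * (d ^^ nat (i + j - n)) (S j))"

primrec psdo_power :: "('r \<Rightarrow> 'r) \<Rightarrow> 'r::comm_ring_1 psdo \<Rightarrow> nat \<Rightarrow> 'r psdo" where
  "psdo_power d R 0 = (\<lambda>i. if i = 0 then 1 else 0)"
| "psdo_power d R (Suc n) = psdo_mult d R (psdo_power d R n)"

definition psdo_plus_part :: "'r::zero psdo \<Rightarrow> 'r psdo" where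
  "psdo_plus_part R = (\<lambda>i. if i \<ge> 0 then R i else 0)"

definition psdo_res :: "'r psdo \<Rightarrow> 'r" where
  "psdo_res R = R (-1)"

definition psdo_commutator :: "('r \<Rightarrow> 'r) \<Rightarrow> 'r::comm_ring_1 psdo \<Rightarrow> 'r psdo \<Rightarrow> 'r psdo" where
  "psdo_commutator d P Q = (\<lambda>n. psdo_mult d P Q n - psdo_mult d Q P n)"

definition psdo_root :: "('r \<Rightarrow> 'r) \<Rightarrow> nat \<Rightarrow> 'r::comm_ring_1 psdo \<Rightarrow> 'r psdo" where
  "psdo_root d N L = (THE R. R 1 = 1 \<and> (\<forall>i>1. R i = 0) \<and> psdo_power d R N = L)"

text \<open>\<open>frac_power d N L m\<close> is \<open>L\<close> to the power \<open>m / N\<close>.\<close>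

definition frac_power :: "('r \<Rightarrow> 'r) \<Rightarrow> nat \<Rightarrow> 'r::comm_ring_1 psdo \<Rightarrow> nat \<Rightarrow> 'r psdo" where
  "frac_power d N L m = psdo_power d (psdo_root d N L) m"

definition GD_op :: "nat \<Rightarrow> (nat \<Rightarrow> 'r::comm_ring_1) \<Rightarrow> 'r psdo" where
  "GD_op N u = (\<lambda>i. if i = int N then 1 else if 0 \<le> i \<and> i \<le> int N - 2 then u (nat i) else 0)"

text \<open>The derivation on functions. For coefficients that are smooth only on an open set \<open>I\<close>,
  operators are computed in the ring of all functions; their values at points of \<open>I\<close> do not depend
  on the values of the coefficients outside \<open>I\<close>.\<close>

definition Dfun :: "(real \<Rightarrow> 'a::real_normed_field) \<Rightarrow> real \<Rightarrow> 'a" where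
  "Dfun f = (\<lambda>x. vector_derivative f (at x))"

section \<open>Hadamard's coefficients\<close>

text \<open>Fix \<open>y\<close>, and write \<open>E\<^sub>j = t\<^bsup>-(j+1)/N\<^esup> A\<^sub>N\<^sup>(\<^sup>j\<^sup>)((x - y) / t\<^bsup>1/N\<^esup>)\<close>. A formal expansion in which the
  derivatives of order at least \<open>N - 1\<close> of \<open>A\<^sub>N\<close> have been eliminated is represented by its
  coefficients: \<open>c j k x\<close> is the coefficient of \<open>E\<^sub>j t\<^sup>k\<close>, where \<open>j \<le> N - 2\<close> and \<open>k\<close> is an integer.
  The chain rule gives
    \<open>\<partial>\<^sub>x E\<^sub>j = E\<^sub>j\<^sub>+\<^sub>1\<close> and \<open>\<partial>\<^sub>t E\<^sub>j = - (j + 1)/N t\<^sup>-\<^sup>1 E\<^sub>j - (x - y)/N t\<^sup>-\<^sup>1 E\<^sub>j\<^sub>+\<^sub>1\<close>,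
  and the Airy equation \<open>A\<^sub>N\<^bsup>(N-1)\<^esup>(z) = - \<kappa>/N z A\<^sub>N(z)\<close> reads
    \<open>E\<^bsub>N-1\<^esub> = - \<kappa>/N (x - y) t\<^sup>-\<^sup>1 E\<^sub>0\<close>.
  Eliminating \<open>E\<^bsub>N-1\<^esub>\<close> after each differentiation eliminates the higher derivatives of \<open>A\<^sub>N\<close> by the
  derivatives of the Airy equation.\<close>

type_synonym 'a airy_expansion = "nat \<Rightarrow> int \<Rightarrow> real \<Rightarrow> 'a"

text \<open>The linear map \<open>E\<^sub>j \<mapsto> E\<^sub>j\<^sub>+\<^sub>1\<close> followed by the elimination of \<open>E\<^bsub>N-1\<^esub>\<close>.\<close>

definition airy_shift ::
  "nat \<Rightarrow> 'a \<Rightarrow> real \<Rightarrow> 'a::real_normed_field airy_expansion \<Rightarrow> 'a airy_expansion" where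
  "airy_shift N \<kappa> y c j k x =
     (if j = 0 then - (\<kappa> / of_nat N) * of_real (x - y) * c (N - 2) (k + 1) x else c (j - 1) k x)"

definition airy_dx ::
  "nat \<Rightarrow> 'a \<Rightarrow> real \<Rightarrow> 'a::real_normed_field airy_expansion \<Rightarrow> 'a airy_expansion" where
  "airy_dx N \<kappa> y c j k x = Dfun (c j k) x + airy_shift N \<kappa> y c j k x"

definition airy_dt ::
  "nat \<Rightarrow> 'a \<Rightarrow> real \<Rightarrow> 'a::real_normed_field airy_expansion \<Rightarrow> 'a airy_expansion" where
  "airy_dt N \<kappa> y c j k x =
     (of_int (k + 1) - of_nat (j + 1) / of_nat N) * c j (k + 1) x
     - of_real (x - y) / of_nat N * airy_shift N \<kappa> y c j (k + 1) x"

definition airy_L ::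
  "nat \<Rightarrow> 'a \<Rightarrow> (nat \<Rightarrow> real \<Rightarrow> 'a) \<Rightarrow> real \<Rightarrow> 'a::real_normed_field airy_expansion \<Rightarrow> 'a airy_expansion" where
  "airy_L N \<kappa> u y c j k x = (\<Sum>i\<le>N. GD_op N u (int i) x * (airy_dx N \<kappa> y ^^ i) c j k x)"

text \<open>\<open>H k j x y\<close> is \<open>H\<^sub>k\<^sup>j(x, y)\<close>, for \<open>k \<ge> 1\<close>; the leading term of the kernel is \<open>E\<^sub>0\<close>.\<close>

definition heat_kernel ::
  "(nat \<Rightarrow> nat \<Rightarrow> real \<Rightarrow> real \<Rightarrow> 'a::real_normed_field) \<Rightarrow> real \<Rightarrow> 'a airy_expansion" where
  "heat_kernel H y j k x =
     (if k \<ge> 1 then H (nat k) j x y else if k = 0 \<and> j = 0 then 1 else 0)"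

definition Hadamard_coefficients ::
  "nat \<Rightarrow> 'a \<Rightarrow> real set \<Rightarrow> (nat \<Rightarrow> real \<Rightarrow> 'a) \<Rightarrow>
   (nat \<Rightarrow> nat \<Rightarrow> real \<Rightarrow> real \<Rightarrow> 'a::real_normed_field) \<Rightarrow> bool" where
  "Hadamard_coefficients N \<kappa> I u H \<longleftrightarrow>
     (\<exists>W. open W \<and> W \<subseteq> I \<times> I \<and> (\<forall>x\<in>I. (x, x) \<in> W) \<and>
        (\<forall>k\<ge>1. \<forall>j\<le>N - 2. smooth_on W (\<lambda>(x, y). H k j x y)) \<and>
        (\<forall>(x, y)\<in>W. \<forall>j\<le>N - 2. \<forall>k.
           airy_dt N \<kappa> y (heat_kernel H y) j k x
           = \<kappa> * airy_L N \<kappa> u y (heat_kernel H y) j k x))"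

section \<open>Differential polynomials and first integrals\<close>

text \<open>Polynomials in the variables \<open>(i, l)\<close>, which stand for the \<open>l\<close>-th derivative of \<open>u\<^sub>i\<close>.\<close>

type_synonym 'a dpoly = "((nat \<times> nat) \<Rightarrow>\<^sub>0 nat) \<Rightarrow>\<^sub>0 'a"

definition dvar :: "nat \<Rightarrow> nat \<Rightarrow> 'a::comm_ring_1 dpoly" where
  "dvar i l = Poly_Mapping.single (Poly_Mapping.single (i, l) 1) 1"

text \<open>Those that involve only \<open>u\<^sub>0, \<dots>, u\<^bsub>N-2\<^esub>\<close>.\<close>

definition diff_polys :: "nat \<Rightarrow> 'a::comm_ring_1 dpoly set" where
  "diff_polys N = {f. \<forall>m\<in>Poly_Mapping.keys f. \<forall>(i, l)\<in>Poly_Mapping.keys m. i \<le> N - 2}"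

definition dpoly_eval :: "(nat \<Rightarrow> real \<Rightarrow> 'a) \<Rightarrow> 'a::real_normed_field dpoly \<Rightarrow> real \<Rightarrow> 'a" where
  "dpoly_eval u f x =
     (\<Sum>m\<in>Poly_Mapping.keys f. Poly_Mapping.lookup f m *
        (\<Prod>(i, l)\<in>Poly_Mapping.keys m. ((Dfun ^^ l) (u i) x) ^ Poly_Mapping.lookup m (i, l)))"

text \<open>The derivation that is zero on constants and maps each variable \<open>v\<close> to \<open>X v\<close>.\<close>

definition dpoly_derivation :: "(nat \<times> nat \<Rightarrow> 'a dpoly) \<Rightarrow> 'a::comm_ring_1 dpoly \<Rightarrow> 'a dpoly" where
  "dpoly_derivation X f =
     (\<Sum>m\<in>Poly_Mapping.keys f. \<Sum>v\<in>Poly_Mapping.keys m.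
        Poly_Mapping.single (m - Poly_Mapping.single v 1)
          (Poly_Mapping.lookup f m * of_nat (Poly_Mapping.lookup m v)) * X v)"

definition Dx :: "'a::comm_ring_1 dpoly \<Rightarrow> 'a dpoly" where
  "Dx = dpoly_derivation (\<lambda>(i, l). dvar i (Suc l))"

definition generic_L :: "nat \<Rightarrow> 'a::comm_ring_1 dpoly psdo" where
  "generic_L N = GD_op N (\<lambda>i. dvar i 0)"

definition GD_rhs :: "nat \<Rightarrow> nat \<Rightarrow> 'a::comm_ring_1 dpoly psdo" where
  "GD_rhs N m =
     psdo_commutator Dx (psdo_plus_part (frac_power Dx N (generic_L N) m)) (generic_L N)"

text \<open>The derivative along the \<open>m\<close>-th flow: \<open>\<partial>u\<^sub>i/\<partial>s\<^sub>m\<close> is the \<open>i\<close>-th coefficient of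
  \<open>[(L\<^bsup>m/N\<^esup>)\<^sub>+, L]\<close>, and \<open>\<partial>/\<partial>s\<^sub>m\<close> commutes with \<open>Dx\<close>.\<close>

definition GD_flow :: "nat \<Rightarrow> nat \<Rightarrow> 'a::comm_ring_1 dpoly \<Rightarrow> 'a dpoly" where
  "GD_flow N m = dpoly_derivation (\<lambda>(i, l). (Dx ^^ l) (GD_rhs N m (int i)))"

text \<open>The functional with integrand \<open>f\<close> is a first integral of the \<open>m\<close>-th flow.\<close>

definition GD_first_integral :: "nat \<Rightarrow> nat \<Rightarrow> 'a::comm_ring_1 dpoly \<Rightarrow> bool" where
  "GD_first_integral N m f \<longleftrightarrow> (\<exists>g\<in>diff_polys N. GD_flow N m f = Dx g)"

end

theory Submission
  imports Defs
begin

text \<open>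
  Fix \<open>y\<close> and expand everything in powers of \<open>x - y\<close>. Expansions \<open>\<Sum> h\<^sub>k\<^sup>j t\<^sup>k E\<^sub>j\<close> are turned into
  pseudo-differential operators \<open>R = \<Sum> h\<^sub>k\<^sup>j \<partial>\<^sup>j T\<^sup>k\<close> with \<open>T = - (\<kappa>/N) \<partial>\<^bsup>1-N\<^esup> (x - y)\<close>: multiplication by \<open>T\<close>
  from the right plays the role of \<open>t\<close>, because the Airy equation reads \<open>(x - y) E\<^sub>0 = - N \<kappa> t E\<^bsub>N-1\<^esub>\<close>, and
  multiplication by \<open>\<kappa> \<partial>\<^sup>N\<close> from the right the role of \<open>\<partial>\<^sub>t\<close>. So the heat equation says \<open>L R = R \<partial>\<^sup>N\<close>, whence
  \<open>L\<^bsup>p/N\<^esup> R = R \<partial>\<^sup>p\<close> for all \<open>p\<close>. Since \<open>R - 1\<close> ends with a factor \<open>x - y\<close> on the right, the residue of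
  \<open>L\<^bsup>p/N\<^esup> R\<close> at \<open>x = y\<close> is that of \<open>L\<^bsup>p/N\<^esup>\<close>. The residue of \<open>R \<partial>\<^sup>p\<close> at \<open>x = y\<close> is read off from
  \<open>\<partial>\<^sup>j T\<^sup>k = \<kappa>\<^sup>k (1 - (j + 1)/N)\<^sub>k \<partial>\<^bsup>j-kN\<^esup>\<close> at \<open>x = y\<close>, and \<open>p = k N - j - 1\<close> gives the formula.
  Conservation follows from \<open>\<partial>L\<^bsup>p/N\<^esup>/\<partial>s\<^sub>m = [(L\<^bsup>m/N\<^esup>)\<^sub>+, L\<^bsup>p/N\<^esup>]\<close>, as residues of commutators are total derivatives.
\<close>

text \<open>The dictionary arises from letting operators act on v = \<open>E\<^sub>0\<close>.
  Multiplication by t commutes with R, so t (R v) = R (t v). The obstacle is that the leading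
  coefficient of T is a multiple of x - y. Over power series T has no inverse, while differentiating
  an expansion may bring in a factor 1/t. Identities are therefore multiplied by a power of t before
  they are translated, and powers of T are cancelled afterwards. Cancellation needs x - y not to be
  a zero divisor, and associativity needs a genuine derivation. Both fail in the ring of all
  functions with \<open>Dfun\<close>; this is why Taylor series are used. The residues of the
  theorem live in that ring of functions and the conserved densities in the ring of differential
  polynomials, so roots and their powers have to be carried from one coefficient ring to
  another.\<close>

lemma sum_fun_apply: "(\<Sum>k\<in>K. F k) x = (\<Sum>k\<in>K. F k x)"
  for F :: "'k \<Rightarrow> 'x \<Rightarrow> 'r::comm_monoid_add"
  by (induction K rule: infinite_finite_induct) auto

section \<open>Binomial coefficients\<close>

lemma int_choose_0 [simp]: "int_choose i 0 = 1"
  by (simp add: int_choose_def)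

lemma int_choose_1 [simp]: "int_choose i (Suc 0) = i"
  by (simp add: int_choose_def)

text \<open>A product of l consecutive integers is a Pochhammer value and hence divisible by
  \<open>fact l\<close>, so \<open>div\<close> loses nothing. Over \<open>rat\<close> the identities
  for \<open>gchoose\<close> become available.\<close>

lemma of_int_int_choose: "(of_int (int_choose i l) :: rat) = of_int i gchoose l"
proof -
  have "(\<Prod>t<l. i - int t) = pochhammer (i - int l + 1) l"
    using falling_fact_pochhammer'[of i l] by (simp add: atLeast0LessThan)
  then have "fact l dvd (\<Prod>t<l. i - int t)" by (simp add: fact_dvd_pochhammer)
  moreover have "b dvd a \<Longrightarrow> (of_int (a div b) :: rat) = of_int a / of_int b" for a b by auto
  ultimately have e: "(of_int ((\<Prod>t<l. i - int t) div fact l) :: rat) = of_int (\<Prod>t<l. i - int t) / of_int (fact l)"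
    by blast
  show ?thesis
    unfolding int_choose_def e by (simp add: gbinomial_prod_rev atLeast0LessThan)
qed

lemma int_choose_eq_0: "0 \<le> i \<Longrightarrow> i < int l \<Longrightarrow> int_choose i l = 0"
  unfolding int_choose_def by (subst prod_zero) (auto intro!: bexI[of _ "nat i"])

lemma int_choose_negated_upper: "int_choose i l = (-1) ^ l * int_choose (int l - i - 1) l"
proof -
  have "(of_int (int_choose i l) :: rat) = of_int ((-1) ^ l * int_choose (int l - i - 1) l)"
    by (simp add: of_int_int_choose gbinomial_negated_upper[of "of_int i"])
  then show ?thesis by (simp only: of_int_eq_iff)
qed

lemma int_choose_Vandermonde:
  "(\<Sum>p\<le>n. int_choose a p * int_choose b (n - p)) = int_choose (a + b) n"
proof -
  have "(of_int (\<Sum>p\<le>n. int_choose a p * int_choose b (n - p)) :: rat) = of_int (int_choose (a + b) n)"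
    by (simp add: of_int_int_choose gbinomial_Vandermonde[symmetric] atLeast0AtMost)
  then show ?thesis by (simp only: of_int_eq_iff)
qed

lemma int_choose_trinomial:
  assumes "l \<le> q"
  shows "int_choose a q * int (q choose l) = int_choose a l * int_choose (a - int l) (q - l)"
proof -
  have "(of_int (int_choose a q * int (q choose l)) :: rat)
      = of_int (int_choose a l * int_choose (a - int l) (q - l))"
    using gbinomial_trinomial_revision[of l q "of_int a :: rat"] assms
    by (simp add: of_int_int_choose binomial_gbinomial)
  then show ?thesis by (simp only: of_int_eq_iff)
qed

text \<open>The identity behind associativity: it compares the numerical factor of the l-th
  derivative of s times the (n-l)-th derivative of w in the two bracketings of a product of three
  monomials. Trinomial revision splits off \<open>int_choose i l\<close>, and Vandermonde sums the
  rest.\<close>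

lemma int_choose_assoc:
  assumes "l \<le> n"
  shows "(\<Sum>p\<le>n - l. int_choose i (n - p) * int ((n - p) choose l) * int_choose j p)
    = int_choose i l * int_choose (i + j - int l) (n - l)"
proof -
  have "(\<Sum>p\<le>n - l. int_choose i (n - p) * int ((n - p) choose l) * int_choose j p)
    = (\<Sum>p\<le>n - l. int_choose i l * (int_choose j p * int_choose (i - int l) (n - l - p)))"
  proof (rule sum.cong[OF refl])
    fix p assume "p \<in> {..n - l}"
    then have "l \<le> n - p" and e: "n - p - l = n - l - p" using assms by auto
    from int_choose_trinomial[OF this(1), of i] e
    show "int_choose i (n - p) * int ((n - p) choose l) * int_choose j p
      = int_choose i l * (int_choose j p * int_choose (i - int l) (n - l - p))" by simp
  qed
  also have "\<dots> = int_choose i l * int_choose (j + (i - int l)) (n - l)"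
    by (simp only: sum_distrib_left[symmetric] int_choose_Vandermonde)
  finally show ?thesis by (simp add: algebra_simps)
qed

section \<open>Pseudo-differential operators\<close>

definition order_le :: "int \<Rightarrow> 'r::zero psdo \<Rightarrow> bool" where
  "order_le a R \<longleftrightarrow> (\<forall>i>a. R i = 0)"

definition pmono :: "'r::zero \<Rightarrow> int \<Rightarrow> 'r psdo" where
  "pmono a i = (\<lambda>n. if n = i then a else 0)"

lemma order_leD: "order_le a R \<Longrightarrow> a < i \<Longrightarrow> R i = 0"
  by (simp add: order_le_def)

lemma order_le_mono: "order_le a R \<Longrightarrow> a \<le> b \<Longrightarrow> order_le b R"
  by (simp add: order_le_def)

lemma order_le_pmono [intro]: "i \<le> a \<Longrightarrow> order_le a (pmono r i)"
  by (simp add: order_le_def pmono_def)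

lemma order_le_0 [simp]: "order_le a (0 :: 'r::zero psdo)"
  by (simp add: order_le_def)

lemma order_le_add: "order_le a R \<Longrightarrow> order_le a S \<Longrightarrow> order_le a (R + S)"
  for R S :: "'r::monoid_add psdo"
  by (simp add: order_le_def)

lemma order_le_diff: "order_le a R \<Longrightarrow> order_le a S \<Longrightarrow> order_le a (R - S)"
  for R S :: "'r::group_add psdo"
  by (simp add: order_le_def)

lemma order_le_sum: "(\<And>k. k \<in> K \<Longrightarrow> order_le a (F k)) \<Longrightarrow> order_le a (\<Sum>k\<in>K. F k)"
  for F :: "'k \<Rightarrow> 'r::comm_monoid_add psdo"
  by (simp add: order_le_def sum_fun_apply)

lemma pmono_sum_above:
  fixes R :: "'r::comm_monoid_add psdo"
  assumes "order_le a R" "A \<le> i"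
  shows "(\<Sum>k\<in>{A..a}. pmono (R k) k) i = R i"
proof -
  have "(\<Sum>k\<in>{A..a}. pmono (R k) k) i = (\<Sum>k\<in>{A..a}. if k = i then R k else 0)"
    by (auto simp: sum_fun_apply pmono_def intro!: sum.cong)
  also have "\<dots> = R i" using assms by (simp add: order_le_def)
  finally show ?thesis .
qed

text \<open>\<open>Dfun\<close> is neither additive nor a derivation on functions that are not
  differentiable. Products, powers and roots can be set up from these two laws alone, so they make
  sense in the ring of all functions as well.\<close>

locale pre_derivation =
  fixes d :: "'r::comm_ring_1 \<Rightarrow> 'r"
  assumes d_0 [simp]: "d 0 = 0" and d_1 [simp]: "d 1 = 0"
begin

abbreviation pmult (infixl "\<odot>" 70) where "R \<odot> S \<equiv> psdo_mult d R S"

lemma d_funpow_0 [simp]: "(d ^^ n) 0 = 0"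
  by (induction n) auto

lemma d_funpow_1: "(d ^^ n) 1 = (if n = 0 then 1 else 0)"
  by (cases n) (simp_all add: funpow_swap1 del: funpow.simps(2) add: funpow_Suc_right)

lemma psdo_mult_eq:
  assumes R: "order_le a R" and S: "order_le b S"
  shows "(R \<odot> S) n = (\<Sum>i\<in>{n-b..a}. \<Sum>j\<in>{n-i..b}.
    of_int (int_choose i (nat (i + j - n))) * R i * (d ^^ nat (i + j - n)) (S j))"
proof -
  let ?f = "\<lambda>i j. of_int (int_choose i (nat (i + j - n))) * R i * (d ^^ nat (i + j - n)) (S j)"
  have "(R \<odot> S) n = (\<Sum>(i, j)\<in>Sigma {n-b..a} (\<lambda>i. {n-i..b}). ?f i j)"
    unfolding psdo_mult_def
  proof (rule sum.mono_neutral_left)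
    show "{(i, j). R i \<noteq> 0 \<and> S j \<noteq> 0 \<and> n \<le> i + j} \<subseteq> Sigma {n-b..a} (\<lambda>i. {n-i..b})"
      using R S by (force simp: order_le_def not_less[symmetric])
  qed (auto)
  then show ?thesis by (simp add: sum.Sigma)
qed

text \<open>A term of the coefficient at n needs i + j \<ge> n, while i \<le> a and j \<le> b. Hence
  finitely many coefficients of each factor matter, which allows operators to be replaced by
  truncations.\<close>

lemma psdo_mult_cong:
  assumes "order_le a R" "order_le a R'" "order_le b S" "order_le b S'"
    and "\<And>i. n - b \<le> i \<Longrightarrow> R i = R' i" "\<And>j. n - a \<le> j \<Longrightarrow> S j = S' j"
  shows "(R \<odot> S) n = (R' \<odot> S') n"
  by (simp add: psdo_mult_eq[OF assms(1,3)] psdo_mult_eq[OF assms(2,4)], intro sum.cong refl)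
    (use assms(5,6) in auto)

lemma order_le_mult [intro]:
  assumes "order_le a R" "order_le b S" shows "order_le (a + b) (R \<odot> S)"
  unfolding order_le_def by (simp add: psdo_mult_eq[OF assms])

lemma psdo_mult_top:
  assumes "order_le a R" "order_le b S" shows "(R \<odot> S) (a + b) = R a * S b"
  by (simp add: psdo_mult_eq[OF assms])

lemma psdo_mult_pmono_left:
  assumes "order_le b S"
  shows "(pmono r i \<odot> S) n = (\<Sum>j\<in>{n-i..b}.
    of_int (int_choose i (nat (i + j - n))) * r * (d ^^ nat (i + j - n)) (S j))"
proof -
  have "(pmono r i \<odot> S) n = (\<Sum>i'\<in>{n-b..i}. if i' = i then (\<Sum>j\<in>{n-i..b}.
    of_int (int_choose i (nat (i + j - n))) * r * (d ^^ nat (i + j - n)) (S j)) else 0)"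
    unfolding psdo_mult_eq[OF order_le_pmono[OF order_refl] assms]
    by (rule sum.cong[OF refl]) (simp add: pmono_def)
  also have "\<dots> = (\<Sum>j\<in>{n-i..b}.
    of_int (int_choose i (nat (i + j - n))) * r * (d ^^ nat (i + j - n)) (S j))" by simp
  finally show ?thesis .
qed

lemma psdo_mult_pmono_right:
  assumes "order_le a R"
  shows "(R \<odot> pmono s j) n = (\<Sum>i\<in>{n-j..a}.
    of_int (int_choose i (nat (i + j - n))) * R i * (d ^^ nat (i + j - n)) s)"
proof -
  have "(\<Sum>j'\<in>{n-i..j}. of_int (int_choose i (nat (i + j' - n))) * R i
          * (d ^^ nat (i + j' - n)) (pmono s j j'))
      = of_int (int_choose i (nat (i + j - n))) * R i * (d ^^ nat (i + j - n)) s" if "n - j \<le> i" for i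
  proof -
    have "(\<Sum>j'\<in>{n-i..j}. of_int (int_choose i (nat (i + j' - n))) * R i
          * (d ^^ nat (i + j' - n)) (pmono s j j'))
      = (\<Sum>j'\<in>{n-i..j}. if j' = j then of_int (int_choose i (nat (i + j - n))) * R i
          * (d ^^ nat (i + j - n)) s else 0)"
      by (intro sum.cong) (auto simp: pmono_def)
    then show ?thesis using that by simp
  qed
  then show ?thesis
    by (subst psdo_mult_eq[OF assms order_le_pmono[OF order_refl]]) (auto intro!: sum.cong)
qed

lemma psdo_mult_pmono_pmono:
  "(pmono r i \<odot> pmono s j) n = (if n \<le> i + j
    then of_int (int_choose i (nat (i + j - n))) * r * (d ^^ nat (i + j - n)) s else 0)"
proof -
  have "(pmono r i \<odot> pmono s j) n = (\<Sum>i'\<in>{n-j..i}. if i' = i then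
    of_int (int_choose i (nat (i + j - n))) * r * (d ^^ nat (i + j - n)) s else 0)"
    unfolding psdo_mult_pmono_right[OF order_le_pmono[OF order_refl]]
    by (rule sum.cong[OF refl]) (simp add: pmono_def)
  then show ?thesis by simp
qed

lemma psdo_mult_1_left:
  assumes "order_le b S" shows "pmono 1 0 \<odot> S = S"
proof
  fix n
  have "(pmono 1 0 \<odot> S) n = (\<Sum>j\<in>{n..b}. if j = n then S n else 0)"
    by (subst psdo_mult_pmono_left[OF assms], rule sum.cong) (auto simp: int_choose_eq_0)
  also have "\<dots> = S n" using assms by (simp add: order_le_def)
  finally show "(pmono 1 0 \<odot> S) n = S n" .
qed

lemma psdo_mult_pmono_1:
  assumes "order_le a R" shows "(R \<odot> pmono 1 j) n = R (n - j)"
proof -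
  have "(R \<odot> pmono 1 j) n = (\<Sum>i\<in>{n-j..a}. if i = n - j then R i else 0)"
    by (subst psdo_mult_pmono_right[OF assms], rule sum.cong) (auto simp: d_funpow_1)
  also have "\<dots> = R (n - j)" using assms by (simp add: order_le_def)
  finally show ?thesis .
qed

lemma psdo_mult_1_right: "order_le a R \<Longrightarrow> R \<odot> pmono 1 0 = R"
  by (rule ext) (simp add: psdo_mult_pmono_1)

lemma psdo_power_0: "psdo_power d R 0 = pmono 1 0"
  by (auto simp: pmono_def)

end

section \<open>Leibniz rule, distributivity and associativity over a differential ring\<close>

locale derivation = 
  fixes d :: "'r::comm_ring_1 \<Rightarrow> 'r"
  assumes d_add [simp]: "d (a + b) = d a + d b"
    and d_mult: "d (a * b) = a * d b + d a * b"
begin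

sublocale pre_derivation d
proof
  show "d 0 = 0" using d_add[of 0 0] by simp
  show "d 1 = 0" using d_mult[of 1 1] by simp
qed

lemma d_uminus [simp]: "d (- a) = - d a"
  using d_add[of a "-a"] by (simp add: minus_unique)

lemma d_diff [simp]: "d (a - b) = d a - d b"
  using d_add[of a "-b"] by simp

lemma d_sum: "d (\<Sum>k\<in>K. f k) = (\<Sum>k\<in>K. d (f k))"
  by (induction K rule: infinite_finite_induct) auto

lemma d_funpow_add: "(d ^^ n) (a + b) = (d ^^ n) a + (d ^^ n) b"
  by (induction n) auto

lemma d_of_nat [simp]: "d (of_nat k) = 0"
  by (induction k) auto

lemma d_of_int [simp]: "d (of_int k) = 0"
  by (cases k) auto

lemma d_funpow_of_int_mult: "(d ^^ n) (of_int k * a) = of_int k * (d ^^ n) a"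
  by (induction n) (auto simp: d_mult)

lemma d_funpow_mult:
  "(d ^^ n) (a * b) = (\<Sum>k\<le>n. of_nat (n choose k) * (d ^^ k) a * (d ^^ (n - k)) b)"
proof (induction n)
  case (Suc n)
  have "(d ^^ Suc n) (a * b) = (\<Sum>k\<le>n. of_nat (n choose k) * (d ^^ k) a * (d ^^ (Suc n - k)) b)
      + (\<Sum>k\<le>n. of_nat (n choose k) * (d ^^ Suc k) a * (d ^^ (n - k)) b)"
    by (simp add: Suc.IH d_sum d_mult sum.distrib[symmetric] Suc_diff_le algebra_simps)
  also have "(\<Sum>k\<le>n. of_nat (n choose k) * (d ^^ k) a * (d ^^ (Suc n - k)) b)
     = a * (d ^^ Suc n) b + (\<Sum>k\<le>n. of_nat (n choose Suc k) * (d ^^ Suc k) a * (d ^^ (n - k)) b)"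
  proof -
    have "(\<Sum>k\<le>n. of_nat (n choose k) * (d ^^ k) a * (d ^^ (Suc n - k)) b)
      = (\<Sum>k\<le>Suc n. of_nat (n choose k) * (d ^^ k) a * (d ^^ (Suc n - k)) b)"
      by (simp add: binomial_eq_0)
    also have "\<dots> = a * (d ^^ Suc n) b + (\<Sum>k\<le>n. of_nat (n choose Suc k) * (d ^^ Suc k) a * (d ^^ (n - k)) b)"
      by (subst sum.atMost_Suc_shift) simp
    finally show ?thesis .
  qed
  finally have "(d ^^ Suc n) (a * b) = a * (d ^^ Suc n) b
     + (\<Sum>k\<le>n. of_nat (Suc n choose Suc k) * (d ^^ Suc k) a * (d ^^ (n - k)) b)"
    by (simp add: sum.distrib[symmetric] algebra_simps)
  then show ?case by (simp add: sum.atMost_Suc_shift del: sum.atMost_Suc)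
qed simp

lemma psdo_mult_add_left:
  assumes "order_le a R" "order_le a R'" "order_le b S"
  shows "(R + R') \<odot> S = R \<odot> S + R' \<odot> S"
  using order_le_add[OF assms(1,2)] assms
  by (auto simp: psdo_mult_eq algebra_simps sum.distrib)

lemma psdo_mult_add_right:
  assumes "order_le a R" "order_le b S" "order_le b S'"
  shows "R \<odot> (S + S') = R \<odot> S + R \<odot> S'"
  using order_le_add[OF assms(2,3)] assms
  by (auto simp: psdo_mult_eq algebra_simps sum.distrib d_funpow_add)

lemma psdo_mult_diff_left:
  assumes "order_le a R" "order_le a R'" "order_le b S"
  shows "(R - R') \<odot> S = R \<odot> S - R' \<odot> S"
  using psdo_mult_add_left[OF order_le_diff[OF assms(1,2)] assms(2,3)] by (simp add: algebra_simps)

lemma psdo_mult_diff_right: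
  assumes "order_le a R" "order_le b S" "order_le b S'"
  shows "R \<odot> (S - S') = R \<odot> S - R \<odot> S'"
  using psdo_mult_add_right[OF assms(1) order_le_diff[OF assms(2,3)] assms(3)] by (simp add: algebra_simps)

lemma psdo_mult_0_left [simp]: "0 \<odot> S = 0" and psdo_mult_0_right [simp]: "R \<odot> 0 = 0"
  by (auto simp: psdo_mult_def)

lemma psdo_mult_sum_left:
  assumes "\<And>k. k \<in> K \<Longrightarrow> order_le a (F k)" "order_le b S"
  shows "(\<Sum>k\<in>K. F k) \<odot> S = (\<Sum>k\<in>K. F k \<odot> S)"
  using assms
proof (induction K rule: infinite_finite_induct)
  case (insert x K)
  have "(F x + sum F K) \<odot> S = F x \<odot> S + sum F K \<odot> S"
    by (rule psdo_mult_add_left[where a=a and b=b]) (use insert.prems in \<open>auto intro: order_le_sum\<close>)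
  with insert.IH insert.prems show ?case
    by (simp only: sum.insert[OF insert.hyps] insertI1 insertI2 simp_thms)
qed auto

lemma psdo_mult_sum_right:
  assumes "order_le a R" "\<And>k. k \<in> K \<Longrightarrow> order_le b (F k)"
  shows "R \<odot> (\<Sum>k\<in>K. F k) = (\<Sum>k\<in>K. R \<odot> F k)"
  using assms
proof (induction K rule: infinite_finite_induct)
  case (insert x K)
  have "R \<odot> (F x + sum F K) = R \<odot> F x + R \<odot> sum F K"
    by (rule psdo_mult_add_right[where a=a and b=b]) (use insert.prems in \<open>auto intro: order_le_sum\<close>)
  with insert.IH insert.prems show ?case
    by (simp only: sum.insert[OF insert.hyps] insertI1 insertI2 simp_thms)
qed auto

lemma int_sum_reindex_down: "(\<Sum>i\<in>{n - m..n'}. f i) = (\<Sum>l\<le>nat (n' - (n - m)). f (n' - int l))"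
  if "n - m \<le> n'" for n m n' :: int and f :: "int \<Rightarrow> 'b::comm_monoid_add"
  by (rule sum.reindex_bij_witness[where i="\<lambda>l. n' - int l" and j="\<lambda>i. nat (n' - i)"])
    (use that in auto)

lemma sum_triangle_swap: "(\<Sum>l\<le>M. \<Sum>p\<le>M - l. f l p) = (\<Sum>p\<le>M. \<Sum>l\<le>M - p. f l p)"
  for f :: "nat \<Rightarrow> nat \<Rightarrow> 'b::comm_monoid_add"
  by (simp add: sum.Sigma, rule sum.reindex_bij_witness[where i=prod.swap and j=prod.swap]) auto

lemma psdo_mult_assoc_pmono:
  "(pmono r i \<odot> pmono s j) \<odot> pmono w k = pmono r i \<odot> (pmono s j \<odot> pmono w k)"
proof
  fix n
  have rs: "order_le (i + j) (pmono r i \<odot> pmono s j)" and st: "order_le (j + k) (pmono s j \<odot> pmono w k)"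
    by auto
  show "((pmono r i \<odot> pmono s j) \<odot> pmono w k) n = (pmono r i \<odot> (pmono s j \<odot> pmono w k)) n"
  proof (cases "n \<le> i + j + k")
    case False
    then have "i + j + k < n" by simp
    moreover have "order_le (i + j + k) ((pmono r i \<odot> pmono s j) \<odot> pmono w k)"
      using order_le_mult[OF rs order_le_pmono[OF order_refl]] .
    moreover have "order_le (i + j + k) (pmono r i \<odot> (pmono s j \<odot> pmono w k))"
      using order_le_mult[OF order_le_pmono[OF order_refl] st] by (simp add: add.assoc)
    ultimately show ?thesis by (simp add: order_le_def)
  next
    case True
    \<comment> \<open>The total number of derivatives in the coefficient at n: l of them fall on s
      and the other M - l on w.\<close>
    define M where "M = nat (i + j + k - n)"
    have prod: "(pmono r i \<odot> pmono s j) (i + j - int l) = of_int (int_choose i l) * r * (d ^^ l) s"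
      for r s i j and l by (simp add: psdo_mult_pmono_pmono)
    have "((pmono r i \<odot> pmono s j) \<odot> pmono w k) n
       = (\<Sum>l\<le>M. of_int (int_choose i l * int_choose (i + j - int l) (M - l)) * r * (d ^^ l) s * (d ^^ (M - l)) w)"
    proof -
      have "((pmono r i \<odot> pmono s j) \<odot> pmono w k) n = (\<Sum>p\<in>{n - k..i + j}.
        of_int (int_choose p (nat (p + k - n))) * (pmono r i \<odot> pmono s j) p * (d ^^ nat (p + k - n)) w)"
        by (rule psdo_mult_pmono_right[OF rs])
      also have "\<dots> = (\<Sum>l\<le>nat (i + j - (n - k)). of_int (int_choose (i + j - int l) (nat (i + j - int l + k - n)))
          * (pmono r i \<odot> pmono s j) (i + j - int l) * (d ^^ nat (i + j - int l + k - n)) w)"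
        by (rule int_sum_reindex_down) (use True in simp)
      also have "nat (i + j - (n - k)) = M" by (simp add: M_def algebra_simps)
      also have "(\<Sum>l\<le>M. of_int (int_choose (i + j - int l) (nat (i + j - int l + k - n)))
          * (pmono r i \<odot> pmono s j) (i + j - int l) * (d ^^ nat (i + j - int l + k - n)) w)
        = (\<Sum>l\<le>M. of_int (int_choose i l * int_choose (i + j - int l) (M - l)) * r * (d ^^ l) s * (d ^^ (M - l)) w)"
      proof (rule sum.cong[OF refl])
        fix l assume "l \<in> {..M}"
        then have "nat (i + j - int l + k - n) = M - l" unfolding M_def by simp
        then show "of_int (int_choose (i + j - int l) (nat (i + j - int l + k - n)))
          * (pmono r i \<odot> pmono s j) (i + j - int l) * (d ^^ nat (i + j - int l + k - n)) w
          = of_int (int_choose i l * int_choose (i + j - int l) (M - l)) * r * (d ^^ l) s * (d ^^ (M - l)) w"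
          by (simp add: prod mult_ac)
      qed
      finally show ?thesis .
    qed
    also have "\<dots> = (\<Sum>l\<le>M. \<Sum>p\<le>M - l. of_int (int_choose i (M - p) * int ((M - p) choose l) * int_choose j p)
        * r * (d ^^ l) s * (d ^^ (M - l)) w)"
      by (intro sum.cong refl)
        (simp add: int_choose_assoc[symmetric] sum_distrib_right)
    also have "\<dots> = (\<Sum>p\<le>M. \<Sum>l\<le>M - p. of_int (int_choose i (M - p) * int ((M - p) choose l) * int_choose j p)
        * r * (d ^^ l) s * (d ^^ (M - l)) w)"
      by (rule sum_triangle_swap)
    \<comment> \<open>Here p counts the derivatives of w produced by moving the j-th power past it.
      The remaining M - p come from the i-th power and are distributed over the product of s and the
      p-th derivative of w by the Leibniz rule.\<close>
    also have "\<dots> = (\<Sum>p\<le>M. of_int (int_choose i (M - p)) * r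
         * (d ^^ (M - p)) (of_int (int_choose j p) * (s * (d ^^ p) w)))"
    proof (rule sum.cong[OF refl])
      fix p assume "p \<in> {..M}"
      then have "(d ^^ (M - p - l)) ((d ^^ p) w) = (d ^^ (M - l)) w" if "l \<le> M - p" for l
        using that by (simp add: funpow_add[symmetric, unfolded comp_def, THEN fun_cong])
      then show "(\<Sum>l\<le>M - p. of_int (int_choose i (M - p) * int ((M - p) choose l) * int_choose j p)
          * r * (d ^^ l) s * (d ^^ (M - l)) w) = of_int (int_choose i (M - p)) * r
         * (d ^^ (M - p)) (of_int (int_choose j p) * (s * (d ^^ p) w))"
        unfolding d_funpow_of_int_mult unfolding d_funpow_mult sum_distrib_left
        by (intro sum.cong refl) (simp add: mult_ac)
    qed
    also have "\<dots> = (pmono r i \<odot> (pmono s j \<odot> pmono w k)) n"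
    proof -
      have "(pmono r i \<odot> (pmono s j \<odot> pmono w k)) n = (\<Sum>q\<in>{n - i..j + k}.
        of_int (int_choose i (nat (i + q - n))) * r * (d ^^ nat (i + q - n)) ((pmono s j \<odot> pmono w k) q))"
        by (rule psdo_mult_pmono_left[OF st])
      also have "\<dots> = (\<Sum>p\<le>nat (j + k - (n - i)). of_int (int_choose i (nat (i + (j + k - int p) - n))) * r
          * (d ^^ nat (i + (j + k - int p) - n)) ((pmono s j \<odot> pmono w k) (j + k - int p)))"
        by (rule int_sum_reindex_down) (use True in simp)
      also have "nat (j + k - (n - i)) = M" by (simp add: M_def algebra_simps)
      also have "(\<Sum>p\<le>M. of_int (int_choose i (nat (i + (j + k - int p) - n))) * r
          * (d ^^ nat (i + (j + k - int p) - n)) ((pmono s j \<odot> pmono w k) (j + k - int p)))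
        = (\<Sum>p\<le>M. of_int (int_choose i (M - p)) * r
         * (d ^^ (M - p)) (of_int (int_choose j p) * (s * (d ^^ p) w)))"
      proof (rule sum.cong[OF refl])
        fix p assume "p \<in> {..M}"
        then have "nat (i + (j + k - int p) - n) = M - p" unfolding M_def by simp
        then show "of_int (int_choose i (nat (i + (j + k - int p) - n))) * r
          * (d ^^ nat (i + (j + k - int p) - n)) ((pmono s j \<odot> pmono w k) (j + k - int p))
          = of_int (int_choose i (M - p)) * r * (d ^^ (M - p)) (of_int (int_choose j p) * (s * (d ^^ p) w))"
          by (simp add: prod mult.assoc)
      qed
      finally show ?thesis by (rule sym)
    qed
    finally show ?thesis .
  qed
qed

text \<open>The coefficient at n sees each factor only down to n minus the orders of the other two.
  Cut off there, the factors are finite sums of monomials, and distributivity leads back to the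
  monomial case.\<close>

lemma psdo_mult_assoc:
  assumes R: "order_le a R" and S: "order_le b S" and T: "order_le c T"
  shows "(R \<odot> S) \<odot> T = R \<odot> (S \<odot> T)"
proof
  fix n
  define R' where "R' = (\<Sum>i\<in>{n - b - c..a}. pmono (R i) i)"
  define S' where "S' = (\<Sum>i\<in>{n - a - c..b}. pmono (S i) i)"
  define T' where "T' = (\<Sum>i\<in>{n - a - b..c}. pmono (T i) i)"
  have R': "order_le a R'" and S': "order_le b S'" and T': "order_le c T'"
    unfolding R'_def S'_def T'_def by (auto intro!: order_le_sum)
  note ord = R S T R' S' T'
  have eq: "\<And>i. n - b - c \<le> i \<Longrightarrow> R' i = R i" "\<And>i. n - a - c \<le> i \<Longrightarrow> S' i = S i"
    "\<And>i. n - a - b \<le> i \<Longrightarrow> T' i = T i"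
    unfolding R'_def S'_def T'_def by (auto simp: pmono_sum_above[OF R] pmono_sum_above[OF S] pmono_sum_above[OF T])
  have "((R \<odot> S) \<odot> T) n = ((R' \<odot> S') \<odot> T') n"
    by (intro psdo_mult_cong[where a="a+b" and b=c] psdo_mult_cong[where a=a and b=b])
      (use ord in \<open>auto simp: eq\<close>)
  also have "(R' \<odot> S') \<odot> T' = R' \<odot> (S' \<odot> T')"
  proof -
    have RS: "R' \<odot> S' = (\<Sum>i\<in>{n - b - c..a}. \<Sum>j\<in>{n - a - c..b}. pmono (R i) i \<odot> pmono (S j) j)"
      unfolding R'_def S'_def
      by (subst psdo_mult_sum_left[where a=a and b=b], auto intro!: order_le_sum sum.cong)
       (subst psdo_mult_sum_right[where a=a and b=b], auto)
    have o1: "order_le (a + b) (pmono (R i) i \<odot> pmono (S j) j)" if "i \<le> a" "j \<le> b" for i j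
      using that by auto
    have 1: "(R' \<odot> S') \<odot> T' = (\<Sum>i\<in>{n - b - c..a}. \<Sum>j\<in>{n - a - c..b}. \<Sum>k\<in>{n - a - b..c}.
       (pmono (R i) i \<odot> pmono (S j) j) \<odot> pmono (T k) k)"
      unfolding RS T'_def
      by (subst psdo_mult_sum_left[where a="a+b" and b=c], auto intro!: order_le_sum sum.cong o1,
        subst psdo_mult_sum_left[where a="a+b" and b=c], auto intro!: order_le_sum sum.cong o1,
        subst psdo_mult_sum_right[where a="a+b" and b=c], auto intro!: o1)
    have ST: "S' \<odot> T' = (\<Sum>j\<in>{n - a - c..b}. \<Sum>k\<in>{n - a - b..c}. pmono (S j) j \<odot> pmono (T k) k)"
      unfolding T'_def S'_def
      by (subst psdo_mult_sum_left[where a=b and b=c], auto intro!: order_le_sum sum.cong)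
       (subst psdo_mult_sum_right[where a=b and b=c], auto)
    have o2: "order_le (b + c) (pmono (S i) i \<odot> pmono (T j) j)" if "i \<le> b" "j \<le> c" for i j
      using that by auto
    have 2: "R' \<odot> (S' \<odot> T') = (\<Sum>i\<in>{n - b - c..a}. \<Sum>j\<in>{n - a - c..b}. \<Sum>k\<in>{n - a - b..c}.
       pmono (R i) i \<odot> (pmono (S j) j \<odot> pmono (T k) k))"
      unfolding ST R'_def
      by (subst psdo_mult_sum_left[where a=a and b="b+c"], auto intro!: order_le_sum sum.cong o2,
        subst psdo_mult_sum_right[where a=a and b="b+c"], auto intro!: order_le_sum sum.cong o2,
        subst psdo_mult_sum_right[where a=a and b="b+c"], auto intro!: o2)
    from 1 2 show ?thesis by (simp add: psdo_mult_assoc_pmono)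
  qed
  also have "(R' \<odot> (S' \<odot> T')) n = (R \<odot> (S \<odot> T)) n"
    by (intro psdo_mult_cong[where a=a and b="b+c"] psdo_mult_cong[where a=b and b=c])
      (use ord in \<open>auto simp: eq\<close>)
  finally show "((R \<odot> S) \<odot> T) n = (R \<odot> (S \<odot> T)) n" .
qed

end

section \<open>Powers and roots\<close>

definition monic_order :: "int \<Rightarrow> 'r::zero_neq_one psdo \<Rightarrow> bool" where
  "monic_order a R \<longleftrightarrow> order_le a R \<and> R a = 1"

lemma monic_orderD: "monic_order a R \<Longrightarrow> order_le a R" "monic_order a R \<Longrightarrow> R a = 1"
  by (auto simp: monic_order_def)

lemma monic_order_pmono [intro!]: "monic_order i (pmono 1 i)"
  by (auto simp: monic_order_def pmono_def order_le_def)

context pre_derivation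
begin

lemma monic_order_mult: "monic_order a R \<Longrightarrow> monic_order b S \<Longrightarrow> monic_order (a + b) (R \<odot> S)"
  by (auto simp: monic_order_def psdo_mult_top)

lemma monic_order_power: "monic_order 1 R \<Longrightarrow> monic_order (int n) (psdo_power d R n)"
proof (induction n)
  case 0
  show ?case unfolding psdo_power_0 by (simp add: monic_order_pmono)
next
  case (Suc n)
  then show ?case using monic_order_mult[of 1 R "int n"] by simp
qed

lemma order_le_power: "order_le 1 R \<Longrightarrow> order_le (int n) (psdo_power d R n)"
proof (induction n)
  case 0
  show ?case unfolding psdo_power_0 by auto
next
  case (Suc n)
  then show ?case using order_le_mult[of 1 R "int n"] by simp
qed

text \<open>Isolates the two lowest coefficients that can enter, \<open>R q\<close> and
  \<open>S (b + q - 1)\<close>. The bracket involves coefficients of R above q and of S from b + q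
  on, so it cancels when two products with equal higher coefficients are subtracted.\<close>

lemma psdo_mult_expand:
  assumes R: "order_le 1 R" and S: "order_le b S" and "q \<le> 0"
  shows "(R \<odot> S) (b + q) = R q * S b + R 1 * S (b + q - 1)
    + ((\<Sum>i\<in>{q+1..0}. \<Sum>j\<in>{b + q - i..b}.
          of_int (int_choose i (nat (i + j - (b + q)))) * R i * (d ^^ nat (i + j - (b + q))) (S j))
     + (\<Sum>j\<in>{b + q..b}. of_int (int_choose 1 (nat (1 + j - (b + q)))) * R 1 * (d ^^ nat (1 + j - (b + q))) (S j)))"
proof -
  let ?f = "\<lambda>i j. of_int (int_choose i (nat (i + j - (b + q)))) * R i * (d ^^ nat (i + j - (b + q))) (S j)"
  let ?F = "\<lambda>i. \<Sum>j\<in>{b + q - i..b}. ?f i j"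
  have "{q..1} = insert q (insert 1 {q+1..0})" using \<open>q \<le> 0\<close> by auto
  then have "(R \<odot> S) (b + q) = ?F q + (?F 1 + (\<Sum>i\<in>{q+1..0}. ?F i))"
    using \<open>q \<le> 0\<close> by (simp add: psdo_mult_eq[OF R S])
  moreover have "?F q = R q * S b" by simp
  moreover have "{b + q - 1..b} = insert (b + q - 1) {b + q..b}" using \<open>q \<le> 0\<close> by auto
  then have "?F 1 = R 1 * S (b + q - 1) + (\<Sum>j\<in>{b + q..b}. ?f 1 j)" by simp
  ultimately show ?thesis by (simp add: algebra_simps)
qed

text \<open>Lets the coefficients of an \<open>n\<close>-th root be computed one after the other.\<close>

lemma psdo_power_agree:
  assumes A: "monic_order 1 A" and B: "monic_order 1 B" and "q \<le> 0"
    and eq: "\<And>i. q < i \<Longrightarrow> A i = B i"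
  shows "(\<forall>i > int n - 1 + q. psdo_power d A n i = psdo_power d B n i)
    \<and> psdo_power d A n (int n - 1 + q) - psdo_power d B n (int n - 1 + q) = of_nat n * (A q - B q)"
proof (induction n)
  case (Suc n)
  let ?S = "psdo_power d A n" and ?T = "psdo_power d B n"
  have S: "monic_order (int n) ?S" and T: "monic_order (int n) ?T"
    using A B by (auto intro: monic_order_power)
  have "(A \<odot> ?S) m = (B \<odot> ?T) m" if "int (Suc n) - 1 + q < m" for m
    by (rule psdo_mult_cong[where a=1 and b="int n"])
      (use A B S T Suc.IH eq that in \<open>auto simp: monic_order_def\<close>)
  moreover have "(A \<odot> ?S) (int n + q) - (B \<odot> ?T) (int n + q) = of_nat (Suc n) * (A q - B q)"
  proof -
    have ST: "?S j = ?T j" if "int n + q \<le> j" for j using Suc.IH that by auto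
    have AB: "A i = B i" if "q + 1 \<le> i" for i using eq[of i] that by auto
    note e = psdo_mult_expand[OF monic_orderD(1) monic_orderD(1) \<open>q \<le> 0\<close>]
    \<comment> \<open>Since all leading coefficients are 1, the deviation at q enters once through
      the new factor and again through the previous power; this makes the multiplicity grow by one
      with each factor.\<close>
    have "(A \<odot> ?S) (int n + q) - (B \<odot> ?T) (int n + q)
       = (A q - B q) + (?S (int n + q - 1) - ?T (int n + q - 1))"
    proof -
      have 1: "(\<Sum>i\<in>{q+1..0}. \<Sum>j\<in>{int n + q - i..int n}.
          of_int (int_choose i (nat (i + j - (int n + q)))) * A i * (d ^^ nat (i + j - (int n + q))) (?S j))
        = (\<Sum>i\<in>{q+1..0}. \<Sum>j\<in>{int n + q - i..int n}.
          of_int (int_choose i (nat (i + j - (int n + q)))) * B i * (d ^^ nat (i + j - (int n + q))) (?T j))"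
        by (intro sum.cong refl) (use ST AB in auto)
      have 2: "(\<Sum>j\<in>{int n + q..int n}. of_int (int_choose 1 (nat (1 + j - (int n + q)))) * A 1
          * (d ^^ nat (1 + j - (int n + q))) (?S j))
        = (\<Sum>j\<in>{int n + q..int n}. of_int (int_choose 1 (nat (1 + j - (int n + q)))) * B 1
          * (d ^^ nat (1 + j - (int n + q))) (?T j))"
        by (intro sum.cong refl) (use ST A B in \<open>auto simp: monic_order_def\<close>)
      show ?thesis
        unfolding e[OF A S] e[OF B T] 1 2
        using A B S T by (simp add: monic_order_def)
    qed
    also have "?S (int n + q - 1) - ?T (int n + q - 1) = of_nat n * (A q - B q)"
      using Suc.IH by (simp add: algebra_simps)
    finally show ?thesis by (simp add: algebra_simps)
  qed
  ultimately show ?case by (simp add: add.commute)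
qed (simp)

section \<open>Existence, uniqueness and recursive computation of monic N-th roots\<close>

context
  fixes N :: nat and c :: 'r and L :: "'r psdo"
  assumes c: "c * of_nat N = 1" and L: "monic_order (int N) L"
begin

text \<open>Changing the coefficient at -k changes the N-th power at order N - 1 - k by N times as
  much and leaves all higher orders alone. So c, the inverse of N, times the defect found there is
  exactly the correction.\<close>

primrec root_approx :: "nat \<Rightarrow> 'r psdo" where
  "root_approx 0 = pmono 1 1"
| "root_approx (Suc k) = (root_approx k)(- int k := root_approx k (- int k)
     + c * (L (int N - 1 - int k) - psdo_power d (root_approx k) N (int N - 1 - int k)))"

lemma root_approx_monic: "monic_order 1 (root_approx k)"
  by (induction k) (auto simp: monic_order_def order_le_def pmono_def)

lemma root_approx_power:
  "int N - 1 - int k < m \<Longrightarrow> psdo_power d (root_approx k) N m = L m"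
proof (induction k arbitrary: m)
  case 0
  have "monic_order (int N) (psdo_power d (root_approx 0) N)"
    by (rule monic_order_power[OF root_approx_monic])
  with L 0 show ?case by (cases "m = int N") (auto simp: monic_order_def order_le_def)
next
  case (Suc k)
  have "root_approx (Suc k) i = root_approx k i" if "- int k < i" for i using that by simp
  note agree = psdo_power_agree[OF root_approx_monic[of "Suc k"] root_approx_monic[of k],
      of "- int k" N, OF _ this, simplified of_nat_0_le_iff neg_le_0_iff_le]
  show ?case
  proof (cases "m = int N - 1 - int k")
    case False
    then have "int N - 1 - int k < m" using Suc.prems by simp
    with agree Suc.IH[of m] show ?thesis by (auto simp del: root_approx.simps)
  next
    case True
    have "of_nat N * (c * x) = x" for x using c by (metis mult.assoc mult.commute mult_1)
    then have "of_nat N * (root_approx (Suc k) (- int k) - root_approx k (- int k))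
      = L (int N - 1 - int k) - psdo_power d (root_approx k) N (int N - 1 - int k)" by simp
    with agree True show ?thesis by (simp del: root_approx.simps)
  qed
qed

lemma root_approx_stable: "k \<le> l \<Longrightarrow> - int k < i \<Longrightarrow> root_approx l i = root_approx k i"
  by (induction l rule: dec_induct) auto

lemma psdo_root_exists: "\<exists>R. monic_order 1 R \<and> psdo_power d R N = L"
proof (intro exI conjI ext)
  \<comment> \<open>The coefficient at i is final from any stage k with -k < i, and
    \<open>nat (2 - i)\<close> is such a stage for every i.\<close>
  let ?A = "\<lambda>i. root_approx (nat (2 - i)) i"
  have A: "?A i = root_approx k i" if "- int k < i" for i k
  proof (cases "nat (2 - i) \<le> k")
    case True
    then show ?thesis using root_approx_stable[of "nat (2 - i)" k i] by simp
  next
    case False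
    then show ?thesis using root_approx_stable[of k "nat (2 - i)" i] that by simp
  qed
  show monic: "monic_order 1 ?A"
    using root_approx_monic by (auto simp: monic_order_def order_le_def pmono_def)
  fix m
  define k where "k = nat (int N - m)"
  have k: "int N - 1 - int k < m" unfolding k_def by linarith
  have "psdo_power d ?A N m = psdo_power d (root_approx k) N m"
    using psdo_power_agree[OF monic root_approx_monic[of k], of "- int k" N] A k by auto
  also have "\<dots> = L m" using k by (rule root_approx_power)
  finally show "psdo_power d ?A N m = L m" .
qed

text \<open>Downward induction: if two roots agree above -k, their N-th powers differ at order N - 1
  - k by N times the difference at -k, and N is invertible.\<close>

lemma psdo_root_unique:
  assumes R: "monic_order 1 R" "psdo_power d R N = L" and S: "monic_order 1 S" "psdo_power d S N = L"
  shows "R = S"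
proof -
  have "R i = S i" if "- int k < i" for k i
    using that
  proof (induction k arbitrary: i)
    case 0
    with R S show ?case by (cases "i = 1") (auto simp: monic_order_def order_le_def)
  next
    case (Suc k)
    have "of_nat N * (R (- int k) - S (- int k)) = 0"
      using psdo_power_agree[OF R(1) S(1), of "- int k" N] Suc.IH by (simp add: R(2) S(2))
    then have "c * of_nat N * (R (- int k) - S (- int k)) = 0" by (simp add: mult.assoc)
    with Suc c show ?case by (cases "i = - int k") auto
  qed
  from this[of "nat (1 - i)" i for i] show ?thesis by (intro ext) simp
qed

lemma psdo_root_monic: "monic_order 1 (psdo_root d N L)" 
  and psdo_root_power: "psdo_power d (psdo_root d N L) N = L"
proof -
  have eq: "(R 1 = 1 \<and> (\<forall>i>1. R i = 0) \<and> psdo_power d R N = L)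
    \<longleftrightarrow> (monic_order 1 R \<and> psdo_power d R N = L)" for R
    by (auto simp: monic_order_def order_le_def)
  have "\<exists>!R. monic_order 1 R \<and> psdo_power d R N = L"
    using psdo_root_exists psdo_root_unique by blast
  from theI'[OF this] show "monic_order 1 (psdo_root d N L)" "psdo_power d (psdo_root d N L) N = L"
    unfolding psdo_root_def eq by auto
qed

text \<open>Expresses a coefficient of the root through ring operations, the derivation and the
  coefficients above it. In this form the root, defined by a description operator, can be followed
  from one coefficient ring to another.\<close>

lemma psdo_root_coeff:
  assumes "q \<le> 0"
  shows "psdo_root d N L q = c * (L (int N - 1 + q)
     - psdo_power d (\<lambda>i. if q < i then psdo_root d N L i else 0) N (int N - 1 + q))"
proof -
  let ?A = "psdo_root d N L" and ?B = "\<lambda>i. if q < i then psdo_root d N L i else 0"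
  have "monic_order 1 ?B"
    using psdo_root_monic assms by (auto simp: monic_order_def order_le_def)
  from psdo_power_agree[OF psdo_root_monic this assms, of N]
  have "L (int N - 1 + q) - psdo_power d ?B N (int N - 1 + q) = of_nat N * ?A q"
    by (simp add: psdo_root_power)
  then show ?thesis using c by (metis mult.assoc mult_1)
qed

end

end

lemma GD_op_monic: "monic_order (int N) (GD_op N u)"
  by (auto simp: monic_order_def order_le_def GD_op_def)

section \<open>Transfer between coefficient rings\<close>

text \<open>A relation rather than a homomorphism, because the correspondence exists for some
  elements only: smooth functions and their Taylor series, or functions that agree on an open set
  with the value of a differential polynomial.\<close>

locale coefficient_relation =
  l: pre_derivation d + r: pre_derivation d'
  for d :: "'r::comm_ring_1 \<Rightarrow> 'r" and d' :: "'s::comm_ring_1 \<Rightarrow> 's" +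
  fixes rel :: "'r \<Rightarrow> 's \<Rightarrow> bool"
  assumes rel_0: "rel 0 0" and rel_1: "rel 1 1"
    and rel_add: "rel a a' \<Longrightarrow> rel b b' \<Longrightarrow> rel (a + b) (a' + b')"
    and rel_uminus: "rel a a' \<Longrightarrow> rel (- a) (- a')"
    and rel_mult: "rel a a' \<Longrightarrow> rel b b' \<Longrightarrow> rel (a * b) (a' * b')"
    and rel_d: "rel a a' \<Longrightarrow> rel (d a) (d' a')"
begin

lemma rel_diff: "rel a a' \<Longrightarrow> rel b b' \<Longrightarrow> rel (a - b) (a' - b')"
  using rel_add[of a a' "-b" "-b'"] rel_uminus by simp

lemma rel_sum: "(\<And>k. k \<in> K \<Longrightarrow> rel (f k) (g k)) \<Longrightarrow> rel (\<Sum>k\<in>K. f k) (\<Sum>k\<in>K. g k)"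
  by (induction K rule: infinite_finite_induct) (auto intro: rel_0 rel_add)

lemma rel_of_nat: "rel (of_nat k) (of_nat k)"
  by (induction k) (auto intro: rel_0 rel_1 rel_add)

lemma rel_of_int: "rel (of_int k) (of_int k)"
  by (cases k) (auto simp del: of_nat_Suc intro: rel_of_nat rel_uminus)

lemma rel_funpow: "rel a a' \<Longrightarrow> rel ((d ^^ n) a) ((d' ^^ n) a')"
  by (induction n) (auto intro: rel_d)

lemma rel_psdo_mult:
  assumes "order_le a R" "order_le a R'" "order_le b S" "order_le b S'"
    and "\<And>i. rel (R i) (R' i)" "\<And>i. rel (S i) (S' i)"
  shows "rel (psdo_mult d R S n) (psdo_mult d' R' S' n)"
  unfolding l.psdo_mult_eq[OF assms(1,3)] r.psdo_mult_eq[OF assms(2,4)]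
  by (intro rel_sum rel_mult rel_of_int rel_funpow assms)

lemma rel_psdo_power:
  assumes "order_le 1 R" "order_le 1 R'" "\<And>i. rel (R i) (R' i)"
  shows "rel (psdo_power d R n m) (psdo_power d' R' n m)"
proof (induction n arbitrary: m)
  case (Suc n)
  show ?case
    by (simp, rule rel_psdo_mult[where b="int n", OF assms(1,2)])
      (use assms Suc in \<open>auto intro: l.order_le_power r.order_le_power\<close>)
qed (simp add: rel_0 rel_1)

lemma rel_psdo_root:
  assumes c: "c * of_nat N = 1" "c' * of_nat N = 1" "rel c c'"
    and L: "monic_order (int N) L" "monic_order (int N) L'" "\<And>i. rel (L i) (L' i)"
  shows "rel (psdo_root d N L i) (psdo_root d' N L' i)"
proof -
  let ?R = "psdo_root d N L" and ?R' = "psdo_root d' N L'"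
  have monic: "monic_order 1 ?R" "monic_order 1 ?R'"
    using l.psdo_root_monic[OF c(1) L(1)] r.psdo_root_monic[OF c(2) L(2)] by auto
  have "rel (?R i) (?R' i)" if "- int k < i" for k i
    using that
  proof (induction k arbitrary: i)
    case 0
    with monic show ?case
      by (cases "i = 1") (auto simp: monic_order_def order_le_def rel_0 rel_1)
  next
    case (Suc k)
    show ?case
    proof (cases "i = - int k")
      case True
      then have i: "i \<le> 0" by simp
      show ?thesis
        unfolding l.psdo_root_coeff[OF c(1) L(1) i] r.psdo_root_coeff[OF c(2) L(2) i]
        by (intro rel_mult rel_diff c L rel_psdo_power)
          (use monic Suc.IH True in \<open>auto simp: monic_order_def order_le_def rel_0\<close>)
    next
      case False
      then show ?thesis using Suc by simp
    qed
  qed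
  from this[of "nat (1 - i)" i] show ?thesis by simp
qed

lemma rel_frac_power:
  assumes c: "c * of_nat N = 1" "c' * of_nat N = 1" "rel c c'"
    and L: "monic_order (int N) L" "monic_order (int N) L'" "\<And>i. rel (L i) (L' i)"
  shows "rel (frac_power d N L m i) (frac_power d' N L' m i)"
  unfolding frac_power_def
  by (intro rel_psdo_power rel_psdo_root[OF assms] monic_orderD(1)
      l.psdo_root_monic[OF c(1) L(1)] r.psdo_root_monic[OF c(2) L(2)])

end

section \<open>Telescoping sums and series\<close>

text \<open>Meant for sequences whose orders are bounded by b - k, so that each coefficient receives
  finitely many contributions: convergence in the order filtration.\<close>

definition psum :: "(nat \<Rightarrow> 'r::comm_monoid_add psdo) \<Rightarrow> 'r psdo" where
  "psum F n = (\<Sum>k | F k n \<noteq> 0. F k n)"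

lemma psum_eq:
  assumes "\<And>k. K \<le> k \<Longrightarrow> F k n = 0" shows "psum F n = (\<Sum>k<K. F k n)"
  unfolding psum_def
  by (rule sum.mono_neutral_left) (use assms in \<open>auto simp: not_le[symmetric]\<close>)

lemma psum_eq_order:
  assumes "\<And>k. order_le (b - int k) (F k)" "b - int K < n"
  shows "psum F n = (\<Sum>k<K. F k n)"
  by (rule psum_eq) (use assms in \<open>auto simp: order_le_def\<close>)

lemma order_le_psum:
  assumes "\<And>k. order_le (b - int k) (F k)" shows "order_le b (psum F)"
proof -
  have "psum F n = 0" if "b < n" for n
    using psum_eq_order[where K=0, OF assms] that by simp
  then show ?thesis by (simp add: order_le_def)
qed

lemma psum_Suc:
  assumes "\<And>k. order_le (b - int k) (F k)"
  shows "psum F = F 0 + psum (\<lambda>k. F (Suc k))"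
proof
  fix n
  define K where "K = nat (b - n + 1)"
  have "b - int (Suc K) < n" "b - 1 - int K < n" unfolding K_def by auto
  moreover have "order_le (b - 1 - int k) (F (Suc k))" for k using assms[of "Suc k"] by (simp add: algebra_simps)
  ultimately show "psum F n = (F 0 + psum (\<lambda>k. F (Suc k))) n"
    by (simp add: psum_eq_order[where b=b and K="Suc K"] psum_eq_order[where b="b-1" and K=K] assms
        sum.lessThan_Suc_shift del: sum.lessThan_Suc of_nat_Suc)
qed

lemma psum_add:
  assumes "\<And>k. order_le (b - int k) (F k)" "\<And>k. order_le (b - int k) (G k)"
  shows "psum (\<lambda>k. F k + G k) = psum F + psum G"
proof
  fix n
  define K where "K = nat (b - n + 1)"
  have K: "b - int K < n" unfolding K_def by auto
  show "psum (\<lambda>k. F k + G k) n = (psum F + psum G) n"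
    using psum_eq_order[OF assms(1) K] psum_eq_order[OF assms(2) K]
      psum_eq_order[where F="\<lambda>k. F k + G k", OF order_le_add[OF assms] K]
    by (simp add: sum.distrib)
qed

section \<open>Products with series, and descent on the order\<close>

context derivation
begin

text \<open>From K on the products have order below n, so the series can be cut off at K before
  finite distributivity is applied.\<close>

lemma psdo_mult_psum_right:
  assumes R: "order_le a R" and F: "\<And>k. order_le (b - int k) (F k)"
  shows "R \<odot> psum F = psum (\<lambda>k. R \<odot> F k)"
proof
  fix n
  define K where "K = nat (a + b - n + 1)"
  have K: "a + b - int K < n" unfolding K_def by auto
  have F': "order_le b (F k)" for k using F[of k] by (rule order_le_mono) simp
  have "(R \<odot> psum F) n = (R \<odot> (\<Sum>k<K. F k)) n"
    by (rule psdo_mult_cong[OF R R order_le_psum[OF F] order_le_sum])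
      (use F' K in \<open>auto simp: sum_fun_apply intro!: psum_eq_order[OF F]\<close>)
  also have "\<dots> = (\<Sum>k<K. (R \<odot> F k) n)"
    by (subst psdo_mult_sum_right[OF R F']) (rule sum_fun_apply)
  also have "\<dots> = psum (\<lambda>k. R \<odot> F k) n"
    by (rule psum_eq_order[symmetric, where b="a + b"])
      (use order_le_mult[OF R F] K in \<open>auto simp: algebra_simps\<close>)
  finally show "(R \<odot> psum F) n = psum (\<lambda>k. R \<odot> F k) n" .
qed

lemma psdo_mult_psum_left:
  assumes S: "order_le b S" and F: "\<And>k. order_le (a - int k) (F k)"
  shows "psum F \<odot> S = psum (\<lambda>k. F k \<odot> S)"
proof
  fix n
  define K where "K = nat (a + b - n + 1)"
  have K: "a + b - int K < n" unfolding K_def by auto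
  have F': "order_le a (F k)" for k using F[of k] by (rule order_le_mono) simp
  have "(psum F \<odot> S) n = ((\<Sum>k<K. F k) \<odot> S) n"
    by (rule psdo_mult_cong[OF order_le_psum[OF F] order_le_sum S S])
      (use F' K in \<open>auto simp: sum_fun_apply intro!: psum_eq_order[OF F]\<close>)
  also have "\<dots> = (\<Sum>k<K. (F k \<odot> S) n)"
    by (subst psdo_mult_sum_left[OF F' S]) (rule sum_fun_apply)
  also have "\<dots> = psum (\<lambda>k. F k \<odot> S) n"
    by (rule psum_eq_order[symmetric, where b="a + b"])
      (use order_le_mult[OF F S] K in \<open>auto simp: algebra_simps\<close>)
  finally show "(psum F \<odot> S) n = psum (\<lambda>k. F k \<odot> S) n" .
qed

text \<open>Whenever the order is at most q the coefficient at q vanishes too, so the order bound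
  can be lowered forever.\<close>

lemma psdo_zeroI:
  assumes "order_le a X" "\<And>q. order_le q X \<Longrightarrow> X q = 0" shows "X = 0"
proof -
  have "order_le (a - int k) X" for k
  proof (induction k)
    case (Suc k)
    show ?case
      unfolding order_le_def
    proof (intro allI impI)
      fix i assume "a - int (Suc k) < i"
      then have "i = a - int k \<or> a - int k < i" by auto
      with assms(2)[OF Suc.IH] Suc.IH show "X i = 0" by (auto simp: order_le_def)
    qed
  qed (simp add: assms)
  then have "X i = 0" for i
    by (rule order_leD[of "a - int (nat (a - i + 1))" X i]) linarith
  then show ?thesis by (intro ext) simp
qed

text \<open>The recursion says that \<open>Y n\<close> is the sum of the products \<open>A\<^sup>i X P (n - 1 - i)\<close>, \<open>i < n\<close>,
  whose leading coefficient is \<open>n\<close> times that of \<open>X\<close>.\<close>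

lemma telescoping_cancel:
  assumes A: "monic_order 1 A" and P: "\<And>n. monic_order (int n) (P n)" and X: "order_le a X"
    and Y0: "Y 0 = 0" and Y: "\<And>n. Y (Suc n) = X \<odot> P n + A \<odot> Y n"
    and c: "c * of_nat N = (1 :: 'r)" and YN: "Y N = 0"
  shows "X = 0"
proof -
  have *: "order_le (q + int n - 1) (Y n) \<and> Y n (q + int n - 1) = of_nat n * X q" if X: "order_le q X" for q n
  proof (induction n)
    case (Suc n)
    have 1: "order_le (q + int n) (X \<odot> P n)" "order_le (1 + (q + int n - 1)) (A \<odot> Y n)"
      using order_le_mult[OF X monic_orderD(1)[OF P]]
        order_le_mult[OF monic_orderD(1)[OF A], of "q + int n - 1" "Y n"] Suc.IH by blast+
    have 2: "(X \<odot> P n) (q + int n) = X q"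
      using psdo_mult_top[OF X, of "int n" "P n"] P by (simp add: monic_order_def)
    have 3: "(A \<odot> Y n) (1 + (q + int n - 1)) = of_nat n * X q"
      using psdo_mult_top[of 1 A "q + int n - 1" "Y n"] Suc.IH A by (simp add: monic_order_def)
    from 1 have "order_le (q + int n) (Y (Suc n))" unfolding Y by (intro order_le_add) simp_all
    moreover from 2 3 have "Y (Suc n) (q + int n) = of_nat (Suc n) * X q"
      by (simp add: Y algebra_simps)
    moreover have "q + int (Suc n) - 1 = q + int n" by simp
    ultimately show ?case by (simp only: simp_thms)
  qed (simp add: Y0 order_le_def)
  show ?thesis
  proof (rule psdo_zeroI[OF X])
    fix q assume "order_le q X"
    from *[OF this, of N] have "of_nat N * X q = 0" by (simp add: YN)
    then have "c * of_nat N * X q = 0" by (simp add: mult.assoc)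
    then show "X q = 0" by (simp add: c)
  qed
qed

end

context derivation
begin

lemma psdo_power_Suc_right:
  assumes "order_le 1 R" shows "psdo_power d R (Suc n) = psdo_power d R n \<odot> R"
proof (induction n)
  case 0
  show ?case using psdo_mult_1_left[OF assms] psdo_mult_1_right[OF assms]
    by (simp add: psdo_power_0 del: psdo_power.simps(1))
next
  case (Suc n)
  have "psdo_power d R (Suc (Suc n)) = R \<odot> (psdo_power d R n \<odot> R)" by (simp only: psdo_power.simps(2) Suc.IH[symmetric])
  also have "\<dots> = (R \<odot> psdo_power d R n) \<odot> R"
    by (rule psdo_mult_assoc[symmetric, OF assms order_le_power[OF assms] assms])
  finally show ?case by simp
qed

text \<open>The Leibniz series stops after two terms. The case of interest is s = x - y.\<close>

lemma psdo_mult_pmono_linear: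
  assumes "d (d s) = 0"
  shows "pmono r i \<odot> pmono s j = pmono (r * s) (i + j) + pmono (of_int i * r * d s) (i + j - 1)"
proof
  fix n
  have 0: "(d ^^ l) s = 0" if "2 \<le> l" for l
  proof -
    from le_Suc_ex[OF that] obtain m where "l = 2 + m" ..
    then have "l = m + 2" by simp
    then show ?thesis using assms by (simp only: funpow_add) (simp add: numeral_2_eq_2)
  qed
  consider "n > i + j" | "n = i + j" | "n = i + j - 1" | "n < i + j - 1" by linarith
  then show "(pmono r i \<odot> pmono s j) n = (pmono (r * s) (i + j) + pmono (of_int i * r * d s) (i + j - 1)) n"
  proof cases
    case 4
    then show ?thesis by (simp add: psdo_mult_pmono_pmono 0) (simp add: pmono_def)
  qed (simp_all add: psdo_mult_pmono_pmono, simp_all add: pmono_def)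
qed

lemma psdo_mult_pmono_const: "d s = 0 \<Longrightarrow> pmono r i \<odot> pmono s j = pmono (r * s) (i + j)"
  by (subst psdo_mult_pmono_linear) (auto simp: pmono_def)

lemma psdo_mult_pmono_0_left: 
  assumes "order_le b S" shows "(pmono r 0 \<odot> S) n = r * S n"
proof -
  have "(pmono r 0 \<odot> S) n = (\<Sum>j\<in>{n..b}. if j = n then r * S n else 0)"
    by (subst psdo_mult_pmono_left[OF assms], rule sum.cong) (auto simp: int_choose_eq_0)
  also have "\<dots> = r * S n" using assms by (simp add: order_le_def)
  finally show ?thesis .
qed

lemma psdo_mult_pmono_0_add:
  assumes "order_le b S" shows "pmono (r + r') 0 \<odot> S = pmono r 0 \<odot> S + pmono r' 0 \<odot> S"
  by (rule ext) (simp add: psdo_mult_pmono_0_left[OF assms] distrib_right)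

lemma psdo_mult_pmono_0_mult:
  assumes "order_le b S" shows "pmono (r * r') 0 \<odot> S = pmono r 0 \<odot> (pmono r' 0 \<odot> S)"
proof -
  have "order_le b (pmono r' 0 \<odot> S)" using order_le_mult[of 0 "pmono r' 0" b S] assms by auto
  then show ?thesis
    by (intro ext) (simp add: psdo_mult_pmono_0_left[OF assms] psdo_mult_pmono_0_left mult.assoc)
qed

lemma psdo_mult_pmono_0_0 [simp]: "pmono 0 i \<odot> S = 0"
  by (auto simp: psdo_mult_def pmono_def)

end

interpretation fps: derivation "fps_deriv :: 'a::comm_ring_1 fps \<Rightarrow> 'a fps"
  by unfold_locales (simp_all add: algebra_simps)

section \<open>Airy expansions as pseudo-differential operators\<close>

text \<open>Power series in \<open>x - y\<close> replace the functions of \<open>x\<close>.\<close>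

definition fairy_shift ::
  "nat \<Rightarrow> 'a::field_char_0 \<Rightarrow> (nat \<Rightarrow> int \<Rightarrow> 'a fps) \<Rightarrow> nat \<Rightarrow> int \<Rightarrow> 'a fps" where
  "fairy_shift N \<kappa> c j k =
     (if j = 0 then fps_const (- (\<kappa> / of_nat N)) * fps_X * c (N - 2) (k + 1) else c (j - 1) k)"

definition fairy_dx ::
  "nat \<Rightarrow> 'a::field_char_0 \<Rightarrow> (nat \<Rightarrow> int \<Rightarrow> 'a fps) \<Rightarrow> nat \<Rightarrow> int \<Rightarrow> 'a fps" where
  "fairy_dx N \<kappa> c j k = fps_deriv (c j k) + fairy_shift N \<kappa> c j k"

definition fairy_dt ::
  "nat \<Rightarrow> 'a::field_char_0 \<Rightarrow> (nat \<Rightarrow> int \<Rightarrow> 'a fps) \<Rightarrow> nat \<Rightarrow> int \<Rightarrow> 'a fps" where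
  "fairy_dt N \<kappa> c j k =
     fps_const (of_int (k + 1) - of_nat (j + 1) / of_nat N) * c j (k + 1)
     + fps_const (- (1 / of_nat N)) * fps_X * fairy_shift N \<kappa> c j (k + 1)"

definition fairy_L ::
  "nat \<Rightarrow> 'a::field_char_0 \<Rightarrow> (nat \<Rightarrow> 'a fps) \<Rightarrow> (nat \<Rightarrow> int \<Rightarrow> 'a fps) \<Rightarrow> nat \<Rightarrow> int \<Rightarrow> 'a fps" where
  "fairy_L N \<kappa> u c j k = (\<Sum>i\<le>N. GD_op N u (int i) * (fairy_dx N \<kappa> ^^ i) c j k)"

text \<open>The admissible values of \<open>\<kappa>\<close> are signs, so \<open>\<kappa>\<close>
  is its own inverse. This turns the division by \<open>\<kappa>\<close> that the Airy equation
  calls for into a multiplication.\<close>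

locale airy =
  fixes N :: nat and \<kappa> :: "'a::field_char_0"
  assumes N: "2 \<le> N" and \<kappa>: "\<kappa> * \<kappa> = 1"
begin

abbreviation pm :: "'a fps psdo \<Rightarrow> 'a fps psdo \<Rightarrow> 'a fps psdo" (infixl "\<odot>" 70)
  where "R \<odot> S \<equiv> psdo_mult fps_deriv R S"

abbreviation "\<gamma> \<equiv> - (\<kappa> / of_nat N)"

text \<open>\<open>T\<close> acts by multiplication from the right like \<open>t\<close> on expansions, because the Airy equation
  says that \<open>(x - y) E\<^sub>0\<close> is \<open>- N \<kappa> t E\<^bsub>N-1\<^esub>\<close>. Likewise \<open>\<partial>\<^sub>t\<close> becomes multiplication by \<open>\<kappa> \<partial>\<^sup>N\<close> from
  the right, and \<open>E j k\<close> represents \<open>t\<^sup>k E\<^sub>j\<close>.\<close>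

definition T :: "'a fps psdo" where
  "T = pmono (fps_const \<gamma>) (1 - int N) \<odot> pmono fps_X 0"

definition E :: "int \<Rightarrow> nat \<Rightarrow> 'a fps psdo" where
  "E j k = pmono 1 j \<odot> psdo_power fps_deriv T k"

lemma deriv_consts [simp]: "fps_deriv (fps_deriv fps_X) = (0 :: 'a fps)" by simp

lemma order_T: "order_le (1 - int N) T"
  unfolding T_def using fps.order_le_mult[of "1 - int N" _ 0] by auto

lemma order_T_1: "order_le 1 T"
  using order_T by (rule order_le_mono) simp

lemma order_T_power: "order_le (int k * (1 - int N)) (psdo_power fps_deriv T k)"
proof (induction k)
  case 0
  show ?case unfolding fps.psdo_power_0 by auto
next
  case (Suc k)
  from fps.order_le_mult[OF order_T this] show ?case by (simp add: algebra_simps)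
qed

lemma order_E: "order_le (j + int k * (1 - int N)) (E j k)"
  unfolding E_def using order_T_power by auto

text \<open>As N is at least 2, every factor \<open>T\<close> lowers the order by at least one. This
  coarser bound is the form that \<open>psum\<close> asks for.\<close>

lemma order_E': "order_le (j - int k) (E j k)"
proof (rule order_le_mono[OF order_E])
  have "int k * (1 - int N) \<le> int k * (-1)" using N by (intro mult_left_mono) auto
  then show "j + int k * (1 - int N) \<le> j - int k" by simp
qed

lemma E_0: "E j 0 = pmono 1 j"
  unfolding E_def fps.psdo_power_0 by (simp add: fps.psdo_mult_pmono_const)

lemma E_mult_T: "E j k \<odot> T = E j (Suc k)"
  unfolding E_def fps.psdo_power_Suc_right[OF order_T_1]
  by (rule fps.psdo_mult_assoc[OF order_le_pmono[OF order_refl] order_T_power order_T])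

lemma pmono_mult_E: "pmono 1 i \<odot> E j k = E (i + j) k"
  unfolding E_def
  by (subst fps.psdo_mult_assoc[symmetric, OF order_le_pmono[OF order_refl] order_le_pmono[OF order_refl] order_T_power])
    (simp add: fps.psdo_mult_pmono_const)

lemma of_int_mult_const: "of_int k * fps_const c = fps_const (of_int k * c :: 'a)"
  by (simp add: fps_of_int[symmetric])

lemma pmono_mult_T:
  "pmono 1 j \<odot> T = pmono (fps_const \<gamma> * fps_X) (j + 1 - int N)
     + pmono (fps_const (of_int (j + 1 - int N) * \<gamma>)) (j - int N)"
proof -
  have "pmono 1 j \<odot> T = (pmono 1 j \<odot> pmono (fps_const \<gamma>) (1 - int N)) \<odot> pmono fps_X 0"
    unfolding T_def by (rule fps.psdo_mult_assoc[symmetric]) auto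
  also have "pmono 1 j \<odot> pmono (fps_const \<gamma>) (1 - int N) = pmono (fps_const \<gamma>) (j + 1 - int N)"
    by (simp add: fps.psdo_mult_pmono_const algebra_simps)
  also have "pmono (fps_const \<gamma>) (j + 1 - int N) \<odot> pmono fps_X 0
    = pmono (fps_const \<gamma> * fps_X) (j + 1 - int N)
     + pmono (fps_const (of_int (j + 1 - int N) * \<gamma>)) (j - int N)"
    unfolding fps.psdo_mult_pmono_linear[OF deriv_consts]
    by (simp add: of_int_mult_const diff_diff_eq del: fps_const_neg of_int_diff of_int_add)
  finally show ?thesis .
qed

lemma pmono_mult_T_power: "pmono r i \<odot> psdo_power fps_deriv T k = pmono r 0 \<odot> E i k"
  unfolding E_def
  by (subst fps.psdo_mult_assoc[symmetric, OF order_le_pmono[OF order_refl] order_le_pmono[OF order_refl] order_T_power])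
    (simp add: fps.psdo_mult_pmono_const)

text \<open>Moves the x - y of the leftmost \<open>T\<close> to the front. This recursion yields
  both the elimination of the top index and the values on the diagonal.\<close>

lemma E_Suc: "E j (Suc k) = pmono (fps_const \<gamma> * fps_X) 0 \<odot> E (j + 1 - int N) k
   + pmono (fps_const (of_int (j + 1 - int N) * \<gamma>)) 0 \<odot> E (j - int N) k"
proof -
  have "E j (Suc k) = (pmono 1 j \<odot> T) \<odot> psdo_power fps_deriv T k"
    unfolding E_def psdo_power.simps
    by (rule fps.psdo_mult_assoc[symmetric, OF order_le_pmono[OF order_refl] order_T order_T_power])
  also have "\<dots> = pmono (fps_const \<gamma> * fps_X) (j + 1 - int N) \<odot> psdo_power fps_deriv T k
     + pmono (fps_const (of_int (j + 1 - int N) * \<gamma>)) (j - int N) \<odot> psdo_power fps_deriv T k"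
    unfolding pmono_mult_T
    by (rule fps.psdo_mult_add_left[OF _ _ order_T_power]) (rule order_le_pmono[of _ "j + 1 - int N"], simp)+
  finally show ?thesis by (simp only: pmono_mult_T_power)
qed

text \<open>For j = N - 1 the second term of \<open>E_Suc\<close> has the factor 0. What is left is
  the Airy equation times a power of t.\<close>

lemma E_top: "E (int N - 1) (Suc k) = pmono (fps_const \<gamma> * fps_X) 0 \<odot> E 0 k"
  by (simp add: E_Suc)

definition B :: "'a fps psdo" where "B = pmono (fps_const \<kappa>) (int N)"

lemma order_B: "order_le (int N) B" unfolding B_def by auto

lemma \<kappa>\<gamma>: "\<kappa> * \<gamma> = - (1 / of_nat N)" "\<gamma> * \<kappa> = - (1 / of_nat N)"
  using \<kappa> by (simp_all add: field_simps)

text \<open>\<open>B \<odot> T\<close> equals -(1/N) \<partial> (x - y), and multiplying by it from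
  the right represents t \<open>\<partial>\<^sub>t\<close>. The factor t is included at once because
  the time derivative alone would require 1/t.\<close>

lemma pmono_mult_BT:
  "pmono 1 j \<odot> (B \<odot> T) = pmono (fps_const (- (1 / of_nat N)) * fps_X) (j + 1)
     + pmono (fps_const (- (of_int (j + 1) / of_nat N))) j"
proof -
  have "pmono 1 j \<odot> (B \<odot> T) = (pmono 1 j \<odot> (B \<odot> pmono (fps_const \<gamma>) (1 - int N))) \<odot> pmono fps_X 0"
    unfolding T_def B_def
    by (subst fps.psdo_mult_assoc[symmetric], auto, subst fps.psdo_mult_assoc[symmetric], auto)
  also have "pmono 1 j \<odot> (B \<odot> pmono (fps_const \<gamma>) (1 - int N)) = pmono (fps_const (- (1 / of_nat N))) (j + 1)"
    unfolding B_def by (simp add: fps.psdo_mult_pmono_const \<kappa>)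
  also have "pmono (fps_const (- (1 / of_nat N)) :: 'a fps) (j + 1) \<odot> pmono fps_X 0
    = pmono (fps_const (- (1 / of_nat N)) * fps_X) (j + 1)
     + pmono (fps_const (- (of_int (j + 1) / of_nat N))) j"
    unfolding fps.psdo_mult_pmono_linear[OF deriv_consts]
    by (simp add: of_int_mult_const del: fps_const_neg of_int_diff of_int_add)
  finally show ?thesis .
qed

lemma order_BT: "order_le 1 (B \<odot> T)"
  using fps.order_le_mult[OF order_B order_T] by simp

text \<open>The commutation rule of \<open>\<partial>\<^sub>t\<close> and t, with the factors in
  reverse order because both act from the right.\<close>

lemma TB: "T \<odot> B = B \<odot> T + pmono 1 0"
proof -
  have "T \<odot> B = pmono (fps_const \<gamma>) (1 - int N) \<odot> (pmono fps_X 0 \<odot> B)"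
    unfolding T_def B_def by (rule fps.psdo_mult_assoc) auto
  also have "pmono fps_X 0 \<odot> B = pmono (fps_X * fps_const \<kappa>) (int N)"
    unfolding B_def by (simp add: fps.psdo_mult_pmono_const)
  also have "pmono (fps_const \<gamma>) (1 - int N) \<odot> pmono (fps_X * fps_const \<kappa>) (int N)
    = pmono (fps_const (\<gamma> * \<kappa>) * fps_X) 1 + pmono (fps_const (of_int (1 - int N) * (\<gamma> * \<kappa>))) 0"
    by (subst fps.psdo_mult_pmono_linear)
      (simp_all add: of_int_mult_const mult_ac del: fps_const_neg of_int_diff)
  also have "of_int (1 - int N) * (\<gamma> * \<kappa>) = - (1 / of_nat N) + 1"
    using N unfolding \<kappa>\<gamma> by (simp add: field_simps)
  also have "pmono (fps_const (\<gamma> * \<kappa>) * fps_X) 1 + pmono (fps_const (- (1 / of_nat N) + 1)) 0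
    = pmono (fps_const (- (1 / of_nat N)) * fps_X) 1 + pmono (fps_const (- (1 / of_nat N))) 0 + pmono 1 0"
    unfolding \<kappa>\<gamma> fps_const_add[symmetric] by (auto simp: pmono_def simp del: fps_const_add fps_const_neg)
  also have "\<dots> = pmono 1 0 \<odot> (B \<odot> T) + pmono 1 0"
    unfolding pmono_mult_BT by simp
  finally show ?thesis by (simp only: fps.psdo_mult_1_left[OF order_BT])
qed

lemma T_BT: "T \<odot> (B \<odot> T) = (B \<odot> T) \<odot> T + T"
proof -
  have "T \<odot> (B \<odot> T) = (T \<odot> B) \<odot> T"
    by (rule fps.psdo_mult_assoc[symmetric, OF order_T order_B order_T])
  also have "T \<odot> B = B \<odot> T + pmono 1 0" by (rule TB)
  also have "(B \<odot> T + pmono 1 0) \<odot> T = (B \<odot> T) \<odot> T + pmono 1 0 \<odot> T"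
    by (rule fps.psdo_mult_add_left[OF order_BT _ order_T]) auto
  also have "pmono 1 0 \<odot> T = T" by (rule fps.psdo_mult_1_left[OF order_T])
  finally show ?thesis .
qed

text \<open>The Euler operator t \<open>\<partial>\<^sub>t\<close> has weight k on the k-th power of
  t; each factor \<open>T\<close> contributes 1 by \<open>T_BT\<close>.\<close>

lemma T_power_BT: "psdo_power fps_deriv T k \<odot> (B \<odot> T)
   = (B \<odot> T) \<odot> psdo_power fps_deriv T k + pmono (of_nat k) 0 \<odot> psdo_power fps_deriv T k"
proof (induction k)
  case 0
  show ?case unfolding fps.psdo_power_0
    by (simp only: fps.psdo_mult_1_left[OF order_BT] fps.psdo_mult_1_right[OF order_BT]
        of_nat_0 fps.psdo_mult_pmono_0_0 add_0_right)
next
  case (Suc k)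
  let ?P = "psdo_power fps_deriv T k"
  have P: "order_le 0 ?P"
    using order_T_power by (rule order_le_mono) (use N in \<open>simp add: mult_nonneg_nonpos\<close>)
  have S: "psdo_power fps_deriv T (Suc k) = ?P \<odot> T" by (rule fps.psdo_power_Suc_right[OF order_T_1])
  have "psdo_power fps_deriv T (Suc k) \<odot> (B \<odot> T) = (?P \<odot> T) \<odot> (B \<odot> T)" by (rule arg_cong[OF S])
  also have "\<dots> = ?P \<odot> (T \<odot> (B \<odot> T))"
    by (rule fps.psdo_mult_assoc[OF P order_T order_BT])
  also have "T \<odot> (B \<odot> T) = (B \<odot> T) \<odot> T + T" by (rule T_BT)
  also have "?P \<odot> ((B \<odot> T) \<odot> T + T) = ?P \<odot> ((B \<odot> T) \<odot> T) + ?P \<odot> T"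
    by (rule fps.psdo_mult_add_right[OF P fps.order_le_mult[OF order_BT order_T_1]])
      (use order_T_1 in \<open>auto intro: order_le_mono\<close>)
  also have "?P \<odot> ((B \<odot> T) \<odot> T) = (?P \<odot> (B \<odot> T)) \<odot> T"
    by (rule fps.psdo_mult_assoc[symmetric, OF P order_BT order_T])
  also have "?P \<odot> (B \<odot> T) = (B \<odot> T) \<odot> ?P + pmono (of_nat k) 0 \<odot> ?P" by (rule Suc.IH)
  also have "((B \<odot> T) \<odot> ?P + pmono (of_nat k) 0 \<odot> ?P) \<odot> T
      = ((B \<odot> T) \<odot> ?P) \<odot> T + (pmono (of_nat k) 0 \<odot> ?P) \<odot> T"
    by (rule fps.psdo_mult_add_left[OF fps.order_le_mult[OF order_BT P] _ order_T])
      (rule order_le_mono[OF fps.order_le_mult[OF order_le_pmono[OF order_refl] P]], simp)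
  also have "((B \<odot> T) \<odot> ?P) \<odot> T = (B \<odot> T) \<odot> (?P \<odot> T)"
    by (rule fps.psdo_mult_assoc[OF order_BT P order_T])
  also have "(pmono (of_nat k) 0 \<odot> ?P) \<odot> T = pmono (of_nat k) 0 \<odot> (?P \<odot> T)"
    by (rule fps.psdo_mult_assoc[OF order_le_pmono[OF order_refl] P order_T])
  also have "(B \<odot> T) \<odot> (?P \<odot> T) + pmono (of_nat k) 0 \<odot> (?P \<odot> T) + ?P \<odot> T
     = (B \<odot> T) \<odot> (?P \<odot> T) + pmono (of_nat (Suc k)) 0 \<odot> (?P \<odot> T)"
    using fps.psdo_mult_pmono_0_left[OF fps.order_le_mult[OF P order_T]]
    by (intro ext) (simp add: distrib_right)
  also have "?P \<odot> T = psdo_power fps_deriv T (Suc k)" by (rule S[symmetric])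
  finally show ?case .
qed

text \<open>The chain rule for the time derivative, multiplied by t, is recovered from operator
  algebra: k comes from the power of t and -(j + 1)/N from the scaling of the Airy function.\<close>

lemma E_mult_BT:
  "E j k \<odot> (B \<odot> T) = pmono (fps_const (of_nat k - of_int (j + 1) / of_nat N)) 0 \<odot> E j k
     + pmono (fps_const (- (1 / of_nat N)) * fps_X) 0 \<odot> E (j + 1) k"
proof -
  let ?P = "psdo_power fps_deriv T k"
  have P: "order_le 0 ?P"
    using order_T_power by (rule order_le_mono) (use N in \<open>simp add: mult_nonneg_nonpos\<close>)
  have "E j k \<odot> (B \<odot> T) = pmono 1 j \<odot> (?P \<odot> (B \<odot> T))"
    unfolding E_def by (rule fps.psdo_mult_assoc[OF order_le_pmono[OF order_refl] P order_BT])
  also have "?P \<odot> (B \<odot> T) = (B \<odot> T) \<odot> ?P + pmono (of_nat k) 0 \<odot> ?P" by (rule T_power_BT)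
  also have "pmono 1 j \<odot> ((B \<odot> T) \<odot> ?P + pmono (of_nat k) 0 \<odot> ?P) = pmono 1 j \<odot> ((B \<odot> T) \<odot> ?P) + pmono 1 j \<odot> (pmono (of_nat k) 0 \<odot> ?P)"
    by (rule fps.psdo_mult_add_right[OF order_le_pmono[OF order_refl] fps.order_le_mult[OF order_BT P]])
      (rule order_le_mono[OF fps.order_le_mult[OF order_le_pmono[OF order_refl] P]], simp)
  also have "pmono 1 j \<odot> ((B \<odot> T) \<odot> ?P) = (pmono 1 j \<odot> (B \<odot> T)) \<odot> ?P"
    by (rule fps.psdo_mult_assoc[symmetric, OF order_le_pmono[OF order_refl] order_BT P])
  also have "\<dots> = pmono (fps_const (- (1 / of_nat N)) * fps_X) (j + 1) \<odot> ?P
      + pmono (fps_const (- (of_int (j + 1) / of_nat N))) j \<odot> ?P"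
    unfolding pmono_mult_BT
    by (rule fps.psdo_mult_add_left[OF order_le_pmono[OF order_refl] _ P]) (simp add: order_le_pmono)
  also have "pmono 1 j \<odot> (pmono (of_nat k) 0 \<odot> ?P) = (pmono 1 j \<odot> pmono (of_nat k) 0) \<odot> ?P"
    by (rule fps.psdo_mult_assoc[symmetric, OF order_le_pmono[OF order_refl] order_le_pmono[OF order_refl] P])
  also have "pmono 1 j \<odot> pmono (of_nat k) 0 = pmono (fps_const (of_nat k) :: 'a fps) j"
    by (simp add: fps.psdo_mult_pmono_const fps_of_nat)
  finally have "E j k \<odot> (B \<odot> T) = pmono (fps_const (- (1 / of_nat N)) * fps_X) 0 \<odot> E (j + 1) k
      + pmono (fps_const (- (of_int (j + 1) / of_nat N))) 0 \<odot> E j k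
      + pmono (fps_const (of_nat k)) 0 \<odot> E j k"
    unfolding pmono_mult_T_power .
  moreover have "fps_const (of_nat k - of_int (j + 1) / of_nat N)
      = fps_const (- (of_int (j + 1) / of_nat N)) + fps_const (of_nat k :: 'a)"
    unfolding fps_const_add by simp
  ultimately show ?thesis
    by (simp only: fps.psdo_mult_pmono_0_add[OF order_E] ac_simps)
qed

text \<open>At x = y the first term of \<open>E_Suc\<close> drops out. The other one contributes
  \<kappa> (1 - (j + 1)/N) and replaces j by j - N, which raises 1 - (j + 1)/N by 1; the factors
  build up the Pochhammer symbol.\<close>

lemma E_at_0:
  "fps_nth (E j k n) 0 = (if n = j - int k * int N
     then \<kappa> ^ k * pochhammer (1 - of_int (j + 1) / of_nat N) k else 0)"
proof (induction k arbitrary: j)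
  case 0
  then show ?case by (simp add: E_0 pmono_def)
next
  case (Suc k)
  have "fps_nth (E j (Suc k) n) 0 = of_int (j + 1 - int N) * \<gamma> * (fps_nth (E (j - int N) k n) 0)"
    unfolding E_Suc
    by (simp add: fps.psdo_mult_pmono_0_left[OF order_E] mult.assoc del: fps_const_neg)
  also have "of_int (j + 1 - int N) * \<gamma> = \<kappa> * (1 - of_int (j + 1) / of_nat N)"
    using N by (simp add: field_simps)
  also have "fps_nth (E (j - int N) k n) 0 = (if n = j - int (Suc k) * int N
     then \<kappa> ^ k * pochhammer (1 - of_int (j + 1) / of_nat N + 1) k else 0)"
  proof -
    have "1 - of_int (j - int N + 1) / of_nat N = 1 - of_int (j + 1) / of_nat N + (1::'a)"
      using N by (simp add: field_simps)
    then show ?thesis unfolding Suc.IH by (simp add: algebra_simps)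
  qed
  finally show ?case by (simp add: pochhammer_rec)
qed

end

context derivation
begin

lemma pmono_1_mult_pmono: "pmono 1 1 \<odot> pmono f 0 = pmono f 1 + pmono (d f) 0"
proof
  fix n :: int
  consider "n > 1" | "n = 1" | "n = 0" | "n < 0" by linarith
  then show "(pmono 1 1 \<odot> pmono f 0) n = (pmono f 1 + pmono (d f) 0) n"
  proof cases
    case 4
    then show ?thesis by (simp add: psdo_mult_pmono_pmono int_choose_eq_0) (simp add: pmono_def)
  qed (simp_all add: psdo_mult_pmono_pmono, simp_all add: pmono_def)
qed

lemma psdo_mult_pmono_const_right:
  assumes "order_le a R" "d s = 0" shows "(R \<odot> pmono s j) n = s * R (n - j)"
proof -
  have 0: "(d ^^ l) s = (if l = 0 then s else 0)" for l
    by (cases l) (simp_all add: assms funpow_swap1 del: funpow.simps(2) add: funpow_Suc_right)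
  have "(R \<odot> pmono s j) n = (\<Sum>i\<in>{n-j..a}. if i = n - j then s * R i else 0)"
    by (subst psdo_mult_pmono_right[OF assms(1)], rule sum.cong) (auto simp: 0)
  also have "\<dots> = s * R (n - j)" using assms by (simp add: order_le_def)
  finally show ?thesis .
qed

end

section \<open>The heat equation as an intertwining relation\<close>

context airy
begin

lemmas assoc = fps.psdo_mult_assoc

definition layer :: "(nat \<Rightarrow> int \<Rightarrow> 'a fps) \<Rightarrow> nat \<Rightarrow> 'a fps psdo" where
  "layer c k = (\<Sum>j\<le>N-2. pmono (c j (int k)) 0 \<odot> E (int j) k)"

text \<open>The expansion after raising j, with the top index N - 1 kept: eliminating it costs a
  factor 1/t, which is at hand only after multiplication by \<open>T\<close>.\<close>

definition raised_layer :: "(nat \<Rightarrow> int \<Rightarrow> 'a fps) \<Rightarrow> nat \<Rightarrow> 'a fps psdo" where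
  "raised_layer c k = (\<Sum>j\<le>N-2. pmono (c j (int k)) 0 \<odot> E (int j + 1) k)"

definition \<Phi> :: "(nat \<Rightarrow> int \<Rightarrow> 'a fps) \<Rightarrow> 'a fps psdo" where
  "\<Phi> c = psum (layer c)"

text \<open>Multiplication by the m-th power of t. \<open>\<Phi>\<close> reads off nonnegative
  powers of t only, so expansions are shifted until no negative power is left.\<close>

definition shift :: "nat \<Rightarrow> (nat \<Rightarrow> int \<Rightarrow> 'a fps) \<Rightarrow> nat \<Rightarrow> int \<Rightarrow> 'a fps" where
  "shift m c j k = c j (k - int m)"

definition starts_at :: "int \<Rightarrow> (nat \<Rightarrow> int \<Rightarrow> 'a fps) \<Rightarrow> bool" where
  "starts_at m c \<longleftrightarrow> (\<forall>j\<le>N-2. \<forall>k<m. c j k = 0)"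

lemma order_pmono_E: "order_le (j - int k) (pmono f 0 \<odot> E j k)"
  by (rule order_le_mono[OF fps.order_le_mult[OF order_le_pmono[OF order_refl] order_E']]) simp

lemma order_layer: "order_le (int N - 2 - int k) (layer c k)"
  unfolding layer_def
  by (intro order_le_sum order_le_mono[OF order_pmono_E]) (use N in auto)

lemma order_raised_layer: "order_le (int N - 1 - int k) (raised_layer c k)"
  unfolding raised_layer_def
  by (intro order_le_sum order_le_mono[OF order_pmono_E]) (use N in auto)

lemma order_\<Phi>: "order_le (int N - 2) (\<Phi> c)"
  unfolding \<Phi>_def by (rule order_le_psum[OF order_layer])

lemma \<Phi>_cong: "(\<And>j k. j \<le> N - 2 \<Longrightarrow> c j k = c' j k) \<Longrightarrow> \<Phi> c = \<Phi> c'"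
  unfolding \<Phi>_def layer_def by simp

lemma layer_mult:
  assumes "order_le b S"
  shows "layer c k \<odot> S = (\<Sum>j\<le>N-2. pmono (c j (int k)) 0 \<odot> (E (int j) k \<odot> S))"
proof -
  have "layer c k \<odot> S = (\<Sum>j\<le>N-2. (pmono (c j (int k)) 0 \<odot> E (int j) k) \<odot> S)"
    unfolding layer_def
    by (rule fps.psdo_mult_sum_left[where a="int N - 2", OF order_le_mono[OF order_pmono_E] assms]) (use N in auto)
  then show ?thesis
    by (simp only: assoc[OF order_le_pmono[OF order_refl] order_E assms])
qed

lemma raised_layer_mult:
  assumes "order_le b S"
  shows "raised_layer c k \<odot> S = (\<Sum>j\<le>N-2. pmono (c j (int k)) 0 \<odot> (E (int j + 1) k \<odot> S))"
proof -
  have "raised_layer c k \<odot> S = (\<Sum>j\<le>N-2. (pmono (c j (int k)) 0 \<odot> E (int j + 1) k) \<odot> S)"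
    unfolding raised_layer_def
    by (rule fps.psdo_mult_sum_left[where a="int N - 1", OF order_le_mono[OF order_pmono_E] assms]) (use N in auto)
  then show ?thesis
    by (simp only: assoc[OF order_le_pmono[OF order_refl] order_E assms])
qed

lemma \<Phi>_mult:
  assumes "order_le b S"
  shows "\<Phi> c \<odot> S = psum (\<lambda>k. layer c k \<odot> S)"
  unfolding \<Phi>_def by (rule fps.psdo_mult_psum_left[OF assms order_layer])

lemma \<Phi>_mult_T:
  assumes "starts_at 0 c" shows "\<Phi> c \<odot> T = \<Phi> (shift 1 c)"
proof -
  have "layer c k \<odot> T = layer (shift 1 c) (Suc k)" for k
    unfolding layer_mult[OF order_T] by (simp add: layer_def shift_def E_mult_T)
  then have "\<Phi> c \<odot> T = psum (\<lambda>k. layer (shift 1 c) (Suc k))"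
    unfolding \<Phi>_mult[OF order_T] by simp
  moreover have "layer (shift 1 c) 0 = 0"
    using assms by (simp add: layer_def shift_def starts_at_def)
  ultimately show ?thesis
    unfolding \<Phi>_def[of "shift 1 c"] psum_Suc[OF order_layer] by simp
qed

lemma \<Phi>_mult_T_power:
  assumes "starts_at 0 c" shows "\<Phi> c \<odot> psdo_power fps_deriv T m = \<Phi> (shift m c)"
proof (induction m)
  case 0
  have "shift 0 c = c" by (intro ext) (simp add: shift_def)
  then show ?case unfolding fps.psdo_power_0 fps.psdo_mult_1_right[OF order_\<Phi>] by simp
next
  case (Suc m)
  have "\<Phi> c \<odot> psdo_power fps_deriv T (Suc m) = (\<Phi> c \<odot> psdo_power fps_deriv T m) \<odot> T"
    unfolding fps.psdo_power_Suc_right[OF order_T_1]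
    by (rule assoc[symmetric, OF order_\<Phi> order_T_power order_T])
  also have "\<Phi> c \<odot> psdo_power fps_deriv T m = \<Phi> (shift m c)" by (rule Suc.IH)
  also have "\<Phi> (shift m c) \<odot> T = \<Phi> (shift 1 (shift m c))"
    by (rule \<Phi>_mult_T) (use assms in \<open>auto simp: starts_at_def shift_def\<close>)
  also have "shift 1 (shift m c) = shift (Suc m) c"
    by (intro ext) (simp add: shift_def algebra_simps)
  finally show ?case .
qed

lemma layer_add: "layer (\<lambda>j k. c j k + c' j k) k = layer c k + layer c' k"
  unfolding layer_def by (simp only: fps.psdo_mult_pmono_0_add[OF order_E] sum.distrib)

lemma \<Phi>_add: "\<Phi> (\<lambda>j k. c j k + c' j k) = \<Phi> c + \<Phi> c'"
  unfolding \<Phi>_def psum_add[OF order_layer order_layer, symmetric] layer_add ..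

lemma \<Phi>_scale: "\<Phi> (\<lambda>j k. f * c j k) = pmono f 0 \<odot> \<Phi> c"
proof -
  have "layer (\<lambda>j k. f * c j k) = (\<lambda>k. pmono f 0 \<odot> layer c k)"
    unfolding layer_def
    by (rule ext, subst fps.psdo_mult_sum_right[where b="int N - 2", OF order_le_pmono[OF order_refl] order_le_mono[OF order_pmono_E]])
      (use N in \<open>auto simp: fps.psdo_mult_pmono_0_mult[OF order_E]\<close>)
  then show ?thesis
    unfolding \<Phi>_def fps.psdo_mult_psum_right[OF order_le_pmono[OF order_refl] order_layer] by (rule arg_cong)
qed

lemma \<Phi>_sum: "\<Phi> (\<lambda>j k. \<Sum>i\<in>I. c i j k) = (\<Sum>i\<in>I. \<Phi> (c i))"
proof (induction I rule: infinite_finite_induct)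
  case (insert i I)
  then show ?case using \<Phi>_add[of "c i" "\<lambda>j k. \<Sum>i\<in>I. c i j k"] by simp
qed (auto simp: \<Phi>_def layer_def psum_def)

lemma raised_mult_T:
  assumes "starts_at 0 c"
  shows "psum (raised_layer c) \<odot> T = \<Phi> (shift 1 (fairy_shift N \<kappa> c))"
proof -
  \<comment> \<open>\<open>G\<close> collects the contributions of j = N - 2: after multiplication
    by \<open>T\<close> they carry the top index, and \<open>E_top\<close> brings them back to the
    power k. The other j, collected in \<open>S\<close>, move on to the power k + 1.\<close>
  define G where "G k = pmono (fps_const \<gamma> * fps_X * c (N - 2) (int k)) 0 \<odot> E 0 k" for k
  define S where "S k = (\<Sum>j<N-2. pmono (c j (int k)) 0 \<odot> E (int j + 1) (Suc k))" for k
  have G: "order_le (int N - 2 - int k) (G k)" for k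
    unfolding G_def by (rule order_le_mono[OF order_pmono_E]) (use N in auto)
  have G': "order_le (int N - 2 - int k) (G (Suc k))" for k
    using G[of "Suc k"] by (rule order_le_mono) simp
  have S: "order_le (int N - 2 - int k) (S k)" for k
    unfolding S_def by (intro order_le_sum order_le_mono[OF order_pmono_E]) (use N in auto)
  have N2: "int (N - 2) + 1 = int N - 1" using N by simp
  have "raised_layer c k \<odot> T = S k + G k" for k
  proof -
    have "{..N - 2} = insert (N - 2) {..<N - 2}" by auto
    then have "raised_layer c k \<odot> T = pmono (c (N - 2) (int k)) 0 \<odot> E (int N - 1) (Suc k) + S k"
      unfolding raised_layer_mult[OF order_T] S_def E_mult_T by (simp add: N2)
    also have "pmono (c (N - 2) (int k)) 0 \<odot> E (int N - 1) (Suc k) = G k"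
      unfolding E_top G_def by (simp only: fps.psdo_mult_pmono_0_mult[OF order_E, symmetric] mult_ac)
    finally show ?thesis by (simp only: add.commute)
  qed
  then have 1: "psum (raised_layer c) \<odot> T = psum S + psum G"
    unfolding fps.psdo_mult_psum_left[OF order_T order_raised_layer]
    by (simp only: psum_add[OF S G])
  have 2: "layer (shift 1 (fairy_shift N \<kappa> c)) 0 = G 0"
  proof -
    have "c (j - 1) (-1) = 0" if "j \<le> N - 2" for j using assms that by (auto simp: starts_at_def)
    then have "layer (shift 1 (fairy_shift N \<kappa> c)) 0 = (\<Sum>j\<le>N - 2. if j = 0 then G 0 else 0)"
      unfolding layer_def shift_def fairy_shift_def G_def by (intro sum.cong refl) auto
    then show ?thesis by (simp add: G_def)
  qed
  have 3: "layer (shift 1 (fairy_shift N \<kappa> c)) (Suc k) = G (Suc k) + S k" for k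
    unfolding layer_def S_def G_def
    by (subst sum.atMost_shift) (simp add: shift_def fairy_shift_def add.commute)
  have "\<Phi> (shift 1 (fairy_shift N \<kappa> c)) = G 0 + (psum (\<lambda>k. G (Suc k)) + psum S)"
    unfolding \<Phi>_def psum_Suc[OF order_layer] 2 3 by (simp only: psum_add[OF G' S])
  also have "\<dots> = psum S + psum G"
    unfolding psum_Suc[OF G] by (simp only: add_ac)
  finally show ?thesis using 1 by simp
qed

lemma deriv_mult_\<Phi>: "pmono 1 1 \<odot> \<Phi> c = psum (raised_layer c) + \<Phi> (\<lambda>j k. fps_deriv (c j k))"
proof -
  have e: "pmono 1 1 \<odot> (pmono f 0 \<odot> E j k) = pmono f 0 \<odot> E (j + 1) k + pmono (fps_deriv f) 0 \<odot> E j k" for f j k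
  proof -
    have "pmono 1 1 \<odot> (pmono f 0 \<odot> E j k) = (pmono 1 1 \<odot> pmono f 0) \<odot> E j k"
      by (rule assoc[symmetric, OF order_le_pmono[OF order_refl] order_le_pmono[OF order_refl] order_E])
    also have "pmono 1 1 \<odot> pmono f 0 = pmono f 1 + pmono (fps_deriv f) 0" by (rule fps.pmono_1_mult_pmono)
    also have "(pmono f 1 + pmono (fps_deriv f) 0) \<odot> E j k = pmono f 1 \<odot> E j k + pmono (fps_deriv f) 0 \<odot> E j k"
      by (rule fps.psdo_mult_add_left[OF order_le_pmono[OF order_refl] _ order_E]) auto
    also have "pmono f 1 = pmono f 0 \<odot> pmono 1 1" by (simp add: fps.psdo_mult_pmono_const)
    also have "(pmono f 0 \<odot> pmono 1 1) \<odot> E j k = pmono f 0 \<odot> E (j + 1) k"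
      by (subst assoc[OF order_le_pmono[OF order_refl] order_le_pmono[OF order_refl] order_E])
        (simp add: pmono_mult_E add.commute)
    finally show ?thesis .
  qed
  have "pmono 1 1 \<odot> layer c k = raised_layer c k + layer (\<lambda>j k. fps_deriv (c j k)) k" for k
    unfolding layer_def raised_layer_def
    by (subst fps.psdo_mult_sum_right[where b="int N - 2", OF order_le_pmono[OF order_refl] order_le_mono[OF order_pmono_E]])
      (use N in \<open>auto simp only: e sum.distrib\<close>)
  then show ?thesis
    unfolding \<Phi>_def fps.psdo_mult_psum_right[OF order_le_pmono[OF order_refl] order_layer]
    using psum_add[OF order_raised_layer, of "\<lambda>k. layer (\<lambda>j k. fps_deriv (c j k)) k"]
      order_le_mono[OF order_layer, of _ "int N - 1 - _"] by simp
qed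

lemma \<Phi>_dx:
  assumes "starts_at 0 c"
  shows "\<Phi> (shift 1 (fairy_dx N \<kappa> c)) = pmono 1 1 \<odot> (\<Phi> c \<odot> T)"
proof -
  have "pmono 1 1 \<odot> (\<Phi> c \<odot> T) = (pmono 1 1 \<odot> \<Phi> c) \<odot> T"
    by (rule assoc[symmetric, OF order_le_pmono[OF order_refl] order_\<Phi> order_T])
  also have "pmono 1 1 \<odot> \<Phi> c = psum (raised_layer c) + \<Phi> (\<lambda>j k. fps_deriv (c j k))" by (rule deriv_mult_\<Phi>)
  also have "(psum (raised_layer c) + \<Phi> (\<lambda>j k. fps_deriv (c j k))) \<odot> T
    = psum (raised_layer c) \<odot> T + \<Phi> (\<lambda>j k. fps_deriv (c j k)) \<odot> T"
    by (rule fps.psdo_mult_add_left[OF order_le_psum[OF order_raised_layer] order_le_mono[OF order_\<Phi>] order_T]) simp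
  also have "psum (raised_layer c) \<odot> T = \<Phi> (shift 1 (fairy_shift N \<kappa> c))" by (rule raised_mult_T[OF assms])
  also have "\<Phi> (\<lambda>j k. fps_deriv (c j k)) \<odot> T = \<Phi> (shift 1 (\<lambda>j k. fps_deriv (c j k)))"
    by (rule \<Phi>_mult_T) (use assms in \<open>simp add: starts_at_def\<close>)
  also have "\<Phi> (shift 1 (fairy_shift N \<kappa> c)) + \<Phi> (shift 1 (\<lambda>j k. fps_deriv (c j k)))
    = \<Phi> (shift 1 (fairy_dx N \<kappa> c))"
    unfolding \<Phi>_add[symmetric] by (rule \<Phi>_cong) (simp add: shift_def fairy_dx_def add.commute)
  finally show ?thesis by (rule sym)
qed

text \<open>Two powers of t are needed, one for the time derivative and one for the elimination of
  the top index in the term with x - y.\<close>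

lemma \<Phi>_dt:
  assumes "starts_at 0 c"
  shows "\<Phi> (shift 2 (fairy_dt N \<kappa> c)) = (\<Phi> c \<odot> (B \<odot> T)) \<odot> T"
proof -
  define g where "g j k = fps_const (of_int k - of_nat (j + 1) / of_nat N) * c j k" for j k
  let ?f = "fps_const (- (1 / of_nat N)) * fps_X :: 'a fps"
  have "layer c k \<odot> (B \<odot> T) = layer g k + pmono ?f 0 \<odot> raised_layer c k" for k
  proof -
    have "pmono f 0 \<odot> (E j k \<odot> (B \<odot> T)) = pmono (fps_const (of_nat k - of_int (j + 1) / of_nat N) * f) 0 \<odot> E j k
      + pmono ?f 0 \<odot> (pmono f 0 \<odot> E (j + 1) k)" for f j
    proof -
      let ?g = "fps_const (of_nat k - of_int (j + 1) / of_nat N)"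
      have o: "order_le (j + 1) (pmono r 0 \<odot> E j k)" "order_le (j + 1) (pmono r 0 \<odot> E (j + 1) k)" for r
        by (rule order_le_mono[OF order_pmono_E], simp)+
      have "pmono f 0 \<odot> (E j k \<odot> (B \<odot> T))
        = pmono f 0 \<odot> (pmono ?g 0 \<odot> E j k) + pmono f 0 \<odot> (pmono ?f 0 \<odot> E (j + 1) k)"
        unfolding E_mult_BT by (rule fps.psdo_mult_add_right[OF order_le_pmono[OF order_refl] o])
      also have "pmono f 0 \<odot> (pmono ?g 0 \<odot> E j k) = pmono (?g * f) 0 \<odot> E j k"
        by (subst fps.psdo_mult_pmono_0_mult[OF order_E, symmetric]) (simp only: mult.commute)
      also have "pmono f 0 \<odot> (pmono ?f 0 \<odot> E (j + 1) k) = pmono ?f 0 \<odot> (pmono f 0 \<odot> E (j + 1) k)"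
        unfolding fps.psdo_mult_pmono_0_mult[OF order_E, symmetric] by (simp only: mult.commute)
      finally show ?thesis .
    qed
    then have "layer c k \<odot> (B \<odot> T) = (\<Sum>j\<le>N-2. pmono (g j (int k)) 0 \<odot> E (int j) k
        + pmono ?f 0 \<odot> (pmono (c j (int k)) 0 \<odot> E (int j + 1) k))"
      unfolding layer_mult[OF order_BT] g_def by (simp add: add.commute del: fps_const_neg)
    then show ?thesis
      unfolding layer_def raised_layer_def
      by (subst fps.psdo_mult_sum_right[where b="int N - 1", OF order_le_pmono[OF order_refl] order_le_mono[OF order_pmono_E]])
        (use N in \<open>auto simp only: sum.distrib\<close>)
  qed
  note e = this
  have "\<Phi> c \<odot> (B \<odot> T) = \<Phi> g + pmono ?f 0 \<odot> psum (raised_layer c)"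
  proof -
    have o1: "order_le (int N - 1 - int k) (layer g k)" for k
      by (rule order_le_mono[OF order_layer]) simp
    have o2: "order_le (int N - 1 - int k) (pmono ?f 0 \<odot> raised_layer c k)" for k
      by (rule order_le_mono[OF fps.order_le_mult[OF order_le_pmono[OF order_refl] order_raised_layer]]) simp
    show ?thesis
      unfolding \<Phi>_mult[OF order_BT] e psum_add[OF o1 o2] unfolding \<Phi>_def
        fps.psdo_mult_psum_right[OF order_le_pmono[OF order_refl] order_raised_layer] ..
  qed
  then have "(\<Phi> c \<odot> (B \<odot> T)) \<odot> T = (\<Phi> g + pmono ?f 0 \<odot> psum (raised_layer c)) \<odot> T" by (rule arg_cong)
  also have "\<dots> = \<Phi> g \<odot> T + (pmono ?f 0 \<odot> psum (raised_layer c)) \<odot> T"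
    by (rule fps.psdo_mult_add_left[where a="int N - 1", OF order_le_mono[OF order_\<Phi>]
        order_le_mono[OF fps.order_le_mult[OF order_le_pmono[OF order_refl] order_le_psum[OF order_raised_layer]]] order_T])
      auto
  also have "\<Phi> g \<odot> T = \<Phi> (shift 1 g)"
    by (rule \<Phi>_mult_T) (use assms in \<open>simp add: g_def starts_at_def\<close>)
  also have "(pmono ?f 0 \<odot> psum (raised_layer c)) \<odot> T = pmono ?f 0 \<odot> (psum (raised_layer c) \<odot> T)"
    by (rule assoc[OF order_le_pmono[OF order_refl] order_le_psum[OF order_raised_layer] order_T])
  also have "psum (raised_layer c) \<odot> T = \<Phi> (shift 1 (fairy_shift N \<kappa> c))" by (rule raised_mult_T[OF assms])
  also have "\<Phi> (shift 1 g) + pmono ?f 0 \<odot> \<Phi> (shift 1 (fairy_shift N \<kappa> c)) = \<Phi> (shift 2 (fairy_dt N \<kappa> c))"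
    unfolding \<Phi>_scale[symmetric] \<Phi>_add[symmetric]
    by (rule \<Phi>_cong) (simp add: shift_def fairy_dt_def g_def)
  finally show ?thesis by (rule sym)
qed

lemma shift_shift: "shift m (shift n c) = shift (m + n) c"
  by (intro ext) (simp add: shift_def algebra_simps)

lemma shift_dx: "fairy_dx N \<kappa> (shift m c) = shift m (fairy_dx N \<kappa> c)"
  by (intro ext) (simp add: shift_def fairy_dx_def fairy_shift_def algebra_simps)

lemma starts_at_dx: "starts_at m c \<Longrightarrow> starts_at (m - 1) (fairy_dx N \<kappa> c)"
  by (auto simp: starts_at_def fairy_dx_def fairy_shift_def)

lemma starts_at_shift: "starts_at m c \<Longrightarrow> starts_at (m + int n) (shift n c)"
  by (auto simp: starts_at_def shift_def)

lemma \<Phi>_shift_dx: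
  assumes "starts_at (1 - int N) c"
  shows "\<Phi> (shift N (fairy_dx N \<kappa> c)) = pmono 1 1 \<odot> \<Phi> (shift N c)"
proof -
  have s: "starts_at 0 (shift (N - 1) c)"
    using starts_at_shift[OF assms, of "N - 1"] N by simp
  have e: "shift N c = shift 1 (shift (N - 1) c)" for c using N by (simp add: shift_shift)
  have "\<Phi> (shift N (fairy_dx N \<kappa> c)) = \<Phi> (shift 1 (fairy_dx N \<kappa> (shift (N - 1) c)))"
    by (simp only: e shift_dx)
  also have "\<dots> = pmono 1 1 \<odot> (\<Phi> (shift (N - 1) c) \<odot> T)" by (rule \<Phi>_dx[OF s])
  also have "\<Phi> (shift (N - 1) c) \<odot> T = \<Phi> (shift N c)" by (simp only: \<Phi>_mult_T[OF s] e)
  finally show ?thesis .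
qed

text \<open>Each derivative lowers the least power of t by at most one, so a shift by N made in
  advance suffices for all derivatives up to the order of the operator.\<close>

lemma \<Phi>_shift_dx_funpow:
  assumes "starts_at 0 c" "i \<le> N"
  shows "starts_at (- int i) ((fairy_dx N \<kappa> ^^ i) c)
    \<and> \<Phi> (shift N ((fairy_dx N \<kappa> ^^ i) c)) = pmono 1 (int i) \<odot> \<Phi> (shift N c)"
  using assms(2)
proof (induction i)
  case 0
  with assms(1) show ?case by (simp add: fps.psdo_mult_1_left[OF order_\<Phi>])
next
  case (Suc i)
  let ?c = "(fairy_dx N \<kappa> ^^ i) c"
  have s: "starts_at (- int i) ?c" and IH: "\<Phi> (shift N ?c) = pmono 1 (int i) \<odot> \<Phi> (shift N c)" using Suc by auto
  have "starts_at (1 - int N) ?c" using s Suc.prems by (auto simp: starts_at_def)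
  then have "\<Phi> (shift N (fairy_dx N \<kappa> ?c)) = pmono 1 1 \<odot> (pmono 1 (int i) \<odot> \<Phi> (shift N c))"
    using \<Phi>_shift_dx IH by simp
  also have "\<dots> = (pmono 1 1 \<odot> pmono 1 (int i)) \<odot> \<Phi> (shift N c)"
    by (rule assoc[symmetric, OF order_le_pmono[OF order_refl] order_le_pmono[OF order_refl] order_\<Phi>])
  finally have "\<Phi> (shift N (fairy_dx N \<kappa> ?c)) = pmono 1 (int (Suc i)) \<odot> \<Phi> (shift N c)"
    by (simp add: fps.psdo_mult_pmono_const)
  moreover have "- int (Suc i) = - int i - 1" by simp
  then have "starts_at (- int (Suc i)) (fairy_dx N \<kappa> ?c)" using starts_at_dx[OF s] by (simp only:)
  ultimately show ?case by simp
qed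

lemma \<Phi>_L:
  assumes "starts_at 0 c"
  shows "\<Phi> (shift N (fairy_L N \<kappa> u c)) = GD_op N u \<odot> \<Phi> (shift N c)"
proof -
  let ?L = "GD_op N u"
  have "\<Phi> (shift N (fairy_L N \<kappa> u c))
    = \<Phi> (\<lambda>j k. \<Sum>i\<le>N. ?L (int i) * shift N ((fairy_dx N \<kappa> ^^ i) c) j k)"
    by (rule \<Phi>_cong) (simp add: shift_def fairy_L_def)
  also have "\<dots> = (\<Sum>i\<le>N. pmono (?L (int i)) 0 \<odot> (pmono 1 (int i) \<odot> \<Phi> (shift N c)))"
    unfolding \<Phi>_sum \<Phi>_scale using \<Phi>_shift_dx_funpow[OF assms] by (intro sum.cong refl) simp
  also have "\<dots> = (\<Sum>i\<le>N. pmono (?L (int i)) (int i) \<odot> \<Phi> (shift N c))"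
    by (intro sum.cong refl, subst assoc[symmetric, OF order_le_pmono[OF order_refl] order_le_pmono[OF order_refl] order_\<Phi>])
      (simp add: fps.psdo_mult_pmono_const)
  also have "\<dots> = (\<Sum>i\<le>N. pmono (?L (int i)) (int i)) \<odot> \<Phi> (shift N c)"
    by (rule fps.psdo_mult_sum_left[where a="int N", OF _ order_\<Phi>, symmetric]) auto
  also have "(\<Sum>i\<le>N. pmono (?L (int i)) (int i)) = ?L"
  proof
    fix n
    have "(\<Sum>i\<le>N. pmono (?L (int i)) (int i)) n = (\<Sum>i\<le>N. if i = nat n then (if 0 \<le> n then ?L n else 0) else 0)"
      unfolding sum_fun_apply by (intro sum.cong refl) (auto simp: pmono_def)
    also have "\<dots> = ?L n" by (auto simp: GD_op_def)
    finally show "(\<Sum>i\<le>N. pmono (?L (int i)) (int i)) n = ?L n" .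
  qed
  finally show ?thesis .
qed

text \<open>The leading coefficient of \<open>T\<close> is a nonzero multiple of x - y, and power
  series over a field have no zero divisors. Comparing leading coefficients therefore allows descent
  on the order of X.\<close>

lemma mult_T_cancel:
  assumes "order_le a X" "X \<odot> T = 0" shows "X = 0"
proof (rule fps.psdo_zeroI[OF assms(1)])
  fix q assume "order_le q X"
  from fps.psdo_mult_top[OF this order_T] have "X q * T (1 - int N) = 0" by (simp add: assms(2))
  moreover have "T (1 - int N) = fps_const \<gamma> * fps_X"
    unfolding T_def by (simp add: fps.psdo_mult_pmono_pmono)
  moreover have "\<kappa> \<noteq> 0" using \<kappa> by auto
  ultimately show "X q = 0" using N by simp
qed

lemma mult_T_power_cancel:
  assumes "order_le a X" "X \<odot> psdo_power fps_deriv T m = 0" shows "X = 0"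
  using assms
proof (induction m arbitrary: X a)
  case 0
  then show ?case unfolding fps.psdo_power_0 by (simp add: fps.psdo_mult_1_right)
next
  case (Suc m)
  have "(X \<odot> T) \<odot> psdo_power fps_deriv T m = X \<odot> (T \<odot> psdo_power fps_deriv T m)"
    by (rule assoc[OF Suc.prems(1) order_T order_T_power])
  also have "\<dots> = 0" using Suc.prems(2) by (simp only: psdo_power.simps)
  finally have "(X \<odot> T) \<odot> psdo_power fps_deriv T m = 0" .
  with Suc.IH[OF fps.order_le_mult[OF Suc.prems(1) order_T]] have "X \<odot> T = 0" by blast
  with Suc.prems show ?case by (blast intro: mult_T_cancel)
qed

lemma dressing:
  assumes c: "starts_at 0 c"
    and pde: "\<And>j k. j \<le> N - 2 \<Longrightarrow> fairy_dt N \<kappa> c j k = fps_const \<kappa> * fairy_L N \<kappa> u c j k"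
  shows "GD_op N u \<odot> \<Phi> c = \<Phi> c \<odot> pmono 1 (int N)"
proof -
  let ?P = "psdo_power fps_deriv T" and ?L = "GD_op N u" and ?\<kappa> = "pmono (fps_const \<kappa>) 0"
  have L: "order_le (int N) ?L" using GD_op_monic by (rule monic_orderD)
  have \<kappa>LR: "order_le (0 + (int N + (int N - 2))) (?\<kappa> \<odot> (?L \<odot> \<Phi> c))"
    by (intro fps.order_le_mult order_le_pmono order_refl L order_\<Phi>)
  have RB: "order_le (int N - 2 + int N) (\<Phi> c \<odot> B)" by (rule fps.order_le_mult[OF order_\<Phi> order_B])
  have s: "starts_at 0 (shift 2 (fairy_dt N \<kappa> c))"
    using c by (auto simp: starts_at_def shift_def fairy_dt_def fairy_shift_def)
  \<comment> \<open>Of the N powers of t, two are used up by \<open>\<Phi>_dt\<close>; the other m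
    are a plain shift.\<close>
  from le_Suc_ex[OF N] obtain m where m: "N = 2 + m" ..
  have PN: "psdo_power fps_deriv X N = X \<odot> (X \<odot> psdo_power fps_deriv X m)" for X
    by (simp add: m)
  have sN: "shift N c = shift m (shift 2 c)" for c by (simp add: shift_shift m add.commute)
  have 1: "\<Phi> (shift N (fairy_dt N \<kappa> c)) = (\<Phi> c \<odot> B) \<odot> ?P N"
  proof -
    have "\<Phi> (shift N (fairy_dt N \<kappa> c)) = ((\<Phi> c \<odot> (B \<odot> T)) \<odot> T) \<odot> ?P m"
      unfolding sN \<Phi>_dt[OF c, symmetric] by (rule \<Phi>_mult_T_power[OF s, symmetric])
    also have "\<dots> = (\<Phi> c \<odot> (B \<odot> T)) \<odot> (T \<odot> ?P m)"
      by (rule assoc[OF fps.order_le_mult[OF order_\<Phi> order_BT] order_T order_T_power])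
    also have "\<Phi> c \<odot> (B \<odot> T) = (\<Phi> c \<odot> B) \<odot> T"
      by (rule assoc[symmetric, OF order_\<Phi> order_B order_T])
    also have "((\<Phi> c \<odot> B) \<odot> T) \<odot> (T \<odot> ?P m) = (\<Phi> c \<odot> B) \<odot> (T \<odot> (T \<odot> ?P m))"
      by (rule assoc[OF RB order_T fps.order_le_mult[OF order_T order_T_power]])
    finally show ?thesis unfolding PN .
  qed
  have 2: "\<Phi> (shift N (fairy_dt N \<kappa> c)) = (?\<kappa> \<odot> (?L \<odot> \<Phi> c)) \<odot> ?P N"
  proof -
    have "\<Phi> (shift N (fairy_dt N \<kappa> c)) = \<Phi> (\<lambda>j k. fps_const \<kappa> * shift N (fairy_L N \<kappa> u c) j k)"
      by (rule \<Phi>_cong) (simp add: shift_def pde)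
    also have "\<dots> = ?\<kappa> \<odot> (?L \<odot> (\<Phi> c \<odot> ?P N))"
      unfolding \<Phi>_scale \<Phi>_L[OF c] \<Phi>_mult_T_power[OF c] ..
    also have "?L \<odot> (\<Phi> c \<odot> ?P N) = (?L \<odot> \<Phi> c) \<odot> ?P N"
      by (rule assoc[symmetric, OF L order_\<Phi> order_T_power])
    also have "?\<kappa> \<odot> ((?L \<odot> \<Phi> c) \<odot> ?P N) = (?\<kappa> \<odot> (?L \<odot> \<Phi> c)) \<odot> ?P N"
      by (rule assoc[symmetric, OF order_le_pmono[OF order_refl] fps.order_le_mult[OF L order_\<Phi>] order_T_power])
    finally show ?thesis .
  qed
  let ?a = "int N - 2 + int N"
  have o: "order_le ?a (\<Phi> c \<odot> B)" "order_le ?a (?\<kappa> \<odot> (?L \<odot> \<Phi> c))"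
    using RB \<kappa>LR by (auto intro: order_le_mono)
  have "(\<Phi> c \<odot> B - ?\<kappa> \<odot> (?L \<odot> \<Phi> c)) \<odot> ?P N = 0"
    unfolding fps.psdo_mult_diff_left[OF o order_T_power] using 1 2 by simp
  from mult_T_power_cancel[OF order_le_diff[OF o] this]
  have e: "\<Phi> c \<odot> B = ?\<kappa> \<odot> (?L \<odot> \<Phi> c)" by simp
  show ?thesis
  proof
    fix n
    have "fps_const \<kappa> * (?L \<odot> \<Phi> c) n = fps_const \<kappa> * \<Phi> c (n - int N)"
      using fun_cong[OF e[symmetric], of n] unfolding B_def
      by (simp add: fps.psdo_mult_pmono_const_right[OF order_\<Phi>] fps.psdo_mult_pmono_0_left[OF fps.order_le_mult[OF L order_\<Phi>]])
    moreover have "\<kappa> \<noteq> 0" using \<kappa> by auto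
    ultimately show "(?L \<odot> \<Phi> c) n = (\<Phi> c \<odot> pmono 1 (int N)) n"
      by (simp add: fps.psdo_mult_pmono_1[OF order_\<Phi>])
  qed
qed

section \<open>Fractional powers and the residue on the diagonal\<close>

lemma N_inverse: "fps_const (1 / of_nat N) * of_nat N = (1 :: 'a fps)"
  using N by (simp add: fps_of_nat[symmetric] del: fps_of_nat)

text \<open>With an inverse of R this would be uniqueness of the N-th root, applied to R \<partial>
  conjugated back by R. Telescoping gives the same without inverting R.\<close>

lemma dressing_root:
  assumes "GD_op N u \<odot> R = R \<odot> pmono 1 (int N)" and R: "order_le a R"
  shows "frac_power fps_deriv N (GD_op N u) p \<odot> R = R \<odot> pmono 1 (int p)"
proof -
  let ?A = "psdo_root fps_deriv N (GD_op N u)" and ?D = "\<lambda>n. pmono 1 (int n) :: 'a fps psdo"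
  let ?P = "psdo_power fps_deriv ?A"
  have A: "monic_order 1 ?A" by (rule fps.psdo_root_monic[OF N_inverse GD_op_monic])
  then have oA: "order_le 1 ?A" and oP: "order_le (int n) (?P n)" for n
    by (auto intro: monic_orderD fps.order_le_power)
  have oD: "order_le (int n) (?D n)" for n by auto
  have D: "?D (Suc n) = pmono 1 1 \<odot> ?D n" for n by (simp add: fps.psdo_mult_pmono_const)
  define X where "X = ?A \<odot> R - R \<odot> pmono 1 1"
  have oX: "order_le (1 + a) (?A \<odot> R)" "order_le (1 + a) (R \<odot> pmono 1 1)"
    using fps.order_le_mult[OF oA R] fps.order_le_mult[OF R order_le_pmono[OF order_refl], of 1 1]
    by (auto simp: add.commute)
  \<comment> \<open>The deviation for the n-th powers. It satisfies the recursion of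
    \<open>telescoping_cancel\<close> with X as its first nontrivial value, and the hypothesis says
    that it vanishes at N.\<close>
  define Y where "Y n = ?P n \<odot> R - R \<odot> ?D n" for n
  have oY: "order_le (int n + a) (?P n \<odot> R)" "order_le (int n + a) (R \<odot> ?D n)" for n
    using fps.order_le_mult[OF oP R, of n] fps.order_le_mult[OF R oD, of n] by (auto simp: add.commute)
  have "X = 0"
  proof (rule fps.telescoping_cancel[where Y=Y and P="?D" and N=N, OF A])
    show "order_le (1 + a) X" unfolding X_def by (intro order_le_diff oX)
    show "Y 0 = 0"
      unfolding Y_def fps.psdo_power_0
      by (simp add: fps.psdo_mult_1_left[OF R] fps.psdo_mult_1_right[OF R])
    show "Y (Suc n) = X \<odot> ?D n + ?A \<odot> Y n" for n
    proof -
      have 1: "X \<odot> ?D n = (?A \<odot> R) \<odot> ?D n - (R \<odot> pmono 1 1) \<odot> ?D n"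
        unfolding X_def by (rule fps.psdo_mult_diff_left[OF oX oD])
      have 2: "?A \<odot> Y n = ?A \<odot> (?P n \<odot> R) - ?A \<odot> (R \<odot> ?D n)"
        unfolding Y_def by (rule fps.psdo_mult_diff_right[OF oA oY])
      have 3: "(?A \<odot> R) \<odot> ?D n = ?A \<odot> (R \<odot> ?D n)" by (rule assoc[OF oA R oD])
      have 4: "(R \<odot> pmono 1 1) \<odot> ?D n = R \<odot> ?D (Suc n)"
        unfolding D by (rule assoc[OF R order_le_pmono[OF order_refl] oD])
      have 5: "?A \<odot> (?P n \<odot> R) = ?P (Suc n) \<odot> R"
        using assoc[OF oA oP R, of n] by simp
      show ?thesis unfolding 1 2 3 4 5 by (simp add: Y_def)
    qed
    show "Y N = 0" 
      using assms(1) by (simp add: Y_def fps.psdo_root_power[OF N_inverse GD_op_monic])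
  qed (use N_inverse in auto)
  then have AR: "?A \<odot> R = R \<odot> pmono 1 1" by (simp add: X_def)
  have "?P p \<odot> R = R \<odot> ?D p"
  proof (induction p)
    case 0
    show ?case
      unfolding fps.psdo_power_0
      by (simp add: fps.psdo_mult_1_left[OF R] fps.psdo_mult_1_right[OF R])
  next
    case (Suc n)
    have "?P (Suc n) \<odot> R = ?A \<odot> (?P n \<odot> R)" using assoc[OF oA oP R, of n] by simp
    also have "?P n \<odot> R = R \<odot> ?D n" by (rule Suc.IH)
    also have "?A \<odot> (R \<odot> ?D n) = (?A \<odot> R) \<odot> ?D n" by (rule assoc[symmetric, OF oA R oD])
    also have "\<dots> = R \<odot> ?D (Suc n)" unfolding AR D by (rule assoc[OF R order_le_pmono[OF order_refl] oD])
    finally show ?case .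
  qed
  then show ?thesis unfolding frac_power_def .
qed

text \<open>The right factor \<open>x - y\<close> contained in \<open>T\<close> removes the residue on the diagonal.\<close>

lemma residue_mult_X:
  assumes "order_le a Z" shows "fps_nth ((Z \<odot> pmono fps_X 0) (-1)) 0 = 0"
proof -
  have "of_int (int_choose i (nat (i + 0 - (-1)))) * Z i * (fps_deriv ^^ nat (i + 0 - (-1))) fps_X
      = (if i = -1 then Z i * fps_X else 0)" if "-1 \<le> i" for i
  proof -
    \<comment> \<open>For i = 0 the binomial coefficient is zero, and for positive i at least two
      derivatives fall on x - y.\<close>
    consider "i = -1" | "i = 0" | "1 \<le> i" using \<open>-1 \<le> i\<close> by linarith
    then show ?thesis
    proof cases
      case 3
      then have "nat (i + 0 - (-1)) = Suc (Suc (nat (i - 1)))" by linarith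
      then have "(fps_deriv ^^ nat (i + 0 - (-1))) (fps_X :: 'a fps) = 0"
        by (simp add: funpow_swap1 del: funpow.simps(2) add: funpow_Suc_right)
      with 3 show ?thesis by auto
    qed (auto simp: int_choose_def)
  qed
  then have "(Z \<odot> pmono fps_X 0) (-1) = (\<Sum>i\<in>{-1..a}. if i = -1 then Z i * fps_X else 0)"
    by (subst fps.psdo_mult_pmono_right[OF assms]) (intro sum.cong, auto)
  then show ?thesis by simp
qed

lemma residue_mult_E:
  assumes "order_le a M" shows "fps_nth ((M \<odot> (pmono f 0 \<odot> E j (Suc k))) (-1)) 0 = 0"
proof -
  let ?C = "pmono (fps_const \<gamma>) (1 - int N) :: 'a fps psdo"
  have "E j (Suc k) = E j k \<odot> T" by (rule E_mult_T[symmetric])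
  also have "\<dots> = (E j k \<odot> ?C) \<odot> pmono fps_X 0"
    unfolding T_def by (rule assoc[symmetric, OF order_E]) auto
  finally have "M \<odot> (pmono f 0 \<odot> E j (Suc k)) = M \<odot> (pmono f 0 \<odot> ((E j k \<odot> ?C) \<odot> pmono fps_X 0))" by simp
  also have "pmono f 0 \<odot> ((E j k \<odot> ?C) \<odot> pmono fps_X 0) = (pmono f 0 \<odot> (E j k \<odot> ?C)) \<odot> pmono fps_X 0"
    by (rule assoc[symmetric, OF order_le_pmono[OF order_refl] fps.order_le_mult[OF order_E order_le_pmono[OF order_refl]]]) auto
  also have "M \<odot> ((pmono f 0 \<odot> (E j k \<odot> ?C)) \<odot> pmono fps_X 0) = (M \<odot> (pmono f 0 \<odot> (E j k \<odot> ?C))) \<odot> pmono fps_X 0"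
    by (rule assoc[symmetric, OF assms fps.order_le_mult[OF order_le_pmono[OF order_refl]
      fps.order_le_mult[OF order_E order_le_pmono[OF order_refl]]]]) auto
  finally have e: "M \<odot> (pmono f 0 \<odot> E j (Suc k)) = (M \<odot> (pmono f 0 \<odot> (E j k \<odot> ?C))) \<odot> pmono fps_X 0" .
  show ?thesis unfolding e
    by (rule residue_mult_X[OF fps.order_le_mult[OF assms fps.order_le_mult[OF order_le_pmono[OF order_refl]
      fps.order_le_mult[OF order_E order_le_pmono[OF order_refl]]]]])
qed

theorem formal_diagonal_value:
  assumes c: "starts_at 0 c" "\<And>j. j \<le> N - 2 \<Longrightarrow> c j 0 = (if j = 0 then 1 else 0)"
    and pde: "\<And>j k. j \<le> N - 2 \<Longrightarrow> fairy_dt N \<kappa> c j k = fps_const \<kappa> * fairy_L N \<kappa> u c j k"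
    and j: "j \<le> N - 2" and k: "1 \<le> k"
  shows "fps_nth (psdo_res (frac_power fps_deriv N (GD_op N u) (k * N - (j + 1)))) 0
    = fps_nth (c j (int k)) 0 * (\<kappa> ^ k * pochhammer (1 - of_nat (j + 1) / of_nat N) k)"
proof -
  let ?p = "k * N - (j + 1)"
  let ?M = "frac_power fps_deriv N (GD_op N u) ?p"
  have M: "order_le (int ?p) ?M"
    unfolding frac_power_def
    by (intro fps.order_le_power monic_orderD fps.psdo_root_monic[OF N_inverse GD_op_monic])
  have MR: "?M \<odot> \<Phi> c = \<Phi> c \<odot> pmono 1 (int ?p)"
    by (rule dressing_root[OF dressing[OF c(1) pde] order_\<Phi>])
  \<comment> \<open>Ensures that the natural subtraction in the exponent is exact.\<close>
  have "j + 1 \<le> N" using j N by linarith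
  also have "N \<le> k * N" using k by simp
  finally have "j + 1 \<le> k * N" .
  then have p: "int ?p = int k * int N - int j - 1" by (simp add: of_nat_diff)
  have left: "fps_nth ((?M \<odot> \<Phi> c) (-1)) 0 = fps_nth (?M (-1)) 0"
  proof -
    \<comment> \<open>Large enough that the products with later layers have order below -1, and
      positive so that layer 0, which is the identity, is included.\<close>
    define K where "K = nat (int ?p + int N)"
    have K: "int ?p + (int N - 2) - int K < -1" "0 < K" unfolding K_def using N by auto
    have o: "order_le (int ?p + (int N - 2) - int k) (?M \<odot> layer c k)" for k
      by (rule order_le_mono[OF fps.order_le_mult[OF M order_layer]]) simp
    have "fps_nth ((?M \<odot> \<Phi> c) (-1)) 0 = (\<Sum>k<K. fps_nth ((?M \<odot> layer c k) (-1)) 0)"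
      unfolding \<Phi>_def fps.psdo_mult_psum_right[OF M order_layer]
      by (subst psum_eq_order[OF o K(1)]) (rule fps_sum_nth)
    also have "\<dots> = (\<Sum>k<K. if k = 0 then fps_nth (?M (-1)) 0 else 0)"
    proof (intro sum.cong refl)
      fix k
      have M_layer: "?M \<odot> layer c k = (\<Sum>j\<le>N-2. ?M \<odot> (pmono (c j (int k)) 0 \<odot> E (int j) k))"
        unfolding layer_def
        by (rule fps.psdo_mult_sum_right[where b="int N - 2", OF M order_le_mono[OF order_pmono_E]]) (use N in auto)
      have layer_0: "layer c 0 = pmono 1 0"
      proof -
        have "layer c 0 = (\<Sum>j\<le>N-2. if j = 0 then pmono 1 0 else 0)"
          unfolding layer_def
            by (intro sum.cong refl) (use c(2) in \<open>auto simp: E_0 fps.psdo_mult_1_left[OF order_le_pmono[OF order_refl]]\<close>)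
        then show ?thesis by simp
      qed
      have zero: "(\<Sum>j\<le>N-2. fps_nth ((?M \<odot> (pmono (c j (int k)) 0 \<odot> E (int j) k)) (-1)) 0) = 0" if "k \<noteq> 0"
      proof (rule sum.neutral, rule ballI)
        fix j
        from \<open>k \<noteq> 0\<close> obtain k' where "k = Suc k'" by (cases k) auto
        then show "fps_nth ((?M \<odot> (pmono (c j (int k)) 0 \<odot> E (int j) k)) (-1)) 0 = 0"
          by (simp only: residue_mult_E[OF M])
      qed
      show "fps_nth ((?M \<odot> layer c k) (-1)) 0 = (if k = 0 then fps_nth (?M (-1)) 0 else 0)"
      proof (cases "k = 0")
        case True
        then show ?thesis by (simp only: layer_0 fps.psdo_mult_1_right[OF M] if_True refl)
      next
        case False
        then show ?thesis unfolding M_layer sum_fun_apply fps_sum_nth zero[OF False] by simp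
      qed
    qed
    finally show ?thesis using K(2) by simp
  qed
  have right: "fps_nth ((\<Phi> c \<odot> pmono 1 (int ?p)) (-1)) 0
    = fps_nth (c j (int k)) 0 * (\<kappa> ^ k * pochhammer (1 - of_nat (j + 1) / of_nat N) k)"
  proof -
    \<comment> \<open>Multiplying by the p-th power of \<partial> from the right moves indices by p,
      so the residue is the coefficient at -1 - p = j - k N.\<close>
    define n where "n = - 1 - int ?p"
    define K where "K = Suc k + nat (int N - 2 - n)"
    have K: "int N - 2 - int K < n" "k < K" unfolding K_def by auto
    have n: "n = int j - int k * int N" unfolding n_def p by simp
    have *: "fps_nth ((pmono f 0 \<odot> E (int j') k') n) 0 
      = (if j' = j \<and> k' = k then fps_nth f 0 * (\<kappa> ^ k * pochhammer (1 - of_nat (j + 1) / of_nat N) k) else 0)"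
      if "j' \<le> N - 2" for f j' k'
    proof -
      \<comment> \<open>Division with remainder by N: both j and j' are less than N, so exactly one
        pair of indices contributes to this coefficient.\<close>
      have jk: "j' = j \<and> k' = k" if "n = int j' - int k' * int N"
      proof -
        have e: "int j + int k' * int N = int j' + int k * int N" using that n by simp
        have "(j + k' * N) mod N = (j' + k * N) mod N" "(j + k' * N) div N = (j' + k * N) div N"
          using e by (metis of_nat_add of_nat_mult of_nat_eq_iff)+
        moreover have "j < N" "j' < N" using j \<open>j' \<le> N - 2\<close> N by auto
        ultimately show ?thesis by simp
      qed
      have "fps_nth ((pmono f 0 \<odot> E (int j') k') n) 0 = fps_nth f 0 * fps_nth (E (int j') k' n) 0"
        by (simp only: fps.psdo_mult_pmono_0_left[OF order_E] fps_mult_nth_0)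
      also have "fps_nth (E (int j') k' n) 0 = (if n = int j' - int k' * int N
        then \<kappa> ^ k' * pochhammer (1 - of_int (int j' + 1) / of_nat N) k' else 0)" by (rule E_at_0)
      finally have e: "fps_nth ((pmono f 0 \<odot> E (int j') k') n) 0 = fps_nth f 0 * (if n = int j' - int k' * int N
          then \<kappa> ^ k' * pochhammer (1 - of_int (int j' + 1) / of_nat N) k' else 0)" .
      show ?thesis
      proof (cases "j' = j \<and> k' = k")
        case False
        then have "n \<noteq> int j' - int k' * int N" using jk by blast
        with e False show ?thesis by (simp only: if_False mult_zero_right)
      next
        case True
        with e show ?thesis by (simp add: n[symmetric] add.commute)
      qed
    qed
    have "(\<Phi> c \<odot> pmono 1 (int ?p)) (-1) = \<Phi> c n"
      by (simp add: fps.psdo_mult_pmono_1[OF order_\<Phi>] n_def)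
    also have "\<Phi> c n = (\<Sum>k'<K. layer c k' n)"
      unfolding \<Phi>_def by (rule psum_eq_order[OF order_layer K(1)])
    also have "fps_nth \<dots> 0 = (\<Sum>k'<K. \<Sum>j'\<le>N-2. fps_nth ((pmono (c j' (int k')) 0 \<odot> E (int j') k') n) 0)"
      by (simp add: layer_def sum_fun_apply fps_sum_nth)
    also have "\<dots> = (\<Sum>k'<K. if k' = k then \<Sum>j'\<le>N-2. if j' = j then fps_nth (c j (int k)) 0
         * (\<kappa> ^ k * pochhammer (1 - of_nat (j + 1) / of_nat N) k) else 0 else 0)"
      by (intro sum.cong refl) (auto simp: * intro!: sum.cong sum.neutral)
    finally show ?thesis using K(2) j by simp
  qed
  show ?thesis unfolding psdo_res_def using left right MR by simp
qed

end

section \<open>Taylor expansion of smooth functions\<close>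

text \<open>Smoothness in one variable, phrased through iterates of \<open>Dfun\<close>, because
  these are the functions that occur as Taylor coefficients and as values of differential
  polynomials.\<close>

primrec smooth_upto :: "nat \<Rightarrow> real set \<Rightarrow> (real \<Rightarrow> 'a::real_normed_field) \<Rightarrow> bool" where
  "smooth_upto 0 U f \<longleftrightarrow> (\<forall>x\<in>U. f differentiable at x)"
| "smooth_upto (Suc n) U f \<longleftrightarrow> (\<forall>x\<in>U. f differentiable at x) \<and> smooth_upto n U (Dfun f)"

definition smooth :: "real set \<Rightarrow> (real \<Rightarrow> 'a::real_normed_field) \<Rightarrow> bool" where
  "smooth U f \<longleftrightarrow> (\<forall>n. smooth_upto n U f)"

lemma Dfun_eqI: "(f has_vector_derivative D) (at x) \<Longrightarrow> Dfun f x = D"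
  unfolding Dfun_def by (rule vector_derivative_at)

lemma Dfun_works: "f differentiable at x \<Longrightarrow> (f has_vector_derivative Dfun f x) (at x)"
  unfolding Dfun_def by (simp add: vector_derivative_works)

lemma Dfun_const [simp]: "Dfun (\<lambda>x. c) = (\<lambda>x. 0)"
  by (rule ext, rule Dfun_eqI) simp

lemma Dfun_add: "f differentiable at x \<Longrightarrow> g differentiable at x \<Longrightarrow> Dfun (f + g) x = Dfun f x + Dfun g x"
  using has_vector_derivative_add[OF Dfun_works Dfun_works, of f x g] by (auto intro: Dfun_eqI simp: plus_fun_def)

lemma Dfun_mult: "f differentiable at x \<Longrightarrow> g differentiable at x \<Longrightarrow> Dfun (f * g) x = f x * Dfun g x + Dfun f x * g x"
  using has_vector_derivative_mult[OF Dfun_works Dfun_works, of f x g] by (auto intro: Dfun_eqI simp: times_fun_def)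

lemma differentiable_add': "f differentiable at x \<Longrightarrow> g differentiable at x \<Longrightarrow> (f + g) differentiable at x"
  for f g :: "real \<Rightarrow> 'a::real_normed_field"
  by (simp add: plus_fun_def differentiable_add)

lemma differentiable_mult': "f differentiable at x \<Longrightarrow> g differentiable at x \<Longrightarrow> (f * g) differentiable at x"
  for f g :: "real \<Rightarrow> 'a::real_normed_field"
  by (simp add: times_fun_def differentiable_mult)

lemma Dfun_of_real_diff: "Dfun (\<lambda>x. of_real (x - y)) = (\<lambda>x. 1)"
  by (rule ext, rule Dfun_eqI) (auto intro!: derivative_eq_intros simp: has_vector_derivative_def scaleR_conv_of_real)

lemma pre_derivation_Dfun: "pre_derivation (Dfun :: (real \<Rightarrow> 'a::real_normed_field) \<Rightarrow> _)"
  by unfold_locales (simp_all add: zero_fun_def one_fun_def)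

lemma smooth_upto_differentiable: "smooth_upto n U f \<Longrightarrow> x \<in> U \<Longrightarrow> f differentiable at x"
  by (cases n) auto

lemma smooth_upto_Suc: "smooth_upto (Suc n) U f \<Longrightarrow> smooth_upto n U f"
  by (induction n arbitrary: f) auto

lemma smooth_differentiable: "smooth U f \<Longrightarrow> x \<in> U \<Longrightarrow> f differentiable at x"
  unfolding smooth_def by (drule spec[of _ 0]) simp

lemma smooth_Dfun: "smooth U f \<Longrightarrow> smooth U (Dfun f)"
  unfolding smooth_def by (metis smooth_upto.simps(2))

lemma smooth_subset: "smooth U f \<Longrightarrow> V \<subseteq> U \<Longrightarrow> smooth V f"
proof -
  have "smooth_upto n U f \<Longrightarrow> V \<subseteq> U \<Longrightarrow> smooth_upto n V f" for n
    by (induction n arbitrary: f) auto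
  then show "smooth U f \<Longrightarrow> V \<subseteq> U \<Longrightarrow> smooth V f" by (auto simp: smooth_def)
qed

context
  fixes U :: "real set"
  assumes U: "open U"
begin

lemma differentiable_cong_open:
  assumes "x \<in> U" "\<And>x. x \<in> U \<Longrightarrow> f x = g x" "f differentiable at x"
  shows "g differentiable at x" "Dfun g x = Dfun f x"
proof -
  have "(g has_vector_derivative Dfun f x) (at x)"
    by (rule has_vector_derivative_transform_within_open[OF Dfun_works[OF assms(3)] U assms(1)])
      (use assms(2) in auto)
  then show "g differentiable at x" "Dfun g x = Dfun f x"
    by (auto intro: differentiableI_vector Dfun_eqI)
qed

text \<open>The rules for \<open>Dfun\<close> of sums and products hold where the functions are
  differentiable, so smoothness has to be carried along equality on an open set.\<close>

lemma smooth_upto_cong: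
  "(\<And>x. x \<in> U \<Longrightarrow> f x = g x) \<Longrightarrow> smooth_upto n U f \<Longrightarrow> smooth_upto n U g"
proof (induction n arbitrary: f g)
  case 0
  then show ?case using differentiable_cong_open(1)[of _ f g] by auto
next
  case (Suc n)
  have d: "f differentiable at x" if "x \<in> U" for x using Suc.prems(2) that by simp
  have "smooth_upto n U (Dfun g)"
    by (rule Suc.IH[of "Dfun f"]) (use differentiable_cong_open(2)[of _ f g] d Suc.prems in auto)
  with d show ?case using differentiable_cong_open(1)[of _ f g] Suc.prems(1) by auto
qed

lemma smooth_cong: "(\<And>x. x \<in> U \<Longrightarrow> f x = g x) \<Longrightarrow> smooth U f \<Longrightarrow> smooth U g"
  unfolding smooth_def using smooth_upto_cong[of f g] by blast

lemma Dfun_funpow_cong: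
  "(\<And>x. x \<in> U \<Longrightarrow> f x = g x) \<Longrightarrow> smooth U f \<Longrightarrow> x \<in> U \<Longrightarrow> (Dfun ^^ n) g x = (Dfun ^^ n) f x"
proof (induction n arbitrary: f g x)
  case (Suc n)
  have d: "\<And>x. x \<in> U \<Longrightarrow> f differentiable at x" using smooth_differentiable[OF Suc.prems(2)] .
  have "(Dfun ^^ n) (Dfun g) x = (Dfun ^^ n) (Dfun f) x"
    by (rule Suc.IH) (use differentiable_cong_open(2)[of _ f g] d Suc.prems smooth_Dfun in auto)
  then show ?case by (simp add: funpow_swap1)
qed simp

lemma smooth_upto_add: "smooth_upto n U f \<Longrightarrow> smooth_upto n U g \<Longrightarrow> smooth_upto n U (f + g)"
proof (induction n arbitrary: f g)
  case (Suc n)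
  have "smooth_upto n U (Dfun f + Dfun g)" by (rule Suc.IH) (use Suc.prems in auto)
  then have "smooth_upto n U (Dfun (f + g))"
    by (rule smooth_upto_cong[rotated]) (use Suc.prems in \<open>simp add: Dfun_add\<close>)
  with Suc.prems show ?case
    unfolding smooth_upto.simps by (blast intro: differentiable_add')
qed (auto simp: plus_fun_def)

lemma smooth_upto_mult: "smooth_upto n U f \<Longrightarrow> smooth_upto n U g \<Longrightarrow> smooth_upto n U (f * g)"
proof (induction n arbitrary: f g)
  case (Suc n)
  have "smooth_upto n U (f * Dfun g + Dfun f * g)"
    by (intro smooth_upto_add Suc.IH) (use Suc.prems smooth_upto_Suc in auto)
  then have "smooth_upto n U (Dfun (f * g))"
    by (rule smooth_upto_cong[rotated]) (use Suc.prems in \<open>simp add: Dfun_mult\<close>)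
  with Suc.prems show ?case unfolding smooth_upto.simps by (blast intro: differentiable_mult')
qed (auto simp: differentiable_mult')

lemma smooth_add: "smooth U f \<Longrightarrow> smooth U g \<Longrightarrow> smooth U (f + g)"
  and smooth_mult: "smooth U f \<Longrightarrow> smooth U g \<Longrightarrow> smooth U (f * g)"
  unfolding smooth_def using smooth_upto_add smooth_upto_mult by blast+

lemma smooth_const: "smooth U (\<lambda>x. c)"
proof -
  have "smooth_upto n U (\<lambda>x. c)" for n by (induction n arbitrary: c) auto
  then show ?thesis by (simp add: smooth_def)
qed

lemma smooth_of_real_diff: "smooth U (\<lambda>x. of_real (x - y) :: 'a::real_normed_field)"
proof -
  have "(\<lambda>x. of_real (x - y) :: 'a) differentiable at x" for x
    by (rule differentiableI_vector[where y=1])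
      (auto intro!: derivative_eq_intros simp: has_vector_derivative_def scaleR_conv_of_real)
  moreover have "smooth_upto n U (\<lambda>x. 1 :: 'a)" for n using smooth_const[of 1] unfolding smooth_def by blast
  ultimately have "smooth_upto n U (\<lambda>x. of_real (x - y) :: 'a)" for n
    by (cases n) (simp_all add: Dfun_of_real_diff del: of_real_diff)
  then show ?thesis by (simp add: smooth_def)
qed

end

definition taylor :: "real \<Rightarrow> (real \<Rightarrow> 'a::real_normed_field) \<Rightarrow> 'a fps" where
  "taylor y f = Abs_fps (\<lambda>n. (Dfun ^^ n) f y / fact n)"

lemma taylor_0 [simp]: "fps_nth (taylor y f) 0 = f y"
  by (simp add: taylor_def)

lemma fps_deriv_taylor: "fps_deriv (taylor y f) = taylor y (Dfun f)"
  by (rule fps_ext) (simp add: taylor_def funpow_swap1 del: of_nat_Suc)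

text \<open>Reduces coefficient n + 1 to coefficient n of the derivative. Additivity and
  multiplicativity of \<open>taylor\<close> then follow by induction from the sum and product rules,
  with no binomial sums.\<close>

lemma fps_nth_eq_by_deriv:
  assumes "fps_nth (fps_deriv A) n = fps_nth (fps_deriv B) n"
  shows "fps_nth A (Suc n) = fps_nth (B :: 'a::field_char_0 fps) (Suc n)"
  using assms by (simp del: of_nat_Suc)

definition taylor_rel :: "real set \<Rightarrow> real \<Rightarrow> (real \<Rightarrow> 'a::real_normed_field) \<Rightarrow> 'a fps \<Rightarrow> bool" where
  "taylor_rel U y f F \<longleftrightarrow> smooth U f \<and> taylor y f = F"

definition expansion_rel ::
  "real set \<Rightarrow> real \<Rightarrow> nat \<Rightarrow> 'a::real_normed_field airy_expansion \<Rightarrow> (nat \<Rightarrow> int \<Rightarrow> 'a fps) \<Rightarrow> bool" where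
  "expansion_rel U y N c C \<longleftrightarrow> (\<forall>j\<le>N-2. \<forall>k. taylor_rel U y (c j k) (C j k))"

context
  fixes U :: "real set" and y :: real
  assumes U: "open U" and y: "y \<in> U"
begin

lemma taylor_cong: "(\<And>x. x \<in> U \<Longrightarrow> f x = g x) \<Longrightarrow> smooth U f \<Longrightarrow> taylor y g = taylor y f"
  unfolding taylor_def using Dfun_funpow_cong[OF U, of f g y] y by simp

lemma taylor_add:
  assumes "smooth U f" "smooth U g" shows "taylor y (f + g) = taylor y f + taylor y g"
proof (rule fps_ext)
  fix n show "fps_nth (taylor y (f + g)) n = fps_nth (taylor y f + taylor y g) n"
    using assms
  proof (induction n arbitrary: f g)
    case (Suc n)
    have "taylor y (Dfun (f + g)) = taylor y (Dfun f + Dfun g)"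
      by (rule taylor_cong)
        (use Suc.prems in \<open>auto simp: Dfun_add smooth_differentiable intro: smooth_add smooth_Dfun U\<close>)
    with Suc.IH[of "Dfun f" "Dfun g"] Suc.prems show ?case
      by (intro fps_nth_eq_by_deriv) (simp add: fps_deriv_taylor smooth_Dfun del: fps_deriv_nth plus_fun_apply)
  qed simp
qed

lemma taylor_mult:
  assumes "smooth U f" "smooth U g" shows "taylor y (f * g) = taylor y f * taylor y g"
proof (rule fps_ext)
  fix n show "fps_nth (taylor y (f * g)) n = fps_nth (taylor y f * taylor y g) n"
    using assms
  proof (induction n arbitrary: f g)
    case (Suc n)
    have s: "smooth U (f * Dfun g)" "smooth U (Dfun f * g)"
      using Suc.prems by (auto intro: smooth_mult smooth_Dfun U)
    have "taylor y (Dfun (f * g)) = taylor y (f * Dfun g + Dfun f * g)"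
      by (rule taylor_cong)
        (use Suc.prems s in \<open>auto simp: Dfun_mult smooth_differentiable intro: smooth_add U\<close>)
    with Suc.IH[of "Dfun f" g] Suc.IH[of f "Dfun g"] Suc.prems show ?case
      by (intro fps_nth_eq_by_deriv)
        (simp add: fps_deriv_taylor taylor_add[OF s] smooth_Dfun del: fps_deriv_nth times_fun_apply)
  qed simp
qed

lemma taylor_const: "taylor y (\<lambda>x. c) = fps_const c"
proof -
  have "(Dfun ^^ n) (\<lambda>x. c) = (\<lambda>x. if n = 0 then c else 0)" for n
    by (induction n) auto
  then show ?thesis by (intro fps_ext) (simp add: taylor_def)
qed

lemma taylor_of_real_diff: "taylor y (\<lambda>x. of_real (x - y)) = (fps_X :: 'a::real_normed_field fps)"
proof (rule fps_ext)
  fix n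
  show "fps_nth (taylor y (\<lambda>x. of_real (x - y))) n = fps_nth (fps_X :: 'a fps) n"
  proof (cases n)
    case (Suc m)
    show ?thesis unfolding Suc
      by (rule fps_nth_eq_by_deriv)
        (simp add: fps_deriv_taylor Dfun_of_real_diff taylor_const del: of_real_diff fps_deriv_nth)
  qed simp
qed

lemma taylor_rel_const: "taylor_rel U y (\<lambda>x. c) (fps_const c)"
  by (simp add: taylor_rel_def taylor_const smooth_const[OF U])

lemma taylor_rel_add: "taylor_rel U y f F \<Longrightarrow> taylor_rel U y g G \<Longrightarrow> taylor_rel U y (f + g) (F + G)"
  by (auto simp: taylor_rel_def taylor_add smooth_add[OF U])

lemma taylor_rel_mult: "taylor_rel U y f F \<Longrightarrow> taylor_rel U y g G \<Longrightarrow> taylor_rel U y (f * g) (F * G)"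
  by (auto simp: taylor_rel_def taylor_mult smooth_mult[OF U])

lemma taylor_rel_Dfun: "taylor_rel U y f F \<Longrightarrow> taylor_rel U y (Dfun f) (fps_deriv F)"
  by (auto simp: taylor_rel_def fps_deriv_taylor smooth_Dfun)

lemma taylor_rel_cong: "taylor_rel U y f F \<Longrightarrow> (\<And>x. x \<in> U \<Longrightarrow> g x = f x) \<Longrightarrow> taylor_rel U y g F"
  using taylor_cong[of f g] smooth_cong[OF U, of f g] by (auto simp: taylor_rel_def)

lemma taylor_rel_of_real_diff: "taylor_rel U y (\<lambda>x. of_real (x - y)) fps_X"
  by (simp only: taylor_rel_def taylor_of_real_diff smooth_of_real_diff[OF U] simp_thms)

lemma taylor_relation: "coefficient_relation (Dfun :: (real \<Rightarrow> 'a::real_normed_field) \<Rightarrow> _) fps_deriv (taylor_rel U y)"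
proof (rule coefficient_relation.intro[OF pre_derivation_Dfun fps.pre_derivation_axioms], unfold_locales)
  show z: "taylor_rel U y (0 :: real \<Rightarrow> 'a) 0" using taylor_rel_const[of 0] by (simp add: zero_fun_def)
  show "taylor_rel U y (1 :: real \<Rightarrow> 'a) 1" using taylor_rel_const[of 1] by (simp add: one_fun_def)
  fix f :: "real \<Rightarrow> 'a" and F assume f: "taylor_rel U y f F"
  show "taylor_rel U y (- f) (- F)"
    using taylor_rel_mult[OF taylor_rel_const[of "-1"] f]
    by (simp add: times_fun_def fun_Compl_def flip: fps_const_neg)
qed (auto intro: taylor_rel_add taylor_rel_mult taylor_rel_Dfun)

end

section \<open>The heat equation for Taylor series\<close>

text \<open>The derivative of a slice is the slice of the Frechet derivative in direction (1, 0),
  which is again smooth on W; hence the induction over all F.\<close>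

lemma smooth_on_imp_smooth_slice:
  fixes F :: "real \<times> real \<Rightarrow> 'a::real_normed_field"
  assumes W: "open W" and F: "smooth_on W F"
  shows "smooth {x. (x, y) \<in> W} (\<lambda>x. F (x, y))"
proof -
  let ?U = "{x. (x, y) \<in> W}"
  have U: "open ?U"
  proof -
    have "?U = (\<lambda>x. (x, y)) -` W" by auto
    then show ?thesis using open_vimage[OF W, of "\<lambda>x. (x, y)"] by (simp add: continuous_intros)
  qed
  have slice: "(\<lambda>x. F (x, y)) differentiable at x" "Dfun (\<lambda>x. F (x, y)) x = frechet_derivative F (at (x, y)) (1, 0)"
    if "smooth_on W F" "(x, y) \<in> W" for F :: "real \<times> real \<Rightarrow> 'a" and x
  proof -
    have "Ck_on 1 W F" using that(1) by (simp only: smooth_on_def)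
    then have "F differentiable at (x, y)" using that(2) by simp
    then have F: "(F has_derivative frechet_derivative F (at (x, y))) (at (x, y))"
      by (simp add: frechet_derivative_works)
    have "((\<lambda>x. (x, y)) has_derivative (\<lambda>h. (h, 0))) (at x)"
      by (auto intro!: derivative_eq_intros)
    from has_derivative_compose[OF this F]
    have "((\<lambda>x. F (x, y)) has_derivative (\<lambda>h. frechet_derivative F (at (x, y)) (h, 0))) (at x)" .
    moreover have "(\<lambda>h. frechet_derivative F (at (x, y)) (h, 0)) = (\<lambda>h. h *\<^sub>R frechet_derivative F (at (x, y)) (1, 0))"
    proof
      fix h
      show "frechet_derivative F (at (x, y)) (h, 0) = h *\<^sub>R frechet_derivative F (at (x, y)) (1, 0)"
        using linear_scale[OF has_derivative_linear[OF F], of h "(1, 0)"]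
        by (simp only: scaleR_Pair real_scaleR_def mult_1_right mult_zero_right)
    qed
    ultimately have "((\<lambda>x. F (x, y)) has_vector_derivative frechet_derivative F (at (x, y)) (1, 0)) (at x)"
      unfolding has_vector_derivative_def by (rule has_derivative_eq_rhs)
    then show "(\<lambda>x. F (x, y)) differentiable at x" "Dfun (\<lambda>x. F (x, y)) x = frechet_derivative F (at (x, y)) (1, 0)"
      by (auto intro: differentiableI_vector Dfun_eqI)
  qed
  have "smooth_upto n ?U (\<lambda>x. F (x, y))" for n
    using F
  proof (induction n arbitrary: F)
    case 0
    show ?case using slice(1)[OF 0] by auto
  next
    case (Suc n)
    let ?F' = "\<lambda>z. frechet_derivative F (at z) (1, 0)"
    have "smooth_on W ?F'"
      unfolding smooth_on_def
    proof
      fix m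
      have "Ck_on (Suc m) W F" using Suc.prems by (simp add: smooth_on_def)
      then show "Ck_on m W ?F'" by simp
    qed
    then have "smooth_upto n ?U (\<lambda>x. ?F' (x, y))" by (rule Suc.IH)
    then have "smooth_upto n ?U (Dfun (\<lambda>x. F (x, y)))"
      by (rule smooth_upto_cong[OF U, rotated]) (use slice(2)[OF Suc.prems] in auto)
    with slice(1)[OF Suc.prems] show ?case by auto
  qed
  then show ?thesis by (simp add: smooth_def)
qed

lemma smooth_on_imp_smooth:
  fixes f :: "real \<Rightarrow> 'a::real_normed_field"
  assumes U: "open U" and f: "smooth_on U f" shows "smooth U f"
proof -
  have "smooth_upto n U f" for n
    using f
  proof (induction n arbitrary: f)
    case 0
    then have "Ck_on 1 U f" by (simp only: smooth_on_def)
    then show ?case by simp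
  next
    case (Suc n)
    have d: "f differentiable at x" if "x \<in> U" for x
    proof -
      have "Ck_on 1 U f" using Suc.prems by (simp only: smooth_on_def)
      then show ?thesis using that by simp
    qed
    let ?f' = "\<lambda>z. frechet_derivative f (at z) 1"
    have "smooth_on U ?f'"
      unfolding smooth_on_def
    proof
      fix m
      have "Ck_on (Suc m) U f" using Suc.prems by (simp add: smooth_on_def)
      then show "Ck_on m U ?f'" by simp
    qed
    then have "smooth_upto n U ?f'" by (rule Suc.IH)
    moreover have "Dfun f x = ?f' x" if "x \<in> U" for x
    proof (rule Dfun_eqI)
      have F: "(f has_derivative frechet_derivative f (at x)) (at x)"
        using d[OF that] by (simp add: frechet_derivative_works)
      have "frechet_derivative f (at x) = (\<lambda>h. h *\<^sub>R frechet_derivative f (at x) 1)"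
      proof
        fix h
        show "frechet_derivative f (at x) h = h *\<^sub>R frechet_derivative f (at x) 1"
          using linear_scale[OF has_derivative_linear[OF F], of h 1]
          by (simp only: real_scaleR_def mult_1_right)
      qed
      with F show "(f has_vector_derivative ?f' x) (at x)"
        unfolding has_vector_derivative_def by (rule has_derivative_eq_rhs)
    qed
    ultimately have "smooth_upto n U (Dfun f)" by (auto intro: smooth_upto_cong[OF U, of ?f'])
    with d show ?case by simp
  qed
  then show ?thesis by (simp add: smooth_def)
qed

context
  fixes U :: "real set" and y :: real and N :: nat and \<kappa> :: "'a::real_normed_field"
  assumes U: "open U" and y: "y \<in> U"
begin

lemma taylor_rel_scale:
  "taylor_rel U y f F \<Longrightarrow> taylor_rel U y (\<lambda>x. a * of_real (x - y) * f x) (fps_const a * fps_X * F)"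
  using taylor_rel_mult[OF U y taylor_rel_mult[OF U y taylor_rel_const[OF U y, of a]
    taylor_rel_of_real_diff[OF U y]], of f F]
  by (simp only: times_fun_def)

lemma rel_airy_shift:
  assumes "expansion_rel U y N c C" "j \<le> N - 2"
  shows "taylor_rel U y (airy_shift N \<kappa> y c j k) (fairy_shift N \<kappa> C j k)"
proof (cases "j = 0")
  case True
  have e: "airy_shift N \<kappa> y c j k = (\<lambda>x. - (\<kappa> / of_nat N) * of_real (x - y) * c (N - 2) (k + 1) x)"
    by (rule ext) (simp only: airy_shift_def True if_True refl)
  have f: "fairy_shift N \<kappa> C j k = fps_const (- (\<kappa> / of_nat N)) * fps_X * C (N - 2) (k + 1)"
    by (simp only: fairy_shift_def True if_True refl)
  show ?thesis unfolding e f
    by (rule taylor_rel_scale) (use assms in \<open>simp add: expansion_rel_def\<close>)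
next
  case False
  then have "airy_shift N \<kappa> y c j k = c (j - 1) k" by (intro ext) (simp add: airy_shift_def)
  with False assms show ?thesis by (simp add: fairy_shift_def expansion_rel_def)
qed

lemma rel_airy_dx:
  assumes "expansion_rel U y N c C" shows "expansion_rel U y N (airy_dx N \<kappa> y c) (fairy_dx N \<kappa> C)"
  unfolding expansion_rel_def
proof (intro allI impI)
  fix j k assume j: "j \<le> N - 2"
  have "airy_dx N \<kappa> y c j k = Dfun (c j k) + airy_shift N \<kappa> y c j k"
    by (rule ext) (simp add: airy_dx_def)
  then show "taylor_rel U y (airy_dx N \<kappa> y c j k) (fairy_dx N \<kappa> C j k)"
    unfolding fairy_dx_def
    using assms j by (auto simp: expansion_rel_def simp del: plus_fun_apply
      intro!: taylor_rel_add[OF U y] taylor_rel_Dfun[OF U y] rel_airy_shift[OF assms j])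
qed

lemma rel_airy_dt:
  assumes "expansion_rel U y N c C" "j \<le> N - 2"
  shows "taylor_rel U y (airy_dt N \<kappa> y c j k) (fairy_dt N \<kappa> C j k)"
proof -
  let ?a = "of_int (k + 1) - of_nat (j + 1) / of_nat N :: 'a"
  let ?s = "airy_shift N \<kappa> y c j (k + 1)"
  have "airy_dt N \<kappa> y c j k = (\<lambda>x. ?a) * c j (k + 1) + (\<lambda>x. - (1 / of_nat N) * of_real (x - y) * ?s x)"
    by (rule ext) (simp add: airy_dt_def)
  moreover have "taylor_rel U y \<dots> (fairy_dt N \<kappa> C j k)"
    unfolding fairy_dt_def
    by (intro taylor_rel_add[OF U y] taylor_rel_mult[OF U y] taylor_rel_const[OF U y] taylor_rel_scale
        rel_airy_shift assms) (use assms in \<open>auto simp: expansion_rel_def\<close>)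
  ultimately show ?thesis by (simp only:)
qed

lemma rel_GD_op:
  fixes u :: "nat \<Rightarrow> real \<Rightarrow> 'a"
  assumes "\<And>i. i \<le> N - 2 \<Longrightarrow> smooth U (u i)"
  shows "taylor_rel U y (GD_op N u n) (GD_op N (\<lambda>i. taylor y (u i)) n)"
  using assms taylor_rel_const[OF U y, of 1] taylor_rel_const[OF U y, of "0::'a"]
  by (auto simp: GD_op_def taylor_rel_def one_fun_def zero_fun_def)

lemma rel_airy_L:
  assumes "\<And>i. i \<le> N - 2 \<Longrightarrow> smooth U (u i)" "expansion_rel U y N c C" "j \<le> N - 2"
  shows "taylor_rel U y (airy_L N \<kappa> u y c j k) (fairy_L N \<kappa> (\<lambda>i. taylor y (u i)) C j k)"
proof -
  interpret coefficient_relation "Dfun :: (real \<Rightarrow> 'a) \<Rightarrow> _" fps_deriv "taylor_rel U y" by (rule taylor_relation[OF U y])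
  have "expansion_rel U y N ((airy_dx N \<kappa> y ^^ i) c) ((fairy_dx N \<kappa> ^^ i) C)" for i
    by (induction i) (auto intro: rel_airy_dx assms(2))
  then have "taylor_rel U y ((airy_dx N \<kappa> y ^^ i) c j k) ((fairy_dx N \<kappa> ^^ i) C j k)" for i
    using assms(3) by (simp add: expansion_rel_def)
  then have "taylor_rel U y (\<Sum>i\<le>N. GD_op N u (int i) * (airy_dx N \<kappa> y ^^ i) c j k)
     (fairy_L N \<kappa> (\<lambda>i. taylor y (u i)) C j k)"
    unfolding fairy_L_def by (intro rel_sum rel_mult rel_GD_op assms(1))
  moreover have "airy_L N \<kappa> u y c j k = (\<Sum>i\<le>N. GD_op N u (int i) * (airy_dx N \<kappa> y ^^ i) c j k)"
    by (rule ext) (simp add: airy_L_def sum_fun_apply)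
  ultimately show ?thesis by (simp only:)
qed

end

lemma Hadamard_diagonal:
  fixes \<kappa> :: "'a::real_normed_field"
  assumes N: "N \<ge> 2" and \<kappa>: "\<kappa> * \<kappa> = 1" and I: "open I"
    and u: "\<And>i. i \<le> N - 2 \<Longrightarrow> smooth_on I (u i)" and H: "Hadamard_coefficients N \<kappa> I u H"
    and j: "j \<le> N - 2" and k: "1 \<le> k" and y: "y \<in> I"
  shows "H k j y y = \<kappa> ^ k / pochhammer (1 - of_nat (j + 1) / of_nat N) k
             * psdo_res (frac_power Dfun N (GD_op N u) (k * N - (j + 1))) y"
proof -
  from H obtain W where W0: "open W" "W \<subseteq> I \<times> I" "\<forall>x\<in>I. (x, x) \<in> W"
    and sm0: "\<forall>k\<ge>1. \<forall>j\<le>N - 2. smooth_on W (\<lambda>(x, y). H k j x y)"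
    and pde0: "\<forall>(x, y)\<in>W. \<forall>j\<le>N - 2. \<forall>k. airy_dt N \<kappa> y (heat_kernel H y) j k x
           = \<kappa> * airy_L N \<kappa> u y (heat_kernel H y) j k x"
    unfolding Hadamard_coefficients_def by (elim exE conjE)
  have W: "open W" "W \<subseteq> I \<times> I" "\<And>x. x \<in> I \<Longrightarrow> (x, x) \<in> W" using W0 by simp_all
  have sm: "smooth_on W (\<lambda>(x, y). H k j x y)" if "1 \<le> k" "j \<le> N - 2" for k j
    using sm0 that by simp
  have pde: "airy_dt N \<kappa> y (heat_kernel H y) j k x = \<kappa> * airy_L N \<kappa> u y (heat_kernel H y) j k x"
    if "(x, y) \<in> W" "j \<le> N - 2" for x y j k
    using bspec[OF pde0 that(1)] that(2) by simp
  \<comment> \<open>The slice at the fixed y: an open neighbourhood of y on which the Hadamard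
    coefficients are smooth in x and the heat equation holds, so both sides have equal Taylor series
    at y.\<close>
  define U where "U = {x. (x, y) \<in> W}"
  have yU: "y \<in> U" using W(3) y by (simp add: U_def)
  have U: "open U"
  proof -
    have "U = (\<lambda>x. (x, y)) -` W" by (auto simp: U_def)
    then show ?thesis using open_vimage[OF W(1), of "\<lambda>x. (x, y)"] by (simp add: continuous_intros)
  qed
  have UI: "U \<subseteq> I" using W(2) by (auto simp: U_def)
  have uU: "smooth U (u i)" if "i \<le> N - 2" for i
    using smooth_subset[OF smooth_on_imp_smooth[OF I u[OF that]] UI] .
  let ?h = "heat_kernel H y" and ?u = "\<lambda>i. taylor y (u i)"
  define C where "C j k = taylor y (?h j k)" for j k
  have "smooth U (?h j k)" if "j \<le> N - 2" for j k
  proof (cases "k \<ge> 1")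
    case True
    then have "?h j k = (\<lambda>x. (\<lambda>(x, y). H (nat k) j x y) (x, y))" by (intro ext) (simp add: heat_kernel_def)
    moreover have "smooth U (\<lambda>x. (\<lambda>(x, y). H (nat k) j x y) (x, y))"
      unfolding U_def by (rule smooth_on_imp_smooth_slice[OF W(1) sm]) (use True that in auto)
    ultimately show ?thesis by (simp only:)
  next
    case False
    then have "?h j k = (\<lambda>x. if k = 0 \<and> j = 0 then 1 else 0)" by (intro ext) (simp add: heat_kernel_def)
    then show ?thesis by (simp only: smooth_const[OF U])
  qed
  then have rel: "expansion_rel U y N ?h C"
    by (simp add: expansion_rel_def taylor_rel_def C_def)
  interpret airy N \<kappa> by unfold_locales (use N \<kappa> in auto)
  have const: "C j k = (if k = 0 \<and> j = 0 then 1 else 0)" if "k \<le> 0" for j k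
  proof -
    have "?h j k = (\<lambda>x. if k = 0 \<and> j = 0 then 1 else 0)"
      using that by (intro ext) (simp add: heat_kernel_def)
    then show ?thesis unfolding C_def by (simp only: taylor_const[OF U yU]) auto
  qed
  have fpde: "fairy_dt N \<kappa> C j k = fps_const \<kappa> * fairy_L N \<kappa> ?u C j k" if "j \<le> N - 2" for j k
  proof -
    have 1: "taylor_rel U y (airy_dt N \<kappa> y ?h j k) (fairy_dt N \<kappa> C j k)"
      by (rule rel_airy_dt[OF U yU rel that])
    have "taylor_rel U y ((\<lambda>x. \<kappa>) * airy_L N \<kappa> u y ?h j k) (fps_const \<kappa> * fairy_L N \<kappa> ?u C j k)"
      by (intro taylor_rel_mult[OF U yU] taylor_rel_const[OF U yU] rel_airy_L[OF U yU uU rel that])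
    then have "taylor_rel U y (airy_dt N \<kappa> y ?h j k) (fps_const \<kappa> * fairy_L N \<kappa> ?u C j k)"
      by (rule taylor_rel_cong[OF U yU]) (use pde that in \<open>simp add: U_def\<close>)
    with 1 show ?thesis by (simp add: taylor_rel_def)
  qed
  let ?p = "pochhammer (1 - of_nat (j + 1) / of_nat N) k :: 'a" and ?m = "k * N - (j + 1)"
  interpret coefficient_relation "Dfun :: (real \<Rightarrow> 'a) \<Rightarrow> _" fps_deriv "taylor_rel U y" by (rule taylor_relation[OF U yU])
  \<comment> \<open>The fractional power is formed in the ring of all functions, but on U its
    coefficients are smooth and their Taylor series are those of the fractional power of the Taylor
    expanded operator.\<close>
  have "taylor_rel U y (frac_power Dfun N (GD_op N u) ?m (-1)) (frac_power fps_deriv N (GD_op N ?u) ?m (-1))"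
  proof (rule rel_frac_power[OF _ N_inverse _ GD_op_monic GD_op_monic])
    show "(\<lambda>x. 1 / of_nat N) * of_nat N = (1 :: real \<Rightarrow> 'a)"
      using N by (intro ext) (simp add: of_nat_fun_apply)
    show "taylor_rel U y (\<lambda>x. 1 / of_nat N) (fps_const (1 / of_nat N))" by (rule taylor_rel_const[OF U yU])
    show "taylor_rel U y (GD_op N u i) (GD_op N ?u i)" for i by (rule rel_GD_op[OF U yU uU])
  qed
  then have "psdo_res (frac_power Dfun N (GD_op N u) ?m) y
     = fps_nth (psdo_res (frac_power fps_deriv N (GD_op N ?u) ?m)) 0"
    by (auto simp: psdo_res_def taylor_rel_def taylor_0[symmetric] simp del: taylor_0)
  also have "\<dots> = fps_nth (C j (int k)) 0 * (\<kappa> ^ k * ?p)"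
    by (rule formal_diagonal_value[OF _ _ fpde j k]) (auto simp: starts_at_def const)
  also have "fps_nth (C j (int k)) 0 = H k j y y"
    using k by (simp add: C_def heat_kernel_def)
  finally have e: "psdo_res (frac_power Dfun N (GD_op N u) ?m) y = H k j y y * (\<kappa> ^ k * ?p)" .
  \<comment> \<open>A vanishing factor would give N (1 + i) = j + 1, which is impossible because j +
    1 < N.\<close>
  have "?p \<noteq> 0"
  proof
    assume "?p = 0"
    then obtain i where "1 - of_nat (j + 1) / of_nat N = - (of_nat i :: 'a)" by (auto simp: pochhammer_eq_0_iff)
    then have "of_nat (N * (1 + i)) = (of_nat (j + 1) :: 'a)" using N by (simp add: field_simps)
    then have "N * (1 + i) = j + 1" unfolding of_nat_eq_iff .
    moreover have "N \<le> N * (1 + i)" by simp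
    ultimately show False using j N by linarith
  qed
  \<comment> \<open>Dividing by the k-th power of \<kappa> is the same as multiplying by it, as the
    formula has it.\<close>
  moreover have "\<kappa> ^ k * \<kappa> ^ k = 1" unfolding power_mult_distrib[symmetric] \<kappa> by simp
  ultimately show ?thesis unfolding e by (simp add: field_simps)
qed

section \<open>Differential polynomials\<close>

lemma poly_mapping_eq_sum_single: "f = (\<Sum>m\<in>Poly_Mapping.keys f. Poly_Mapping.single m (Poly_Mapping.lookup f m))"
proof (rule poly_mapping_eqI)
  fix k
  have "Poly_Mapping.lookup (\<Sum>m\<in>Poly_Mapping.keys f. Poly_Mapping.single m (Poly_Mapping.lookup f m)) k
    = (\<Sum>m\<in>Poly_Mapping.keys f. if m = k then Poly_Mapping.lookup f m else 0)"
    unfolding lookup_sum by (intro sum.cong) (auto simp: lookup_single when_def)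
  also have "\<dots> = Poly_Mapping.lookup f k" by (auto simp: in_keys_iff)
  finally show "Poly_Mapping.lookup f k
    = Poly_Mapping.lookup (\<Sum>m\<in>Poly_Mapping.keys f. Poly_Mapping.single m (Poly_Mapping.lookup f m)) k" by simp
qed

lemma poly_mapping_single_induct [case_names zero single add]:
  fixes f :: "'a \<Rightarrow>\<^sub>0 'b::comm_monoid_add"
  assumes "P 0" "\<And>m c. m \<in> Poly_Mapping.keys f \<Longrightarrow> P (Poly_Mapping.single m c)"
    "\<And>g h. P g \<Longrightarrow> P h \<Longrightarrow> P (g + h)"
  shows "P f"
proof -
  have "finite K \<Longrightarrow> K \<subseteq> Poly_Mapping.keys f
    \<Longrightarrow> P (\<Sum>m\<in>K. Poly_Mapping.single m (Poly_Mapping.lookup f m))" for K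
    by (induction K rule: finite_induct) (use assms in auto)
  then show ?thesis by (subst poly_mapping_eq_sum_single) simp
qed

lemma monomial_induct:
  fixes P :: "'a::comm_ring_1 dpoly \<Rightarrow> bool"
  assumes one: "P 1" and var: "\<And>i l. (i, l) \<in> Poly_Mapping.keys m \<Longrightarrow> P (dvar i l)"
    and mult: "\<And>f g. P f \<Longrightarrow> P g \<Longrightarrow> P (f * g)"
  shows "P (Poly_Mapping.single m 1)"
proof -
  have power: "P (Poly_Mapping.single (Poly_Mapping.single v n) 1)" if "v \<in> Poly_Mapping.keys m" for v n
  proof (induction n)
    case (Suc n)
    have "Poly_Mapping.single (Poly_Mapping.single v (Suc n)) (1::'a)
      = dvar (fst v) (snd v) * Poly_Mapping.single (Poly_Mapping.single v n) 1"
      unfolding dvar_def mult_single by (simp add: single_add[symmetric])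
    then show ?case using mult[OF var Suc.IH, of "fst v" "snd v"] that by simp
  qed (simp add: one)
  have "P (Poly_Mapping.single (\<Sum>v\<in>K. Poly_Mapping.single v (Poly_Mapping.lookup m v)) 1)"
    if "finite K" "K \<subseteq> Poly_Mapping.keys m" for K
    using that
  proof (induction K rule: finite_induct)
    case (insert v K)
    have "Poly_Mapping.single (\<Sum>v\<in>insert v K. Poly_Mapping.single v (Poly_Mapping.lookup m v)) (1::'a)
      = Poly_Mapping.single (Poly_Mapping.single v (Poly_Mapping.lookup m v)) 1
        * Poly_Mapping.single (\<Sum>v\<in>K. Poly_Mapping.single v (Poly_Mapping.lookup m v)) 1"
      unfolding mult_single using insert.hyps by simp
    then show ?case using mult[OF power insert.IH] insert.prems by simp
  qed (simp add: one)
  from this[OF finite_keys order_refl] show ?thesis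
    by (simp only: poly_mapping_eq_sum_single[symmetric])
qed

text \<open>\<open>V\<close> records what is known about the variables occurring in f, so the same
  rule serves for all polynomials and for those in \<open>diff_polys N\<close>.\<close>

lemma dpoly_induct [case_names vars const var add mult]:
  fixes P :: "'a::comm_ring_1 dpoly \<Rightarrow> bool"
  assumes V: "\<And>m v. m \<in> Poly_Mapping.keys f \<Longrightarrow> v \<in> Poly_Mapping.keys m \<Longrightarrow> V v"
    and const: "\<And>c. P (Poly_Mapping.single 0 c)" and var: "\<And>i l. V (i, l) \<Longrightarrow> P (dvar i l)"
    and add: "\<And>f g. P f \<Longrightarrow> P g \<Longrightarrow> P (f + g)" and mult: "\<And>f g. P f \<Longrightarrow> P g \<Longrightarrow> P (f * g)"
  shows "P f"
proof (induction rule: poly_mapping_single_induct)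
  case zero
  show ?case using const[of 0] by simp
next
  case (single m c)
  have "P (Poly_Mapping.single m 1)"
    by (rule monomial_induct) (use const[of 1] var V single mult in auto)
  from mult[OF const this] show ?case unfolding mult_single by simp
qed (rule add)

section \<open>Derivations of the ring of differential polynomials\<close>

definition monomial_derivation ::
  "(nat \<times> nat \<Rightarrow> 'a dpoly) \<Rightarrow> ((nat \<times> nat) \<Rightarrow>\<^sub>0 nat) \<Rightarrow> 'a::comm_ring_1 \<Rightarrow> 'a dpoly" where
  "monomial_derivation X m c = (\<Sum>v\<in>Poly_Mapping.keys m.
     Poly_Mapping.single (m - Poly_Mapping.single v 1) (c * of_nat (Poly_Mapping.lookup m v)) * X v)"

text \<open>Variables with exponent 0 contribute 0. The product rule needs one index set for two
  monomials and their product.\<close>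

lemma monomial_derivation_superset:
  assumes "finite V" "Poly_Mapping.keys m \<subseteq> V"
  shows "monomial_derivation X m c = (\<Sum>v\<in>V.
     Poly_Mapping.single (m - Poly_Mapping.single v 1) (c * of_nat (Poly_Mapping.lookup m v)) * X v)"
  unfolding monomial_derivation_def
  by (rule sum.mono_neutral_left) (use assms in \<open>auto simp: in_keys_iff\<close>)

lemma dpoly_derivation_single:
  "dpoly_derivation X (Poly_Mapping.single m c) = monomial_derivation X m c"
  by (auto simp: dpoly_derivation_def monomial_derivation_def)

lemma dpoly_derivation_add: "dpoly_derivation X (f + g) = dpoly_derivation X f + dpoly_derivation X g"
  unfolding dpoly_derivation_def monomial_derivation_def[symmetric]
  by (rule setsum_keys_plus_distrib)
    (simp_all add: monomial_derivation_def distrib_right single_add sum.distrib)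

lemma monomial_derivation_mult:
  "monomial_derivation X (m + m') (a * b)
    = Poly_Mapping.single m a * monomial_derivation X m' b + monomial_derivation X m a * Poly_Mapping.single m' b"
proof -
  let ?V = "Poly_Mapping.keys m \<union> Poly_Mapping.keys m'"
  have V: "finite ?V" "Poly_Mapping.keys (m + m') \<subseteq> ?V" "Poly_Mapping.keys m \<subseteq> ?V" "Poly_Mapping.keys m' \<subseteq> ?V"
    using keys_add[of m m'] by auto
  \<comment> \<open>Subtraction of exponents is truncated, but truncation would occur only when v
    has exponent 0 in n, and then the coefficient is 0 as well.\<close>
  have shift: "Poly_Mapping.single (n + n' - Poly_Mapping.single v 1) (c * of_nat (Poly_Mapping.lookup n v))
    = Poly_Mapping.single (n - Poly_Mapping.single v 1 + n') (c * of_nat (Poly_Mapping.lookup n v))"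
    for n n' :: "(nat \<times> nat) \<Rightarrow>\<^sub>0 nat" and v and c :: 'a
  proof (cases "Poly_Mapping.lookup n v = 0")
    case False
    then have "n + n' - Poly_Mapping.single v 1 = n - Poly_Mapping.single v 1 + n'"
      by (intro poly_mapping_eqI) (auto simp: lookup_add lookup_minus lookup_single when_def)
    then show ?thesis by simp
  qed simp
  have "Poly_Mapping.single (m + m' - Poly_Mapping.single v 1) (a * b * of_nat (Poly_Mapping.lookup (m + m') v))
    = Poly_Mapping.single m a * Poly_Mapping.single (m' - Poly_Mapping.single v 1) (b * of_nat (Poly_Mapping.lookup m' v))
    + Poly_Mapping.single (m - Poly_Mapping.single v 1) (a * of_nat (Poly_Mapping.lookup m v)) * Poly_Mapping.single m' b" for v
  proof -
    have "Poly_Mapping.single (m + m' - Poly_Mapping.single v 1) (a * b * of_nat (Poly_Mapping.lookup (m + m') v))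
      = Poly_Mapping.single (m' + m - Poly_Mapping.single v 1) (a * b * of_nat (Poly_Mapping.lookup m' v))
        + Poly_Mapping.single (m + m' - Poly_Mapping.single v 1) (a * b * of_nat (Poly_Mapping.lookup m v))"
      by (simp add: lookup_add algebra_simps single_add)
    then show ?thesis unfolding shift mult_single by (simp add: mult_ac add_ac)
  qed
  note e = this
  show ?thesis
    unfolding monomial_derivation_superset[OF V(1,2)] monomial_derivation_superset[OF V(1,3)]
      monomial_derivation_superset[OF V(1,4)] e distrib_right sum.distrib sum_distrib_left sum_distrib_right
    by (simp only: mult_ac)
qed

lemma dpoly_derivation_mult: "dpoly_derivation X (f * g) = f * dpoly_derivation X g + dpoly_derivation X f * g"
proof (induction f rule: poly_mapping_single_induct)
  case zero
  show ?case by (simp add: dpoly_derivation_def)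
next
  case (single m a)
  show ?case
  proof (induction g rule: poly_mapping_single_induct)
    case zero
    show ?case by (simp add: dpoly_derivation_def)
  next
    case (single m' b)
    show ?case by (simp only: mult_single dpoly_derivation_single monomial_derivation_mult)
  next
    case (add g h)
    then show ?case by (simp add: dpoly_derivation_add algebra_simps)
  qed
next
  case (add g h)
  then show ?case by (simp add: dpoly_derivation_add algebra_simps)
qed

lemma dpoly_derivation: "derivation (dpoly_derivation X)"
  by unfold_locales (simp_all add: dpoly_derivation_add dpoly_derivation_mult)

lemma dpoly_derivation_dvar: "dpoly_derivation X (dvar i l) = X (i, l)"
  by (simp add: dvar_def dpoly_derivation_single monomial_derivation_def)

lemma dpoly_derivation_const: "dpoly_derivation X (Poly_Mapping.single 0 c) = 0"
  by (simp add: dpoly_derivation_single monomial_derivation_def)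

interpretation Dx: derivation "Dx :: 'a::comm_ring_1 dpoly \<Rightarrow> 'a dpoly"
  unfolding Dx_def by (rule dpoly_derivation)

lemma Dx_dvar: "Dx (dvar i l) = dvar i (Suc l)"
  by (simp add: Dx_def dpoly_derivation_dvar)

lemma Dx_const: "Dx (Poly_Mapping.single 0 c) = 0"
  by (simp add: Dx_def dpoly_derivation_const)

lemma diff_polys_const: "Poly_Mapping.single 0 c \<in> diff_polys N"
  by (auto simp: diff_polys_def)

lemma diff_polys_dvar: "i \<le> N - 2 \<Longrightarrow> dvar i l \<in> diff_polys N"
  by (auto simp: diff_polys_def dvar_def split: if_splits)

lemma diff_polys_add: "f \<in> diff_polys N \<Longrightarrow> g \<in> diff_polys N \<Longrightarrow> f + g \<in> diff_polys N"
  using keys_add[of f g] by (fastforce simp: diff_polys_def)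

lemma diff_polys_mult: "f \<in> diff_polys N \<Longrightarrow> g \<in> diff_polys N \<Longrightarrow> f * g \<in> diff_polys N"
proof -
  assume f: "f \<in> diff_polys N" and g: "g \<in> diff_polys N"
  have "i \<le> N - 2" if m: "m \<in> Poly_Mapping.keys (f * g)" and v: "(i, l) \<in> Poly_Mapping.keys m" for m i l
  proof -
    obtain a b where "m = a + b" "a \<in> Poly_Mapping.keys f" "b \<in> Poly_Mapping.keys g"
      using keys_mult[of f g] m by auto
    moreover from this v have "(i, l) \<in> Poly_Mapping.keys a \<or> (i, l) \<in> Poly_Mapping.keys b"
      using keys_add[of a b] by auto
    ultimately show ?thesis using f g by (auto simp: diff_polys_def)
  qed
  then show ?thesis by (auto simp: diff_polys_def)
qed

lemma diff_polys_uminus: "f \<in> diff_polys N \<Longrightarrow> - f \<in> diff_polys N"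
  using diff_polys_mult[OF diff_polys_const[of "-1" N], of f] by (simp add: single_uminus)

lemma diff_polys_induct [consumes 1, case_names const var add mult]:
  assumes "f \<in> diff_polys N" "\<And>c. P (Poly_Mapping.single 0 c)" "\<And>i l. i \<le> N - 2 \<Longrightarrow> P (dvar i l)"
    "\<And>f g. f \<in> diff_polys N \<Longrightarrow> g \<in> diff_polys N \<Longrightarrow> P f \<Longrightarrow> P g \<Longrightarrow> P (f + g)"
    "\<And>f g. f \<in> diff_polys N \<Longrightarrow> g \<in> diff_polys N \<Longrightarrow> P f \<Longrightarrow> P g \<Longrightarrow> P (f * g)"
  shows "P f"
proof -
  have "f \<in> diff_polys N \<and> P f"
  proof (rule dpoly_induct[where V="\<lambda>(i, l). i \<le> N - 2" and f=f])
    fix m v assume "m \<in> Poly_Mapping.keys f" "v \<in> Poly_Mapping.keys m"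
    with assms(1) show "case v of (i, l) \<Rightarrow> i \<le> N - 2" unfolding diff_polys_def by blast
  qed (use assms in \<open>auto intro: diff_polys_const diff_polys_dvar diff_polys_add diff_polys_mult\<close>)
  then show ?thesis by simp
qed

lemma diff_polys_Dx: "f \<in> diff_polys N \<Longrightarrow> Dx f \<in> diff_polys N"
proof (induction rule: diff_polys_induct)
  case (const c)
  show ?case using diff_polys_const[of 0 N] by (simp add: Dx_const)
qed (auto simp: Dx_dvar Dx.d_mult intro: diff_polys_dvar diff_polys_add diff_polys_mult)

section \<open>Evaluation of differential polynomials\<close>

definition monomial_eval :: "(nat \<Rightarrow> real \<Rightarrow> 'a::real_normed_field) \<Rightarrow> ((nat \<times> nat) \<Rightarrow>\<^sub>0 nat) \<Rightarrow> real \<Rightarrow> 'a" where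
  "monomial_eval u m x = (\<Prod>(i, l)\<in>Poly_Mapping.keys m. ((Dfun ^^ l) (u i) x) ^ Poly_Mapping.lookup m (i, l))"

lemma monomial_eval_add: "monomial_eval u (m + m') x = monomial_eval u m x * monomial_eval u m' x"
proof -
  let ?V = "Poly_Mapping.keys m \<union> Poly_Mapping.keys m'"
  have superset: "monomial_eval u n x = (\<Prod>(i, l)\<in>?V. ((Dfun ^^ l) (u i) x) ^ Poly_Mapping.lookup n (i, l))"
    if "Poly_Mapping.keys n \<subseteq> ?V" for n
    unfolding monomial_eval_def
    by (rule prod.mono_neutral_left) (use that in \<open>auto simp: in_keys_iff\<close>)
  show ?thesis
    using keys_add[of m m'] by (simp add: superset lookup_add power_add prod.distrib case_prod_unfold)
qed

lemma dpoly_eval_single: "dpoly_eval u (Poly_Mapping.single m c) x = c * monomial_eval u m x"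
  by (simp add: dpoly_eval_def monomial_eval_def)

lemma dpoly_eval_add: "dpoly_eval u (f + g) x = dpoly_eval u f x + dpoly_eval u g x"
  unfolding dpoly_eval_def
  by (rule setsum_keys_plus_distrib) (simp_all add: distrib_right)

lemma dpoly_eval_0: "dpoly_eval u 0 x = 0"
  by (simp add: dpoly_eval_def)

lemma dpoly_eval_uminus: "dpoly_eval u (- f) x = - dpoly_eval u f x"
  using dpoly_eval_add[of u f "- f" x] by (simp add: dpoly_eval_0 eq_neg_iff_add_eq_0 add.commute)

lemma dpoly_eval_mult: "dpoly_eval u (f * g) x = dpoly_eval u f x * dpoly_eval u g x"
proof (induction f rule: poly_mapping_single_induct)
  case (single m a)
  show ?case
  proof (induction g rule: poly_mapping_single_induct)
    case (single m' b)
    show ?case by (simp add: mult_single dpoly_eval_single monomial_eval_add)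
  qed (simp_all add: dpoly_eval_0 dpoly_eval_add algebra_simps)
qed (simp_all add: dpoly_eval_0 dpoly_eval_add algebra_simps)

lemma dpoly_eval_const: "dpoly_eval u (Poly_Mapping.single 0 c) x = c"
  by (simp add: dpoly_eval_single monomial_eval_def)

lemma dpoly_eval_dvar: "dpoly_eval u (dvar i l) x = (Dfun ^^ l) (u i) x"
  by (simp add: dvar_def dpoly_eval_single monomial_eval_def)

text \<open>Smoothness and the formula for the derivative are proved together because the product
  step of the second uses the first.\<close>

lemma dpoly_eval_Dx:
  assumes I: "open I" and u: "\<And>i. i \<le> N - 2 \<Longrightarrow> smooth I (u i)" and f: "f \<in> diff_polys N"
  shows "smooth I (dpoly_eval u f) \<and> (\<forall>x\<in>I. Dfun (dpoly_eval u f) x = dpoly_eval u (Dx f) x)"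
  using f
proof (induction rule: diff_polys_induct)
  case (const c)
  have "dpoly_eval u (Poly_Mapping.single 0 c) = (\<lambda>x. c)" by (intro ext) (rule dpoly_eval_const)
  then show ?case by (simp add: smooth_const[OF I] Dx_const dpoly_eval_0)
next
  case (var i l)
  have "smooth I ((Dfun ^^ l) (u i))" using u[OF var] by (induction l) (auto intro: smooth_Dfun)
  moreover have "dpoly_eval u (dvar i l) = (Dfun ^^ l) (u i)" by (intro ext) (rule dpoly_eval_dvar)
  ultimately show ?case by (simp add: Dx_dvar dpoly_eval_dvar)
next
  case (add f g)
  have "dpoly_eval u (f + g) = dpoly_eval u f + dpoly_eval u g" by (intro ext) (simp add: dpoly_eval_add)
  with add show ?case
    by (auto simp: smooth_add[OF I] Dfun_add smooth_differentiable dpoly_eval_add simp del: plus_fun_apply)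
next
  case (mult f g)
  have "dpoly_eval u (f * g) = dpoly_eval u f * dpoly_eval u g" by (intro ext) (simp add: dpoly_eval_mult)
  with mult show ?case
    by (auto simp: smooth_mult[OF I] Dfun_mult smooth_differentiable dpoly_eval_add dpoly_eval_mult Dx.d_mult
      simp del: times_fun_apply)
qed

text \<open>Membership in \<open>diff_polys N\<close> is part of the relation, so one transfer shows
  both that the coefficients of fractional powers are differential polynomials and what their values
  are.\<close>

definition eval_rel ::
  "real set \<Rightarrow> nat \<Rightarrow> (nat \<Rightarrow> real \<Rightarrow> 'a::real_normed_field) \<Rightarrow> (real \<Rightarrow> 'a) \<Rightarrow> 'a dpoly \<Rightarrow> bool" where
  "eval_rel I N u f p \<longleftrightarrow> p \<in> diff_polys N \<and> (\<forall>x\<in>I. f x = dpoly_eval u p x)"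

lemma eval_relation:
  assumes I: "open I" and u: "\<And>i. i \<le> N - 2 \<Longrightarrow> smooth I (u i)"
  shows "coefficient_relation Dfun Dx (eval_rel I N u)"
proof (rule coefficient_relation.intro[OF pre_derivation_Dfun Dx.pre_derivation_axioms], unfold_locales)
  show "eval_rel I N u 0 0"
    using diff_polys_const[of 0 N] by (simp add: eval_rel_def dpoly_eval_0)
  show "eval_rel I N u 1 1"
    using diff_polys_const[of 1 N] dpoly_eval_const[of u 1] by (simp add: eval_rel_def)
  fix f p assume f: "eval_rel I N u f p"
  show "eval_rel I N u (- f) (- p)"
    using f by (auto simp: eval_rel_def dpoly_eval_uminus intro: diff_polys_uminus)
  show "eval_rel I N u (Dfun f) (Dx p)"
    unfolding eval_rel_def
  proof (intro conjI ballI)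
    have p: "p \<in> diff_polys N" using f by (simp add: eval_rel_def)
    then show "Dx p \<in> diff_polys N" by (rule diff_polys_Dx)
    fix x assume x: "x \<in> I"
    have e: "smooth I (dpoly_eval u p)" "\<forall>x\<in>I. Dfun (dpoly_eval u p) x = dpoly_eval u (Dx p) x"
      using dpoly_eval_Dx[OF I u p] by auto
    have "Dfun f x = Dfun (dpoly_eval u p) x"
      by (rule differentiable_cong_open(2)[OF I x]) (use f smooth_differentiable[OF e(1) x] in \<open>auto simp: eval_rel_def\<close>)
    then show "Dfun f x = dpoly_eval u (Dx p) x" using e x by simp
  qed
qed (auto simp: eval_rel_def dpoly_eval_add dpoly_eval_mult intro: diff_polys_add diff_polys_mult)

lemma Dx_N_inverse:
  assumes "0 < N" shows "Poly_Mapping.single 0 (1 / of_nat N) * of_nat N = (1 :: 'a::field_char_0 dpoly)"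
proof -
  have "Poly_Mapping.single 0 (1 / of_nat N) * of_nat N
    = (Poly_Mapping.single 0 (1 / of_nat N) * Poly_Mapping.single 0 (of_nat N) :: 'a dpoly)" by simp
  also have "\<dots> = 1" unfolding mult_single using assms by simp
  finally show ?thesis .
qed

lemma eval_frac_power:
  fixes u :: "nat \<Rightarrow> real \<Rightarrow> 'a::real_normed_field"
  assumes N: "0 < N" and I: "open I" and u: "\<And>i. i \<le> N - 2 \<Longrightarrow> smooth I (u i)"
  shows "eval_rel I N u (frac_power Dfun N (GD_op N u) m n) (frac_power Dx N (generic_L N) m n)"
proof -
  interpret coefficient_relation Dfun Dx "eval_rel I N u" by (rule eval_relation[OF I u])
  show ?thesis
    unfolding generic_L_def
  proof (rule rel_frac_power[OF _ Dx_N_inverse[OF N] _ GD_op_monic GD_op_monic])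
    show "(\<lambda>x. 1 / of_nat N) * of_nat N = (1 :: real \<Rightarrow> 'a)"
      using N by (intro ext) (simp add: of_nat_fun_apply)
    show "eval_rel I N u (\<lambda>x. 1 / of_nat N) (Poly_Mapping.single 0 (1 / of_nat N))"
      by (simp add: eval_rel_def dpoly_eval_const diff_polys_const)
    show "eval_rel I N u (GD_op N u i) (GD_op N (\<lambda>i. dvar i 0) i)" for i
      using rel_0 rel_1 by (auto simp: GD_op_def eval_rel_def dpoly_eval_dvar diff_polys_dvar)
  qed
qed

text \<open>Membership comes as a by-product of evaluation, here at u = 0.\<close>

lemma frac_power_diff_polys:
  assumes "0 < N"
  shows "frac_power Dx N (generic_L N) m n \<in> (diff_polys N :: 'a::real_normed_field dpoly set)"
  using eval_frac_power[OF assms open_UNIV, of "\<lambda>i x. 0 :: 'a"] smooth_const[OF open_UNIV, of "0::'a"]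
  by (auto simp: eval_rel_def)

section \<open>Residues of commutators and the flows\<close>

context derivation
begin

lemma psdo_commutator_eq: "psdo_commutator d R S = R \<odot> S - S \<odot> R"
  by (rule ext) (simp add: psdo_commutator_def)

text \<open>The index set may be adapted to vanishing binomial coefficients, so that both products
  of a commutator become sums over the same pairs.\<close>

lemma psdo_mult_eq_sum:
  assumes R: "order_le a R" and S: "order_le b S" and Z: "finite Z" "\<And>i j. (i, j) \<in> Z \<Longrightarrow> n \<le> i + j"
    and zero: "\<And>i j. (i, j) \<notin> Z \<Longrightarrow> n \<le> i + j \<Longrightarrow> R i = 0 \<or> S j = 0 \<or> int_choose i (nat (i + j - n)) = 0"
  shows "(R \<odot> S) n = (\<Sum>(i, j)\<in>Z. of_int (int_choose i (nat (i + j - n))) * R i * (d ^^ nat (i + j - n)) (S j))"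
  unfolding psdo_mult_def
proof (rule sum.mono_neutral_cong)
  have "{(i, j). R i \<noteq> 0 \<and> S j \<noteq> 0 \<and> n \<le> i + j} \<subseteq> {n-b..a} \<times> {n-a..b}"
    using R S by (force simp: order_le_def not_less[symmetric])
  then show "finite {(i, j). R i \<noteq> 0 \<and> S j \<noteq> 0 \<and> n \<le> i + j}" by (rule finite_subset) simp
  show "(case p of (i, j) \<Rightarrow> of_int (int_choose i (nat (i + j - n))) * R i * (d ^^ nat (i + j - n)) (S j)) = 0"
    if "p \<in> Z - {(i, j). R i \<noteq> 0 \<and> S j \<noteq> 0 \<and> n \<le> i + j}" for p
    using that Z(2) by (cases p) auto
  show "(case p of (i, j) \<Rightarrow> of_int (int_choose i (nat (i + j - n))) * R i * (d ^^ nat (i + j - n)) (S j)) = 0"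
    if "p \<in> {(i, j). R i \<noteq> 0 \<and> S j \<noteq> 0 \<and> n \<le> i + j} - Z" for p
    using that zero by (cases p) fastforce
qed (use Z in auto)

lemma psdo_mult_differential:
  assumes "order_le a R" "order_le b S" "\<And>i. i < 0 \<Longrightarrow> R i = 0" "\<And>i. i < 0 \<Longrightarrow> S i = 0" "n < 0"
  shows "(R \<odot> S) n = 0"
proof -
  have "(R \<odot> S) n = (\<Sum>(i, j)\<in>{}. of_int (int_choose i (nat (i + j - n))) * R i * (d ^^ nat (i + j - n)) (S j))"
  proof (rule psdo_mult_eq_sum[OF assms(1,2)])
    fix i j
    show "R i = 0 \<or> S j = 0 \<or> int_choose i (nat (i + j - n)) = 0"
      using assms(3)[of i] assms(4)[of j] int_choose_eq_0[of i "nat (i + j - n)"] \<open>n < 0\<close>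
      by (cases "i < 0"; cases "j < 0") auto
  qed auto
  then show ?thesis by simp
qed

text \<open>The primitive that n integrations by parts produce; its derivative telescopes.\<close>

lemma d_alternating_sum:
  "d (\<Sum>s<n. (-1) ^ s * (d ^^ s) a * (d ^^ (n - 1 - s)) b) = a * (d ^^ n) b - (-1) ^ n * (d ^^ n) a * b"
proof -
  define t where "t s = (-1) ^ s * (d ^^ s) a * (d ^^ (n - s)) b" for s
  have d1: "d ((-1) ^ s) = 0" for s using d_of_int[of "(-1) ^ s"] by simp
  have "d ((-1) ^ s * (d ^^ s) a * (d ^^ (n - 1 - s)) b) = t s - t (Suc s)" if "s < n" for s
  proof -
    have "d ((d ^^ (n - 1 - s)) b) = (d ^^ (n - s)) b"
      using that by (metis Suc_diff_Suc diff_Suc_eq_diff_pred funpow.simps(2) comp_apply One_nat_def diff_commute)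
    then show ?thesis by (simp add: t_def d_mult d1 algebra_simps)
  qed
  then have "d (\<Sum>s<n. (-1) ^ s * (d ^^ s) a * (d ^^ (n - 1 - s)) b) = (\<Sum>s<n. t s - t (Suc s))"
    unfolding d_sum by (intro sum.cong) auto
  also have "\<dots> = t 0 - t n" by (rule sum_lessThan_telescope')
  finally show ?thesis by (simp add: t_def)
qed

text \<open>Each pair of coefficients contributes a difference that integration by parts makes
  exact. The primitive is written out so that it can be recognised as a differential
  polynomial.\<close>

lemma residue_commutator:
  assumes P: "order_le a P" "\<And>i. i < 0 \<Longrightarrow> P i = 0" and S: "order_le b S"
  shows "psdo_res (psdo_commutator d P S) = d (\<Sum>(i, j)\<in>Sigma {0..a} (\<lambda>i. {-1-i..-1}).
    of_int (int_choose i (nat (i + j + 1))) * (\<Sum>s<nat (i + j + 1). (-1) ^ s * (d ^^ s) (P i) * (d ^^ (nat (i + j + 1) - 1 - s)) (S j)))"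
proof -
  \<comment> \<open>If both i and j are nonnegative, the number i + j + 1 of derivatives exceeds
    each of them and both binomial coefficients vanish; this leaves j negative.\<close>
  let ?Z = "Sigma {0..a} (\<lambda>i. {-1-i..-1})" and ?n = "\<lambda>i j. nat (i + j + 1)"
  have 1: "(P \<odot> S) (-1) = (\<Sum>(i, j)\<in>?Z. of_int (int_choose i (nat (i + j - - 1))) * P i * (d ^^ nat (i + j - - 1)) (S j))"
  proof (rule psdo_mult_eq_sum[OF P(1) S])
    fix i j :: int assume "(i, j) \<notin> ?Z" "-1 \<le> i + j"
    then consider "i < 0" | "a < i" | "0 \<le> i" "0 \<le> j" by force
    then show "P i = 0 \<or> S j = 0 \<or> int_choose i (nat (i + j - - 1)) = 0"
      by cases (use P int_choose_eq_0[of i "nat (i + j - - 1)"] in \<open>auto simp: order_le_def\<close>)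
  qed auto
  have "(S \<odot> P) (-1) = (\<Sum>(j, i)\<in>prod.swap ` ?Z. of_int (int_choose j (nat (j + i - - 1))) * S j * (d ^^ nat (j + i - - 1)) (P i))"
  proof (rule psdo_mult_eq_sum[OF S P(1)])
    fix j i :: int assume "(j, i) \<notin> prod.swap ` ?Z" "-1 \<le> j + i"
    then have "(i, j) \<notin> ?Z" "-1 \<le> i + j" by force+
    then consider "i < 0" | "a < i" | "0 \<le> i" "0 \<le> j" by force
    then show "S j = 0 \<or> P i = 0 \<or> int_choose j (nat (j + i - - 1)) = 0"
      by cases (use P int_choose_eq_0[of j "nat (j + i - - 1)"] in \<open>auto simp: order_le_def\<close>)
  qed auto
  also have "\<dots> = (\<Sum>(i, j)\<in>?Z. of_int (int_choose j (nat (j + i - - 1))) * S j * (d ^^ nat (j + i - - 1)) (P i))"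
    by (subst sum.reindex) (auto simp: case_prod_unfold inj_on_def intro!: sum.cong)
  finally have 2: "(S \<odot> P) (-1) = \<dots>" .
  have "psdo_res (psdo_commutator d P S) = (\<Sum>(i, j)\<in>?Z.
      of_int (int_choose i (nat (i + j - - 1))) * P i * (d ^^ nat (i + j - - 1)) (S j)
      - of_int (int_choose j (nat (j + i - - 1))) * S j * (d ^^ nat (j + i - - 1)) (P i))"
    unfolding psdo_res_def psdo_commutator_def 1 2 by (simp add: sum_subtractf case_prod_unfold)
  also have "\<dots> = (\<Sum>(i, j)\<in>?Z. d (of_int (int_choose i (?n i j))
      * (\<Sum>s<?n i j. (-1) ^ s * (d ^^ s) (P i) * (d ^^ (?n i j - 1 - s)) (S j))))"
  proof (rule sum.cong[OF refl])
    fix p assume "p \<in> ?Z"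
    then obtain i j where p: "p = (i, j)" and ij: "0 \<le> i" "i \<le> a" "- 1 - i \<le> j" "j \<le> - 1" by auto
    have n: "nat (i + j - - 1) = ?n i j" "nat (j + i - - 1) = ?n i j" by (simp_all add: add.commute)
    \<comment> \<open>Negating the upper index turns the binomial coefficient of j into that of i,
      with precisely the sign of repeated integration by parts.\<close>
    have "int (?n i j) - j - 1 = i" using ij by simp
    then have C: "int_choose j (?n i j) = (-1) ^ ?n i j * int_choose i (?n i j)"
      using int_choose_negated_upper[of j "?n i j"] by simp
    have "d (of_int (int_choose i (?n i j)) * (\<Sum>s<?n i j. (-1) ^ s * (d ^^ s) (P i) * (d ^^ (?n i j - 1 - s)) (S j)))
      = of_int (int_choose i (?n i j)) * (P i * (d ^^ ?n i j) (S j) - (-1) ^ ?n i j * (d ^^ ?n i j) (P i) * S j)"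
      by (simp only: d_mult d_of_int d_alternating_sum mult_zero_left add_0_right)
    also have "\<dots> = of_int (int_choose i (?n i j)) * P i * (d ^^ ?n i j) (S j)
      - of_int (int_choose j (?n i j)) * S j * (d ^^ ?n i j) (P i)"
      unfolding C by (simp add: algebra_simps)
    finally show "(case p of (i, j) \<Rightarrow> of_int (int_choose i (nat (i + j - - 1))) * P i * (d ^^ nat (i + j - - 1)) (S j)
      - of_int (int_choose j (nat (j + i - - 1))) * S j * (d ^^ nat (j + i - - 1)) (P i))
      = (case p of (i, j) \<Rightarrow> d (of_int (int_choose i (?n i j))
        * (\<Sum>s<?n i j. (-1) ^ s * (d ^^ s) (P i) * (d ^^ (?n i j - 1 - s)) (S j))))"
      unfolding p prod.case n by (rule sym)
  qed
  finally show ?thesis by (simp add: d_sum case_prod_unfold)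
qed

lemma psdo_power_add:
  assumes R: "order_le 1 R"
  shows "psdo_power d R (m + n) = psdo_power d R m \<odot> psdo_power d R n"
proof (induction m)
  case 0
  show ?case unfolding psdo_power_0 by (simp add: psdo_mult_1_left[OF order_le_power[OF R]])
next
  case (Suc m)
  then show ?case using psdo_mult_assoc[OF R order_le_power[OF R] order_le_power[OF R], of m n] by simp
qed

text \<open>At negative indices because P and L are differential operators. At high indices because
  the m-th power of the root commutes with L, so [P, L] = [L, Q] with Q of order at most -1: the
  order is at most N - 1, and there the leading products cancel. Thus the flow preserves the shape
  of L.\<close>

lemma commutator_plus_part:
  fixes u :: "nat \<Rightarrow> 'r" and m :: nat
  assumes c: "c * of_nat N = (1 :: 'r)" and N: "2 \<le> N"
  defines "L \<equiv> GD_op N u" and "P \<equiv> psdo_plus_part (frac_power d N (GD_op N u) m)"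
  assumes i: "i < 0 \<or> int N - 1 \<le> i"
  shows "psdo_commutator d P L i = 0"
proof -
  let ?A = "psdo_root d N L"
  let ?M = "psdo_power d ?A m"
  have L: "order_le (int N) L" unfolding L_def using GD_op_monic by (rule monic_orderD)
  have A: "order_le 1 ?A" unfolding L_def by (rule monic_orderD[OF psdo_root_monic[OF c GD_op_monic]])
  have AN: "psdo_power d ?A N = L" unfolding L_def by (rule psdo_root_power[OF c GD_op_monic])
  have M: "order_le (int m) ?M" by (rule order_le_power[OF A])
  have P_eq: "P = psdo_plus_part ?M" unfolding P_def L_def frac_power_def ..
  have P: "order_le (int m) P" unfolding P_eq using M by (auto simp: order_le_def psdo_plus_part_def)
  consider "i < 0" | "int N - 1 \<le> i" using i by blast
  then show ?thesis
  proof cases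
    case 1
    have "\<And>i. i < 0 \<Longrightarrow> P i = 0" "\<And>i. i < 0 \<Longrightarrow> L i = 0"
      using N by (auto simp: P_eq psdo_plus_part_def L_def GD_op_def)
    then show ?thesis
      using psdo_mult_differential[OF P L _ _ 1] psdo_mult_differential[OF L P _ _ 1]
      by (simp add: psdo_commutator_def)
  next
    case 2
    define Q where "Q = ?M - P"
    have Q: "order_le (-1) Q" by (auto simp: Q_def order_le_def P_eq psdo_plus_part_def)
    have Qm: "order_le (int m) Q" using Q by (rule order_le_mono) simp
    have P': "P = ?M - Q" by (simp add: Q_def)
    have "?M \<odot> psdo_power d ?A N = psdo_power d ?A N \<odot> ?M"
      by (simp only: psdo_power_add[OF A, symmetric] add.commute)
    then have "?M \<odot> L = L \<odot> ?M" by (simp only: AN)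
    then have "P \<odot> L - L \<odot> P = L \<odot> Q - Q \<odot> L"
      unfolding P' psdo_mult_diff_left[OF M Qm L] psdo_mult_diff_right[OF L M Qm] by simp
    then have "psdo_commutator d P L i = (L \<odot> Q) i - (Q \<odot> L) i"
      unfolding psdo_commutator_eq by (simp only: minus_apply)
    also have "\<dots> = 0"
    proof (cases "i = int N - 1")
      case True
      then show ?thesis using psdo_mult_top[OF L Q] psdo_mult_top[OF Q L] by simp
    next
      case False
      then have "int N - 1 < i" using 2 by simp
      then show ?thesis using order_le_mult[OF L Q] order_le_mult[OF Q L] by (simp add: order_le_def)
    qed
    finally show ?thesis .
  qed
qed

text \<open>As D commutes with d, the map sending R to D R - [P, R] obeys the product rule. It kills
  L, the N-th power of the root; telescoping shows that it kills the root, and then all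
  powers.\<close>

lemma isospectral_root_power:
  assumes D: "derivation D" and comm: "\<And>a. D (d a) = d (D a)"
    and c: "c * of_nat N = (1 :: 'r)" and L: "monic_order (int N) L" and P: "order_le p P"
    and DL: "\<And>i. D (L i) = psdo_commutator d P L i"
  shows "D (psdo_power d (psdo_root d N L) n i) = psdo_commutator d P (psdo_power d (psdo_root d N L) n) i"
proof -
  interpret D: derivation D by (rule D)
  let ?A = "psdo_root d N L"
  let ?S = "psdo_power d ?A"
  let ?D = "\<lambda>R. (\<lambda>i. D (R i))"
  have A: "monic_order 1 ?A" by (rule psdo_root_monic[OF c L])
  have oA: "order_le 1 ?A" and oS: "order_le (int n) (?S n)" for n
    using monic_orderD(1)[OF A] order_le_power by auto
  have oD: "order_le a (?D R)" if "order_le a R" for a R using that by (simp add: order_le_def)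
  have comm_funpow: "D ((d ^^ k) a) = (d ^^ k) (D a)" for k a by (induction k) (simp_all add: comm)
  have Dmult: "?D (R \<odot> S) = ?D R \<odot> S + R \<odot> ?D S" if R: "order_le a R" and S: "order_le b S" for a b R S
  proof
    fix n
    show "D ((R \<odot> S) n) = (?D R \<odot> S + R \<odot> ?D S) n"
      by (simp add: psdo_mult_eq[OF R S] psdo_mult_eq[OF oD[OF R] S] psdo_mult_eq[OF R oD[OF S]] D.d_sum D.d_mult
        comm_funpow sum.distrib[symmetric] algebra_simps)
  qed
  define X where "X = ?D ?A - (P \<odot> ?A - ?A \<odot> P)"
  define Y where "Y n = ?D (?S n) - (P \<odot> ?S n - ?S n \<odot> P)" for n
  have oPA: "order_le (p + 1) (P \<odot> ?A)" "order_le (p + 1) (?A \<odot> P)"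
    using order_le_mult[OF P oA] order_le_mult[OF oA P] by (simp_all add: add.commute)
  \<comment> \<open>A common order bound for the differentiated power and both products with P,
    whatever the sign of p.\<close>
  let ?b = "\<lambda>n. max (int n) (p + int n)"
  have oPS: "order_le (?b n) (P \<odot> ?S n)" "order_le (?b n) (?S n \<odot> P)" "order_le (?b n) (?D (?S n))" for n
    using order_le_mono[OF order_le_mult[OF P oS]] order_le_mono[OF order_le_mult[OF oS P]] order_le_mono[OF oD[OF oS]]
    by auto
  let ?a = "max 1 (p + 1)"
  have o1: "order_le ?a (?D ?A)" "order_le ?a (P \<odot> ?A)" "order_le ?a (?A \<odot> P)"
    using oD[OF oA] oPA by (auto intro: order_le_mono)
  have oX: "order_le ?a X" unfolding X_def by (intro order_le_diff o1)
  have Y0: "Y 0 = 0"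
  proof -
    have "?D (?S 0) = 0" by (rule ext) simp
    then show ?thesis
      unfolding Y_def unfolding psdo_power_0
      by (simp add: psdo_mult_1_left[OF P] psdo_mult_1_right[OF P])
  qed
  have YS: "Y (Suc n) = X \<odot> ?S n + ?A \<odot> Y n" for n
  proof -
    have 1: "X \<odot> ?S n = ?D ?A \<odot> ?S n - ((P \<odot> ?A) \<odot> ?S n - (?A \<odot> P) \<odot> ?S n)"
      unfolding X_def psdo_mult_diff_left[OF o1(1) order_le_diff[OF o1(2,3)] oS]
        psdo_mult_diff_left[OF o1(2,3) oS] ..
    have 2: "?A \<odot> Y n = ?A \<odot> ?D (?S n) - (?A \<odot> (P \<odot> ?S n) - ?A \<odot> (?S n \<odot> P))"
      unfolding Y_def psdo_mult_diff_right[OF oA oPS(3) order_le_diff[OF oPS(1,2)]]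
        psdo_mult_diff_right[OF oA oPS(1,2)] ..
    have 3: "(P \<odot> ?A) \<odot> ?S n = P \<odot> ?S (Suc n)" using psdo_mult_assoc[OF P oA oS] by simp
    have 4: "(?A \<odot> P) \<odot> ?S n = ?A \<odot> (P \<odot> ?S n)" by (rule psdo_mult_assoc[OF oA P oS])
    have 5: "?A \<odot> (?S n \<odot> P) = ?S (Suc n) \<odot> P" using psdo_mult_assoc[OF oA oS P] by simp
    have 6: "?D (?S (Suc n)) = ?D ?A \<odot> ?S n + ?A \<odot> ?D (?S n)" using Dmult[OF oA oS] by simp
    have "Y (Suc n) = ?D ?A \<odot> ?S n + ?A \<odot> ?D (?S n) - (P \<odot> ?S (Suc n) - ?S (Suc n) \<odot> P)"
      by (simp only: Y_def 6)
    moreover have "a + b - (p - q) = a - (p - r) + (b - (r - q))" for a b p q r :: "'r psdo"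
      by (simp add: algebra_simps)
    ultimately show ?thesis unfolding 1 2 3 4 5 by (rule trans)
  qed
  have "X = 0"
  proof (rule telescoping_cancel[where Y=Y and P="?S" and N=N, OF A _ oX Y0 YS c])
    show "monic_order (int n) (?S n)" for n by (rule monic_order_power[OF A])
    show "Y N = 0"
      unfolding Y_def psdo_root_power[OF c L] using DL by (intro ext) (simp add: psdo_commutator_def)
  qed
  then have "Y n = 0" for n
    by (induction n) (simp_all only: Y0 YS psdo_mult_0_left psdo_mult_0_right add_0_left)
  then show ?thesis
    unfolding Y_def psdo_commutator_eq by (metis eq_iff_diff_eq_0 fun_cong)
qed

end

lemma diff_polys_sum: "(\<And>k. k \<in> K \<Longrightarrow> f k \<in> diff_polys N) \<Longrightarrow> (\<Sum>k\<in>K. f k) \<in> diff_polys N"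
  using diff_polys_const[of 0 N] by (induction K rule: infinite_finite_induct) (auto intro: diff_polys_add)

lemma diff_polys_of_int: "of_int k \<in> diff_polys N"
proof (cases k)
  case (nonneg n)
  then show ?thesis using diff_polys_const[of "of_nat n" N] by simp
next
  case (neg n)
  then show ?thesis using diff_polys_uminus[OF diff_polys_const[of "of_nat (Suc n)" N]] by (simp del: of_nat_Suc)
qed

lemma diff_polys_Dx_funpow: "f \<in> diff_polys N \<Longrightarrow> (Dx ^^ n) f \<in> diff_polys N"
  by (induction n) (auto intro: diff_polys_Dx)

lemma diff_polys_minus_1_power: "(-1) ^ s \<in> diff_polys N"
  using diff_polys_of_int[of "(-1) ^ s" N] by simp

section \<open>Conservation along the Gelfand-Dickey flows\<close>

lemma GD_flow_derivation: "derivation (GD_flow N m)"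
  unfolding GD_flow_def by (rule dpoly_derivation)

lemma GD_flow_dvar: "GD_flow N m (dvar i l) = (Dx ^^ l) (GD_rhs N m (int i))"
  by (simp add: GD_flow_def dpoly_derivation_dvar)

lemma GD_flow_const: "GD_flow N m (Poly_Mapping.single 0 c) = 0"
  by (simp add: GD_flow_def dpoly_derivation_const)

text \<open>The commutator of two derivations is a derivation. It vanishes on constants, and on the
  variables because the image of the l-th derivative of a coefficient was chosen as the l-th
  derivative of the image.\<close>

lemma GD_flow_Dx: "GD_flow N m (Dx f) = Dx (GD_flow N m f)"
proof -
  interpret D: derivation "GD_flow N m" by (rule GD_flow_derivation)
  show ?thesis
  proof (rule dpoly_induct[where V="\<lambda>_. True" and f=f])
    show "GD_flow N m (Dx (Poly_Mapping.single 0 c)) = Dx (GD_flow N m (Poly_Mapping.single 0 c))" for c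
      by (simp add: Dx_const GD_flow_const)
  qed (simp_all add: Dx_dvar GD_flow_dvar Dx.d_mult D.d_mult algebra_simps)
qed

lemma first_integral:
  assumes N: "2 \<le> N"
  shows "GD_first_integral N m
    (Poly_Mapping.single 0 c * psdo_res (frac_power Dx N (generic_L N) n) :: 'a::real_normed_field dpoly)"
proof -
  let ?L = "generic_L N :: 'a dpoly psdo"
  let ?P = "psdo_plus_part (frac_power Dx N ?L m)" and ?S = "frac_power Dx N ?L n"
  interpret D: derivation "GD_flow N m" by (rule GD_flow_derivation)
  have inv: "Poly_Mapping.single 0 (1 / of_nat N) * of_nat N = (1 :: 'a dpoly)"
    using N by (intro Dx_N_inverse) simp
  have L: "monic_order (int N) ?L" unfolding generic_L_def by (rule GD_op_monic)
  have frac: "order_le (int k) (frac_power Dx N ?L k)" for k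
    unfolding frac_power_def by (intro Dx.order_le_power monic_orderD Dx.psdo_root_monic[OF inv L])
  have P: "order_le (int m) ?P" using frac by (auto simp: order_le_def psdo_plus_part_def)
  \<comment> \<open>The definition of the flow gives the Lax equation for the variable coefficients
    of L. At the remaining indices the coefficient is 0 or 1, and
    \<open>commutator_plus_part\<close> supplies the zero on the right.\<close>
  have DL: "GD_flow N m (?L i) = psdo_commutator Dx ?P ?L i" for i
  proof (cases "0 \<le> i \<and> i \<le> int N - 2")
    case True
    then have "?L i = dvar (nat i) 0" by (simp add: generic_L_def GD_op_def)
    then show ?thesis using True by (simp add: GD_flow_dvar GD_rhs_def)
  next
    case False
    then have "?L i = 0 \<or> ?L i = 1" by (auto simp: generic_L_def GD_op_def)
    moreover have "psdo_commutator Dx ?P ?L i = 0"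
      unfolding generic_L_def by (rule Dx.commutator_plus_part[OF inv N]) (use False in auto)
    ultimately show ?thesis by auto
  qed
  define g where "g = (\<Sum>(i, j)\<in>Sigma {0..int m} (\<lambda>i. {-1-i..-1}). of_int (int_choose i (nat (i + j + 1)))
    * (\<Sum>s<nat (i + j + 1). (-1) ^ s * (Dx ^^ s) (?P i) * (Dx ^^ (nat (i + j + 1) - 1 - s)) (?S j)))"
  have "GD_flow N m (psdo_res ?S) = psdo_res (psdo_commutator Dx ?P ?S)"
    unfolding psdo_res_def frac_power_def[of Dx N ?L n]
    by (rule Dx.isospectral_root_power[OF GD_flow_derivation GD_flow_Dx inv L P DL])
  also have "\<dots> = Dx g"
    unfolding g_def by (rule Dx.residue_commutator[OF P _ frac]) (simp add: psdo_plus_part_def)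
  finally have "GD_flow N m (Poly_Mapping.single 0 c * psdo_res ?S) = Dx (Poly_Mapping.single 0 c * g)"
    by (simp add: D.d_mult Dx.d_mult GD_flow_const Dx_const)
  moreover have "frac_power Dx N ?L k i \<in> diff_polys N" for k i
    using N by (intro frac_power_diff_polys) simp
  then have "?P i \<in> diff_polys N" "?S i \<in> diff_polys N" for i
    using diff_polys_const[of 0 N] by (auto simp: psdo_plus_part_def)
  then have "g \<in> diff_polys N"
    unfolding g_def
    by (auto intro!: diff_polys_sum diff_polys_mult diff_polys_of_int diff_polys_Dx_funpow diff_polys_minus_1_power
      simp: case_prod_unfold)
  then have "Poly_Mapping.single 0 c * g \<in> diff_polys N" by (intro diff_polys_mult diff_polys_const)
  ultimately show ?thesis unfolding GD_first_integral_def by blast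
qed

theorem theorem5p1:
  fixes N :: nat and \<kappa> :: "'a::real_normed_field"
  assumes "N \<ge> 2"
    and "even N \<Longrightarrow> \<kappa> = (-1) ^ (N div 2 + 1)"
    and "odd N \<Longrightarrow> \<kappa> \<in> {1, -1}"
  shows
    "(\<forall>(I :: real set) (u :: nat \<Rightarrow> real \<Rightarrow> 'a) H.
        open I \<and> (\<forall>i\<le>N - 2. smooth_on I (u i)) \<and> Hadamard_coefficients N \<kappa> I u H \<longrightarrow>
        (\<forall>j\<le>N - 2. \<forall>k\<ge>1. \<forall>x\<in>I.
           H k j x x = \<kappa> ^ k / pochhammer (1 - of_nat (j + 1) / of_nat N) k
             * psdo_res (frac_power Dfun N (GD_op N u) (k * N - (j + 1))) x))
   \<and> (\<forall>j\<le>N - 2. \<forall>k\<ge>1. \<exists>f\<in>diff_polys N.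
        (\<forall>(I :: real set) (u :: nat \<Rightarrow> real \<Rightarrow> 'a) H.
           open I \<and> (\<forall>i\<le>N - 2. smooth_on I (u i)) \<and> Hadamard_coefficients N \<kappa> I u H \<longrightarrow>
           (\<forall>x\<in>I. H k j x x = dpoly_eval u f x)) \<and>
        (\<forall>m\<ge>1. GD_first_integral N m f))"
proof -
  \<comment> \<open>For either parity \<kappa> is a sign, which is all that the operator calculus
    asks of it.\<close>
  have "\<kappa> \<in> {1, -1}"
    using assms(2,3) by (cases "even N") (auto simp: minus_one_power_iff)
  then have \<kappa>: "\<kappa> * \<kappa> = 1" by auto
  note diag = Hadamard_diagonal[OF \<open>N \<ge> 2\<close> \<kappa>]
  show ?thesis
  proof (intro conjI allI impI ballI)
    fix I :: "real set" and u :: "nat \<Rightarrow> real \<Rightarrow> 'a" and H and j k :: nat and x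
    assume "open I \<and> (\<forall>i\<le>N - 2. smooth_on I (u i)) \<and> Hadamard_coefficients N \<kappa> I u H"
      and "j \<le> N - 2" "1 \<le> k" "x \<in> I"
    then show "H k j x x = \<kappa> ^ k / pochhammer (1 - of_nat (j + 1) / of_nat N) k
             * psdo_res (frac_power Dfun N (GD_op N u) (k * N - (j + 1))) x"
      by (intro diag[of I]) auto
  next
    fix j k :: nat assume j: "j \<le> N - 2" and k: "1 \<le> k"
    let ?c = "\<kappa> ^ k / pochhammer (1 - of_nat (j + 1) / of_nat N) k" and ?n = "k * N - (j + 1)"
    \<comment> \<open>A universal density, built from the operator with independent variables as
      coefficients: it depends on N, \<kappa>, j and k, and evaluating it at any u gives the
      diagonal value.\<close>
    let ?f = "Poly_Mapping.single 0 ?c * psdo_res (frac_power Dx N (generic_L N) ?n)"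
    show "\<exists>f\<in>diff_polys N.
        (\<forall>I u H. open I \<and> (\<forall>i\<le>N - 2. smooth_on I (u i)) \<and> Hadamard_coefficients N \<kappa> I u H \<longrightarrow>
           (\<forall>x\<in>I. H k j x x = dpoly_eval u f x)) \<and>
        (\<forall>m\<ge>1. GD_first_integral N m f)"
    proof (intro bexI[of _ ?f] conjI allI impI ballI)
      fix m show "GD_first_integral N m ?f" by (rule first_integral[OF \<open>N \<ge> 2\<close>])
    next
      show "?f \<in> diff_polys N"
        unfolding psdo_res_def using \<open>N \<ge> 2\<close> by (intro diff_polys_mult diff_polys_const frac_power_diff_polys) simp
    next
      fix I :: "real set" and u :: "nat \<Rightarrow> real \<Rightarrow> 'a" and H x
      assume asm: "open I \<and> (\<forall>i\<le>N - 2. smooth_on I (u i)) \<and> Hadamard_coefficients N \<kappa> I u H" and x: "x \<in> I"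
      then have I: "open I" and u: "\<And>i. i \<le> N - 2 \<Longrightarrow> smooth I (u i)"
        by (auto intro: smooth_on_imp_smooth)
      have "H k j x x = ?c * psdo_res (frac_power Dfun N (GD_op N u) ?n) x"
        using asm x j k by (intro diag[of I]) auto
      also have "psdo_res (frac_power Dfun N (GD_op N u) ?n) x
          = dpoly_eval u (psdo_res (frac_power Dx N (generic_L N) ?n)) x"
        using eval_frac_power[OF _ I u, where n="-1"] \<open>N \<ge> 2\<close> x by (auto simp: eval_rel_def psdo_res_def)
      finally show "H k j x x = dpoly_eval u ?f x"
        by (simp add: dpoly_eval_mult dpoly_eval_const)
    qed
  qed
qed

end
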